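(* Let $d\le2$, $\epsilon>0$ and $t>d/2+\epsilon$, and let $K\in\Psi^{-t}$, i.e. $K$ is a pseudodifferential operator on $\mathbb{T}^d$ smoothing of order $t$. Let $R$ be the total variation functional $$R(u)=\sup_{\varphi\in C_0^\infty(\mathbb{T}^d),\ \|\varphi\|_\infty\le1}\int_{\mathbb{T}^d}(\nabla\cdot\varphi)\,u\,dx,$$ and let $\mu^\dagger\in\partial R(u^\dagger)$ satisfy the approximate source condition of order $r_1\ge0$: for some constant $C_1$ and all sufficiently small $\beta>0$, $\inf_{w\in Y}\{\|w\|_Y^2:\ S(\mu^\dagger-K^*w)\le\beta\}=C_1\beta^{-r_1}$. Put $\nu=\frac{t-d/2-\epsilon}{2t}$. Then for the choice $\alpha\simeq\delta^\kappa$, where $$\kappa=\begin{cases}\dfrac{1+r_1}{(2+r_1)(1-\nu)}&\text{for } r_1\le\dfrac{d+2\epsilon}{t},\\[2mm]1&\text{else},\end{cases}$$ we obtain the convergence rate $$\mathbb{E}\,D_R^{\mu_\alpha^\delta,\mu^\dagger}(U_\alpha^\delta,u^\dagger)\lesssim\begin{cases}\delta^{\frac{1}{(2+r_1)(1-\nu)}}\le\delta^{\frac1{2+r_1}}&\text{for } r_1\le\dfrac{d+2\epsilon}{t},\\[2mm]\delta^{\frac1{1+r_1}}&\text{else}.\end{cases}$$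
   Context: $Y=L^2(\mathbb{T}^d)$, and $X$ is a space of functions of bounded variation on $\mathbb{T}^d$ on which $R$ has trivial nullspace (e.g. the nullspace of constants is eliminated), with continuous embedding into $X_0=L^2(\mathbb{T}^d)$ in the sense $R(u)\ge C\|u\|_{L^2}$ for all $u\in X$ with some $C>0$ (this embedding is why $d\le2$). $\Psi^\rho$ denotes the pseudodifferential operators on $\mathbb{T}^d$ of order $\rho$. $K$ is assumed to extend to a bijective bounded linear operator smoothing by $t$ orders in the Sobolev scale, $K:H^r(\mathbb{T}^d)\to H^{r+t}(\mathbb{T}^d)$, and, with $L=K^*K$, the power $L^\nu$ maps $L^2(\mathbb{T}^d)$ onto $H^{2t\nu}(\mathbb{T}^d)$ isomorphically (as is the case for the inverse of a translation invariant (pseudo-)differential operator). The dual norm is $S(q)=\sup_{R(u)\le1}\langle q,u\rangle_{X^*\times X}$. $N$ is Gaussian white noise on $\mathbb{T}^d$: a centered Gaussian random variable in $\mathcal{D}'(\mathbb{T}^d)$ with $\mathbb{E}\langle N,\phi\rangle\langle N,\psi\rangle=\langle\phi,\psi\rangle$ for test functions, taking values in $H^{-d/2-\epsilon}(\mathbb{T}^d)$. The data are $F^\delta=Ku^\dagger+\delta N$, $\delta>0$, with deterministic $u^\dagger$. $U_\alpha^\delta$ is, realization-wise, a minimizer over $X$ of $\frac12\|Ku\|_{L^2}^2-\langle Ku,F^\delta\rangle+\alpha R(u)$ (duality pairing of $H^{d/2+\epsilon}$ and $H^{-d/2-\epsilon}$), and $\mu_\alpha^\delta\in\partial R(U_\alpha^\delta)$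 is the subgradient with $K^*(KU_\alpha^\delta-F^\delta)+\alpha\mu_\alpha^\delta=0$. The symmetric Bregman distance is $D_R^{\mu_u,\mu_v}(u,v)=\langle\mu_u-\mu_v,u-v\rangle_{X^*\times X}$. $a\simeq b$ means mutual boundedness by constant multiples and $a\lesssim b$ means $a\le Cb$, with constants independent of $\delta$, as $\delta\to0$ (in particular $\delta<1$). *)

theory Defs
  imports "HOL-Probability.Probability" "HOL-Library.Landau_Symbols"
begin

text \<open>
  The torus is \<open>\<real>\<^sup>d / \<int>\<^sup>d\<close>; functions on it are 1-periodic functions on \<open>real ^ 'd\<close>, integrated
  over the unit cube. Elements of \<open>L\<^sup>2\<close> are functions rather than classes modulo null sets; all
  notions below are insensitive to changes on null sets.
\<close>

definition torus :: "(real ^ 'd) measure" where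
  "torus = lebesgue_on (cbox 0 (\<chi> i. 1))"

definition periodic :: "(real ^ 'd \<Rightarrow> 'b) \<Rightarrow> bool" where
  "periodic f \<longleftrightarrow> (\<forall>x i. f (x + axis i 1) = f x)"

definition L2 :: "(real ^ 'd \<Rightarrow> real) set" where
  "L2 = {u. periodic u \<and> u \<in> borel_measurable torus \<and> integrable torus (\<lambda>x. (u x)\<^sup>2)}"

definition L2_inner :: "(real ^ 'd \<Rightarrow> real) \<Rightarrow> (real ^ 'd \<Rightarrow> real) \<Rightarrow> real" where
  "L2_inner u v = (\<integral>x. u x * v x \<partial>torus)"

definition L2_norm :: "(real ^ 'd \<Rightarrow> real) \<Rightarrow> real" where
  "L2_norm u = sqrt (L2_inner u u)"

definition partial_deriv :: "'d \<Rightarrow> (real ^ 'd \<Rightarrow> 'b) \<Rightarrow> real ^ 'd \<Rightarrow> 'b::real_normed_vector" where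
  "partial_deriv i f = (\<lambda>x. frechet_derivative f (at x) (axis i 1))"

text \<open>Multi-indices are given as lists of coordinate directions.\<close>

definition partial_derivs :: "'d list \<Rightarrow> (real ^ 'd \<Rightarrow> 'b) \<Rightarrow> real ^ 'd \<Rightarrow> 'b::real_normed_vector" where
  "partial_derivs js f = foldr partial_deriv js f"

definition smooth :: "(real ^ 'd \<Rightarrow> 'b::real_normed_vector) \<Rightarrow> bool" where
  "smooth f \<longleftrightarrow> (\<forall>js x. partial_derivs js f differentiable (at x))"

definition test_functions :: "(real ^ 'd \<Rightarrow> real) set" where
  "test_functions = {\<phi>. periodic \<phi> \<and> smooth \<phi>}"

text \<open>
  As the torus is compact, \<open>C\<^sub>0\<^sup>\<infinity> = C\<^sup>\<infinity>\<close>. The sup-norm of a vector field is taken with respect to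
  the Euclidean norm on \<open>\<real>\<^sup>d\<close>.
\<close>

definition unit_fields :: "(real ^ 'd \<Rightarrow> real ^ 'd) set" where
  "unit_fields = {\<phi>. (\<forall>i. (\<lambda>x. \<phi> x $ i) \<in> test_functions) \<and> (\<forall>x. norm (\<phi> x) \<le> 1)}"

definition divergence :: "(real ^ 'd \<Rightarrow> real ^ 'd) \<Rightarrow> real ^ 'd \<Rightarrow> real" where
  "divergence \<phi> x = (\<Sum>i\<in>UNIV. partial_deriv i (\<lambda>y. \<phi> y $ i) x)"

definition BV :: "(real ^ 'd \<Rightarrow> real) set" where
  "BV = {u. periodic u \<and> integrable torus u \<and>
            bdd_above ((\<lambda>\<phi>. \<integral>x. divergence \<phi> x * u x \<partial>torus) ` unit_fields)}"

text \<open>A real supremum, meaningful on \<open>BV\<close> only.\<close>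

definition TV :: "(real ^ 'd \<Rightarrow> real) \<Rightarrow> real" where
  "TV u = (SUP \<phi>\<in>unit_fields. \<integral>x. divergence \<phi> x * u x \<partial>torus)"

definition function_subspace :: "(real ^ 'd \<Rightarrow> real) set \<Rightarrow> bool" where
  "function_subspace X \<longleftrightarrow> (\<lambda>x. 0) \<in> X \<and>
     (\<forall>u\<in>X. \<forall>v\<in>X. (\<lambda>x. u x + v x) \<in> X) \<and> (\<forall>c. \<forall>u\<in>X. (\<lambda>x. c * u x) \<in> X)"

text \<open>Elements of the dual are only relevant through their values on \<open>X\<close>.\<close>

definition dual_space :: "(real ^ 'd \<Rightarrow> real) set \<Rightarrow> ((real ^ 'd \<Rightarrow> real) \<Rightarrow> real) set" where
  "dual_space X = {q. (\<forall>u\<in>X. \<forall>v\<in>X. q (\<lambda>x. u x + v x) = q u + q v) \<and>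
                      (\<forall>c. \<forall>u\<in>X. q (\<lambda>x. c * u x) = c * q u) \<and>
                      (\<exists>C. \<forall>u\<in>X. \<bar>q u\<bar> \<le> C * TV u)}"

definition dual_norm :: "(real ^ 'd \<Rightarrow> real) set \<Rightarrow> ((real ^ 'd \<Rightarrow> real) \<Rightarrow> real) \<Rightarrow> ereal" where
  "dual_norm X q = (SUP u\<in>{u\<in>X. TV u \<le> 1}. ereal (q u))"

definition TV_subdifferential ::
    "(real ^ 'd \<Rightarrow> real) set \<Rightarrow> (real ^ 'd \<Rightarrow> real) \<Rightarrow> ((real ^ 'd \<Rightarrow> real) \<Rightarrow> real) set" where
  "TV_subdifferential X u = {q\<in>dual_space X. \<forall>v\<in>X. TV u + q (\<lambda>x. v x - u x) \<le> TV v}"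

definition sym_bregman :: "((real ^ 'd \<Rightarrow> real) \<Rightarrow> real) \<Rightarrow> ((real ^ 'd \<Rightarrow> real) \<Rightarrow> real) \<Rightarrow>
    (real ^ 'd \<Rightarrow> real) \<Rightarrow> (real ^ 'd \<Rightarrow> real) \<Rightarrow> real" where
  "sym_bregman p q u v = p (\<lambda>x. u x - v x) - q (\<lambda>x. u x - v x)"

text \<open>
  Here \<open>K\<^sup>*w\<close>, as an element of the dual of \<open>X\<close>, is the functional \<open>u \<mapsto> \<langle>w, K u\<rangle>\<close>. The infimum is
  taken in the extended reals, so that it is \<open>\<infinity>\<close> if no \<open>w\<close> is admissible.
\<close>

definition approx_source_condition :: "(real ^ 'd \<Rightarrow> real) set \<Rightarrow>
    ((real ^ 'd \<Rightarrow> real) \<Rightarrow> (real ^ 'd \<Rightarrow> real)) \<Rightarrow> ((real ^ 'd \<Rightarrow> real) \<Rightarrow> real) \<Rightarrow> real \<Rightarrow> bool" where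
  "approx_source_condition X K q r \<longleftrightarrow>
     (\<exists>C. \<forall>\<^sub>F \<beta> in at_right 0.
        (INF w\<in>{w\<in>L2. dual_norm X (\<lambda>u. q u - L2_inner w (K u)) \<le> ereal \<beta>}. ereal ((L2_norm w)\<^sup>2))
        = ereal (C * \<beta> powr (- r)))"

text \<open>
  A distribution is a continuous linear functional on the real test functions. It is required to
  vanish outside the test functions so that equality of distributions is equality in HOL.
\<close>

type_synonym 'd distribution = "(real ^ 'd \<Rightarrow> real) \<Rightarrow> real"

definition distributions :: "('d::finite) distribution set" where
  "distributions = {T.
     (\<forall>\<phi>\<in>test_functions. \<forall>\<psi>\<in>test_functions. T (\<lambda>x. \<phi> x + \<psi> x) = T \<phi> + T \<psi>) \<and>
     (\<forall>c. \<forall>\<phi>\<in>test_functions. T (\<lambda>x. c * \<phi> x) = c * T \<phi>) \<and>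
     (\<exists>C m. \<forall>\<phi>\<in>test_functions. \<forall>B.
        (\<forall>js x. length js \<le> m \<longrightarrow> \<bar>partial_derivs js \<phi> x\<bar> \<le> B) \<longrightarrow> \<bar>T \<phi>\<bar> \<le> C * B) \<and>
     (\<forall>\<phi>. \<phi> \<notin> test_functions \<longrightarrow> T \<phi> = 0)}"

definition regular :: "(real ^ 'd \<Rightarrow> real) \<Rightarrow> 'd distribution" where
  "regular f = (\<lambda>\<phi>. if \<phi> \<in> test_functions then \<integral>x. f x * \<phi> x \<partial>torus else 0)"

definition freq_dot :: "int ^ 'd \<Rightarrow> real ^ 'd \<Rightarrow> real" where
  "freq_dot k x = 2 * pi * (\<Sum>i\<in>UNIV. of_int (k $ i) * x $ i)"

text \<open>The Fourier coefficient \<open>\<langle>T, exp (- 2 \<pi> \<i> k \<cdot> x)\<rangle>\<close>.\<close>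

definition fourier :: "('d::finite) distribution \<Rightarrow> int ^ 'd \<Rightarrow> complex" where
  "fourier T k = Complex (T (\<lambda>x. cos (freq_dot k x))) (- T (\<lambda>x. sin (freq_dot k x)))"

definition japanese_bracket :: "int ^ 'd \<Rightarrow> real" where
  "japanese_bracket k = sqrt (1 + (\<Sum>i\<in>UNIV. (of_int (k $ i))\<^sup>2))"

definition sobolev :: "real \<Rightarrow> ('d::finite) distribution set" where
  "sobolev s = {T\<in>distributions.
     (\<lambda>k. japanese_bracket k powr (2 * s) * (cmod (fourier T k))\<^sup>2) summable_on UNIV}"

definition sobolev_norm :: "real \<Rightarrow> ('d::finite) distribution \<Rightarrow> real" where
  "sobolev_norm s T = sqrt (\<Sum>\<^sub>\<infinity>k. japanese_bracket k powr (2 * s) * (cmod (fourier T k))\<^sup>2)"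

text \<open>The duality pairing of \<open>H\<^sup>s\<close> and \<open>H\<^sup>-\<^sup>s\<close>, for every \<open>s\<close>, extending the inner product of \<open>L\<^sup>2\<close>.\<close>

definition sobolev_pairing :: "('d::finite) distribution \<Rightarrow> 'd distribution \<Rightarrow> real" where
  "sobolev_pairing S T = Re (\<Sum>\<^sub>\<infinity>k. fourier S k * cnj (fourier T k))"

definition forward_diff :: "'d \<Rightarrow> (int ^ 'd \<Rightarrow> complex) \<Rightarrow> int ^ 'd \<Rightarrow> complex" where
  "forward_diff i f = (\<lambda>k. f (k + axis i 1) - f k)"

text \<open>
  The toroidal symbol class \<open>S\<^sup>m\<close> of type (1,0): derivatives in the space variable and differences
  in the frequency variable. Its quantization yields exactly the pseudodifferential operators of
  order \<open>m\<close> on the torus defined by means of charts (Ruzhansky and Turunen).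
\<close>

definition toroidal_symbols :: "real \<Rightarrow> (real ^ 'd \<Rightarrow> int ^ 'd \<Rightarrow> complex) set" where
  "toroidal_symbols m = {a.
     (\<forall>k. periodic (\<lambda>x. a x k) \<and> smooth (\<lambda>x. a x k)) \<and>
     (\<forall>is js. \<exists>C. \<forall>x k.
        cmod (foldr forward_diff is (\<lambda>l. partial_derivs js (\<lambda>y. a y l) x) k)
          \<le> C * japanese_bracket k powr (m - real (length is)))}"

text \<open>
  \<open>K\<close> acts between spaces of real functions, so the quantization of its symbol has to be real on
  real test functions.
\<close>

definition pseudodifferential ::
    "real \<Rightarrow> ((real ^ 'd \<Rightarrow> real) \<Rightarrow> (real ^ 'd \<Rightarrow> real)) \<Rightarrow> bool" where
  "pseudodifferential m K \<longleftrightarrow>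
     (\<exists>a\<in>toroidal_symbols m. \<forall>\<phi>\<in>test_functions. AE x in torus.
        complex_of_real (K \<phi> x) = (\<Sum>\<^sub>\<infinity>k. a x k * fourier (regular \<phi>) k * cis (freq_dot k x)))"

definition sobolev_bijection :: "real \<Rightarrow> real \<Rightarrow> (('d::finite) distribution \<Rightarrow> 'd distribution) \<Rightarrow> bool"
  where
  "sobolev_bijection r s A \<longleftrightarrow>
     bij_betw A (sobolev r) (sobolev s) \<and>
     (\<forall>S\<in>sobolev r. \<forall>T\<in>sobolev r. A (\<lambda>\<phi>. S \<phi> + T \<phi>) = (\<lambda>\<phi>. A S \<phi> + A T \<phi>)) \<and>
     (\<forall>c. \<forall>T\<in>sobolev r. A (\<lambda>\<phi>. c * T \<phi>) = (\<lambda>\<phi>. c * A T \<phi>)) \<and>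
     (\<exists>C. \<forall>T\<in>sobolev r. sobolev_norm s (A T) \<le> C * sobolev_norm r T)"

definition extends_L2_operator :: "(('d::finite) distribution \<Rightarrow> 'd distribution) \<Rightarrow>
    ((real ^ 'd \<Rightarrow> real) \<Rightarrow> (real ^ 'd \<Rightarrow> real)) \<Rightarrow> bool" where
  "extends_L2_operator A K \<longleftrightarrow> (\<forall>u\<in>L2. K u \<in> L2 \<and> A (regular u) = regular (K u))"

definition L2_adjoint :: "((real ^ 'd \<Rightarrow> real) \<Rightarrow> (real ^ 'd \<Rightarrow> real)) \<Rightarrow>
    ((real ^ 'd \<Rightarrow> real) \<Rightarrow> (real ^ 'd \<Rightarrow> real)) \<Rightarrow> bool" where
  "L2_adjoint K Kstar \<longleftrightarrow> (\<forall>w\<in>L2. Kstar w \<in> L2) \<and>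
     (\<forall>u\<in>L2. \<forall>w\<in>L2. L2_inner (K u) w = L2_inner u (Kstar w))"

definition L2_basis :: "(nat \<Rightarrow> real ^ 'd \<Rightarrow> real) \<Rightarrow> bool" where
  "L2_basis v \<longleftrightarrow> (\<forall>j. v j \<in> L2) \<and>
     (\<forall>i j. L2_inner (v i) (v j) = (if i = j then 1 else 0)) \<and>
     (\<forall>u\<in>L2. (\<forall>j. L2_inner u (v j) = 0) \<longrightarrow> L2_norm u = 0)"

text \<open>
  \<open>P\<close> is the power \<open>L\<^sup>\<nu>\<close> of a positive compact self-adjoint operator \<open>L\<close> on \<open>L\<^sup>2\<close>, given by the
  spectral calculus in an orthonormal basis of eigenfunctions. (\<open>L = K\<^sup>*K\<close> is compact as soon as
  \<open>K\<close> is smoothing of positive order.)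
\<close>

definition L2_power :: "((real ^ 'd \<Rightarrow> real) \<Rightarrow> (real ^ 'd \<Rightarrow> real)) \<Rightarrow> real \<Rightarrow>
    ((real ^ 'd \<Rightarrow> real) \<Rightarrow> (real ^ 'd \<Rightarrow> real)) \<Rightarrow> bool" where
  "L2_power L \<nu> P \<longleftrightarrow> (\<exists>v ev. L2_basis v \<and>
     (\<forall>j. 0 \<le> ev j \<and> (AE x in torus. L (v j) x = ev j * v j x)) \<and>
     (\<forall>u\<in>L2. P u \<in> L2 \<and> (\<forall>j. L2_inner (P u) (v j) = ev j powr \<nu> * L2_inner u (v j))))"

definition L2_sobolev_isomorphism ::
    "real \<Rightarrow> ((real ^ 'd \<Rightarrow> real) \<Rightarrow> (real ^ 'd \<Rightarrow> real)) \<Rightarrow> bool" where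
  "L2_sobolev_isomorphism s P \<longleftrightarrow> (\<lambda>u. regular (P u)) ` L2 = sobolev s \<and>
     (\<exists>c>0. \<exists>C. \<forall>u\<in>L2. c * L2_norm u \<le> sobolev_norm s (regular (P u)) \<and>
                        sobolev_norm s (regular (P u)) \<le> C * L2_norm u)"

definition centered_gaussian :: "'w measure \<Rightarrow> ('w \<Rightarrow> real) \<Rightarrow> bool" where
  "centered_gaussian M Z \<longleftrightarrow> Z \<in> borel_measurable M \<and>
     ((AE \<omega> in M. Z \<omega> = 0) \<or> (\<exists>\<sigma>>0. distributed M lborel Z (normal_density 0 \<sigma>)))"

text \<open>
  Since \<open>N \<omega>\<close> is linear, Gaussianity of every \<open>\<langle>N, \<phi>\<rangle>\<close> includes joint Gaussianity of finitely many
  of them.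
\<close>

definition white_noise :: "'w measure \<Rightarrow> real \<Rightarrow> ('w \<Rightarrow> ('d::finite) distribution) \<Rightarrow> bool" where
  "white_noise M s N \<longleftrightarrow>
     (\<forall>\<omega>\<in>space M. N \<omega> \<in> sobolev s) \<and>
     (\<forall>\<phi>\<in>test_functions. centered_gaussian M (\<lambda>\<omega>. N \<omega> \<phi>)) \<and>
     (\<forall>\<phi>\<in>test_functions. \<forall>\<psi>\<in>test_functions.
        (\<integral>\<omega>. N \<omega> \<phi> * N \<omega> \<psi> \<partial>M) = L2_inner \<phi> \<psi>)"

definition noisy_data :: "((real ^ 'd \<Rightarrow> real) \<Rightarrow> (real ^ 'd \<Rightarrow> real)) \<Rightarrow> (real ^ 'd \<Rightarrow> real) \<Rightarrow>
    real \<Rightarrow> 'd distribution \<Rightarrow> 'd distribution" where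
  "noisy_data K u \<delta> n = (\<lambda>\<phi>. regular (K u) \<phi> + \<delta> * n \<phi>)"

definition tikhonov :: "((real ^ 'd \<Rightarrow> real) \<Rightarrow> (real ^ 'd \<Rightarrow> real)) \<Rightarrow> real \<Rightarrow>
    'd distribution \<Rightarrow> (real ^ 'd \<Rightarrow> real) \<Rightarrow> real" where
  "tikhonov K \<alpha> F u = (L2_norm (K u))\<^sup>2 / 2 - sobolev_pairing (regular (K u)) F + \<alpha> * TV u"

definition tikhonov_minimizer :: "(real ^ 'd \<Rightarrow> real) set \<Rightarrow>
    ((real ^ 'd \<Rightarrow> real) \<Rightarrow> (real ^ 'd \<Rightarrow> real)) \<Rightarrow> real \<Rightarrow>
    'd distribution \<Rightarrow> (real ^ 'd \<Rightarrow> real) \<Rightarrow> bool" where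
  "tikhonov_minimizer X K \<alpha> F u \<longleftrightarrow> u \<in> X \<and> (\<forall>v\<in>X. tikhonov K \<alpha> F u \<le> tikhonov K \<alpha> F v)"

text \<open>The identity \<open>K\<^sup>*(K u - F) + \<alpha> q = 0\<close> in the dual of \<open>X\<close>.\<close>

definition optimality_condition :: "(real ^ 'd \<Rightarrow> real) set \<Rightarrow>
    ((real ^ 'd \<Rightarrow> real) \<Rightarrow> (real ^ 'd \<Rightarrow> real)) \<Rightarrow> real \<Rightarrow>
    'd distribution \<Rightarrow> (real ^ 'd \<Rightarrow> real) \<Rightarrow> ((real ^ 'd \<Rightarrow> real) \<Rightarrow> real) \<Rightarrow> bool" where
  "optimality_condition X K \<alpha> F u q \<longleftrightarrow>
     (\<forall>v\<in>X. L2_inner (K u) (K v) - sobolev_pairing (regular (K v)) F + \<alpha> * q v = 0)"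

end

theory Submission
  imports Defs "HOL-Real_Asymp.Real_Asymp"
begin

text \<open>
  Write \<open>s = d / 2 + \<epsilon>\<close>, \<open>e = U - u_dag\<close>, \<open>x = \<parallel>K e\<parallel>\<close>, \<open>T = TV e\<close>, let \<open>\<alpha>\<close> stand for \<open>\<alpha> \<delta>\<close>, and let
  \<open>D\<close> be the symmetric Bregman distance. Testing the optimality condition with \<open>e\<close> gives the energy identity
  (lemma \<open>energy_identity\<close>)
  \<open>\<alpha> D = \<delta> \<langle>K e, N\<rangle> - x\<^sup>2 - \<alpha> \<mu>_dag e\<close>.
  Its right-hand side has two terms of unknown sign. The source condition supplies, for each small \<open>\<beta>\<close>,
  a bound \<open>\<bar>\<mu>_dag e\<bar> \<le> W x + \<beta> T\<close> with \<open>W\<^sup>2\<close> of order \<open>\<beta> powr - r1\<close> (lemma \<open>approx_source_bound\<close>).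
  The noise is cut at a frequency \<open>m\<close>. Below \<open>m\<close> it is paired with \<open>K e\<close> in \<open>L\<^sup>2\<close>, at the price
  \<open>x\<close> times a random variable with second moment of order \<open>m ^ d\<close>. Above \<open>m\<close> it is moved to the other side by duality and
  measured against \<open>T\<close>. Completing squares in \<open>x\<close> and taking expectations leaves an inequality between powers
  of \<open>\<delta>\<close>, in which \<open>\<beta>\<close> is the claimed rate and \<open>m = \<delta> powr (- 1 / (t + d))\<close> (theorem \<open>expected_rate\<close>).

  The decisive estimate is the one for the high frequencies (theorem \<open>high_frequency_bound\<close>): the
  functional \<open>e \<mapsto> \<langle>K e, N\<rangle>\<close>, restricted to frequencies above \<open>m\<close>, is bounded on \<open>X\<close> by \<open>G * TV e\<close>, where
  \<open>G\<close> has second moment of order \<open>m powr (2 * \<eta> - 2 * t)\<close> for any small \<open>\<eta> > 0\<close>. The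
  pathwise argument, which uses only that \<open>N\<close> lies in \<open>H\<^sup>-\<^sup>s\<close> and that \<open>TV\<close> dominates the \<open>L\<^sup>2\<close>
  norm, yields the exponent \<open>- (t - s)\<close> instead of \<open>- t\<close>, and this is too weak for the stated
  threshold \<open>(d + 2 * \<epsilon>) / t\<close>: it would give the rate in the second case only from
  \<open>r1 \<ge> (d + 2 * \<epsilon>) / (t - s)\<close> on. The gain comes from the structure of \<open>TV\<close>. A functional \<open>q\<close> with mean zero that is
  the divergence of a field \<open>g\<close> satisfies \<open>\<integral> e q \<le> sup \<bar>g\<bar> * TV e\<close>. On each dyadic frequency
  block such a \<open>g\<close> is a trigonometric polynomial whose values are Gaussian, with
  variances controlled by the mapping properties of \<open>K\<close> on Sobolev spaces of negative order; a grid of points reduces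
  its supremum to finitely many values, and high moments make the size of the grid harmless. In
  dimension at most two, the one derivative won by passing from \<open>q\<close> to \<open>g\<close> pays for the \<open>d / 2\<close> derivatives
  that evaluation at a point costs in \<open>L\<^sup>2\<close>, the square root of the number of frequencies in a block.

  Moments of \<open>T\<close> come from the cruder pathwise argument (lemma \<open>TV_err_raw\<close>), since there any power of the norm of
  the noise is admissible. The Bregman distance \<open>D\<close> is measurable because it depends
  continuously on the noise in \<open>H\<^sup>-\<^sup>s\<close> (lemma \<open>bregman_measurable\<close>).

  The optimality condition mixes the \<open>L\<^sup>2\<close> inner product with the Sobolev pairing, so Parseval's identity is
  needed. Functions in the range of \<open>K\<close> have absolutely summable Fourier coefficients,
  whence only uniqueness of Fourier coefficients is required (theorem \<open>fcoeff_unique\<close>); it follows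
  from the Stone-Weierstrass theorem.
\<close>

section \<open>Waves, trigonometric polynomials and Fourier coefficients\<close>

abbreviation wave :: "int ^ 'd \<Rightarrow> real ^ 'd \<Rightarrow> complex" where
  "wave k x \<equiv> cis (freq_dot k x)"

lemma freq_dot_linear: "bounded_linear (freq_dot k)"
  unfolding freq_dot_def
  by (intro bounded_linear_const_mult bounded_linear_sum bounded_linear_mult_right
      bounded_linear_compose[OF bounded_linear_mult_right] bounded_linear_vec_nth)

lemma freq_dot_simps [simp]:
  "freq_dot k 0 = 0" "freq_dot 0 x = 0"
  "freq_dot (- k) x = - freq_dot k x"
  by (auto simp: freq_dot_def sum_negf)

lemma freq_dot_add: "freq_dot k (x + y) = freq_dot k x + freq_dot k y"
  and freq_dot_diff: "freq_dot k (x - y) = freq_dot k x - freq_dot k y"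
  by (auto simp: freq_dot_def algebra_simps sum.distrib sum_subtractf)

lemma freq_dot_axis [simp]: "freq_dot k (axis i 1) = 2 * pi * of_int (k $ i)"
proof -
  have "(\<Sum>j\<in>UNIV. of_int (k $ j) * axis i 1 $ j) = (\<Sum>j\<in>UNIV. if j = i then real_of_int (k $ i) else 0)"
    by (intro sum.cong) (auto simp: axis_def)
  then show ?thesis by (simp add: freq_dot_def)
qed

lemma wave_add_freq: "wave (k + l) x = wave k x * wave l x"
  by (simp add: freq_dot_def cis_mult algebra_simps sum.distrib sum_distrib_left)

lemma wave_periodic: "wave k (x + axis i 1) = wave k x"
proof -
  have "wave k (x + axis i 1) = wave k x * cis (2 * pi * of_int (k $ i))"
    by (simp only: freq_dot_add cis_mult freq_dot_axis)
  then show ?thesis by (simp only: cis_multiple_2pi Ints_of_int mult_1_right)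
qed

lemma finite_measure_torus: "finite_measure (torus :: (real ^ 'd) measure)"
  unfolding torus_def by (rule finite_measure_lebesgue_on) simp

lemma space_torus [simp]: "space torus = cbox 0 (\<chi> i. 1)"
  by (simp add: torus_def)

lemma torus_eq_restrict: "torus = restrict_space lebesgue (cbox 0 (\<chi> i. 1))"
  by (simp add: torus_def)

lemma continuous_torus_measurable:
  fixes f :: "real ^ 'd \<Rightarrow> 'b::euclidean_space"
  assumes "continuous_on UNIV f" shows "f \<in> borel_measurable torus"
  unfolding torus_def
  by (rule continuous_imp_measurable_on_sets_lebesgue) (use assms continuous_on_subset in auto)

lemma continuous_bounded_on_cube:
  fixes f :: "real ^ 'd \<Rightarrow> 'b::euclidean_space"
  assumes "continuous_on UNIV f" obtains B where "\<And>x. x \<in> cbox 0 (\<chi> i. 1) \<Longrightarrow> norm (f x) \<le> B"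
proof -
  have "compact (f ` cbox 0 (\<chi> i. 1))"
    by (intro compact_continuous_image continuous_on_subset[OF assms]) auto
  then show ?thesis using compact_imp_bounded bounded_iff that by (metis image_eqI)
qed

lemma integral_wave_1d:
  fixes n :: int
  shows "(\<integral>y. indicator {0..1} y *\<^sub>R cis (2 * pi * of_int n * y) \<partial>lborel) = (if n = 0 then 1 else 0)"
    and "integrable lborel (\<lambda>y. indicator {0..1} y *\<^sub>R cis (2 * pi * of_int n * y))"
proof -
  show "integrable lborel (\<lambda>y. indicator {0..1} y *\<^sub>R cis (2 * pi * of_int n * y))"
    by (rule borel_integrable_compact) (auto intro!: continuous_intros)
  show "(\<integral>y. indicator {0..1} y *\<^sub>R cis (2 * pi * of_int n * y) \<partial>lborel) = (if n = 0 then 1 else 0)"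
  proof (cases "n = 0")
    case True then show ?thesis by simp
  next
    case False
    define F where "F = (\<lambda>y::real. cis (2 * pi * of_int n * y) / (\<i> * of_real (2 * pi * of_int n)))"
    have "(\<integral>y. indicator {0..1} y *\<^sub>R cis (2 * pi * of_int n * y) \<partial>lborel) = F 1 - F 0"
    proof (rule integral_FTC_atLeastAtMost)
      show "(F has_vector_derivative cis (2 * pi * of_int n * x)) (at x within {0..1})" for x
      proof -
        let ?c = "\<i> * of_real (2 * pi * of_int n)"
        have "((\<lambda>z. exp (?c * z) / ?c) has_field_derivative exp (?c * of_real x)) (at (of_real x))"
          using False by (auto intro!: derivative_eq_intros)
        from has_vector_derivative_real_field[OF this]
        show ?thesis unfolding F_def cis_conv_exp by (simp add: mult_ac)
      qed
    qed (auto intro!: continuous_intros)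
    also have "F 1 - F 0 = 0"
      using cis_multiple_2pi[of "of_int n"] by (simp add: F_def)
    finally show ?thesis using False by simp
  qed
qed

text \<open>
  The cube is a product, so Fubini reduces orthogonality of the waves to the one-dimensional integral.
\<close>

lemma integral_wave:
  fixes k :: "int ^ 'd"
  shows "(\<integral>x. wave k x \<partial>torus) = (if k = 0 then 1 else 0)"
proof -
  let ?c = "cbox 0 (\<chi> i. 1) :: (real ^ 'd) set"
  define \<kappa> where "\<kappa> = (\<lambda>b :: real ^ 'd. \<Sum>i\<in>UNIV. if b = axis i 1 then k $ i else 0)"
  define f where "f = (\<lambda>b y. indicator {0..1} y *\<^sub>R cis (2 * pi * of_int (\<kappa> b) * y) :: complex)"
  have \<kappa>_axis: "\<kappa> (axis i 1) = k $ i" for i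
    unfolding \<kappa>_def by (simp add: axis_eq_axis)
  have inj: "inj_on (\<lambda>i. axis i 1 :: real ^ 'd) UNIV"
    by (auto simp: inj_on_def axis_eq_axis)
  have Basis_eq: "(Basis :: (real ^ 'd) set) = (\<lambda>i. axis i 1) ` UNIV"
    by (auto simp: Basis_vec_def)
  have split: "indicator ?c x *\<^sub>R wave k x = (\<Prod>b\<in>Basis. f b (x \<bullet> b))" for x
  proof -
    have "(\<Prod>b\<in>Basis. f b (x \<bullet> b)) = (\<Prod>i\<in>UNIV. f (axis i 1) (x $ i))"
      unfolding Basis_eq by (subst prod.reindex[OF inj]) (simp add: inner_axis)
    also have "\<dots> = (\<Prod>i\<in>UNIV. of_real (indicator {0..1} (x $ i))) * (\<Prod>i\<in>UNIV. cis (2 * pi * of_int (k $ i) * x $ i))"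
      unfolding f_def \<kappa>_axis scaleR_conv_of_real prod.distrib ..
    also have "(\<Prod>i\<in>UNIV. cis (2 * pi * of_int (k $ i) * x $ i)) = wave k x"
      unfolding cis_conv_exp freq_dot_def
      by (subst exp_sum[symmetric]) (auto simp: sum_distrib_left mult_ac)
    also have "(\<Prod>i\<in>UNIV. complex_of_real (indicator {0..1} (x $ i))) = of_real (indicator ?c x)"
    proof (cases "x \<in> ?c")
      case True
      then show ?thesis by (auto simp: mem_box_cart)
    next
      case False
      then obtain i where "x $ i \<notin> {0..1}" by (auto simp: mem_box_cart)
      then have "indicat_real {0..1} (x $ i) = 0" by simp
      then have "(\<Prod>i\<in>UNIV. complex_of_real (indicator {0..1} (x $ i))) = 0"
        by (intro prod_zero) (auto intro!: exI[of _ i])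
      with False show ?thesis by simp
    qed
    finally show ?thesis by (simp add: scaleR_conv_of_real)
  qed
  interpret P: finite_product_sigma_finite "\<lambda>_. lborel :: real measure" "Basis :: (real ^ 'd) set"
    by standard (auto simp: sigma_finite_lborel)
  have meas: "(\<lambda>x. \<Prod>b\<in>Basis. f b (x \<bullet> b)) \<in> borel_measurable borel"
    unfolding f_def by (intro borel_measurable_prod borel_measurable_scaleR)
      (auto intro!: borel_measurable_continuous_onI continuous_intros)
  have "(\<integral>x. wave k x \<partial>torus) = (\<integral>x. indicator ?c x *\<^sub>R wave k x \<partial>lebesgue)"
    unfolding torus_eq_restrict by (subst integral_restrict_space) auto
  also have "\<dots> = (\<integral>x. (\<Prod>b\<in>Basis. f b (x \<bullet> b)) \<partial>lborel)"
    unfolding split using meas by (intro integral_completion) auto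
  also have "\<dots> = (\<integral>y. (\<Prod>b\<in>Basis. f b ((\<Sum>b\<in>Basis. y b *\<^sub>R b) \<bullet> b)) \<partial>(\<Pi>\<^sub>M b\<in>(Basis :: (real ^ 'd) set). lborel))"
    by (subst lborel_eq, subst integral_distr) (use meas in auto)
  also have "\<dots> = (\<integral>y. (\<Prod>b\<in>Basis. f b (y b)) \<partial>(\<Pi>\<^sub>M b\<in>(Basis :: (real ^ 'd) set). lborel))"
    by (intro Bochner_Integration.integral_cong prod.cong) auto
  also have "\<dots> = (\<Prod>b\<in>(Basis :: (real ^ 'd) set). \<integral>y. f b y \<partial>lborel)"
    by (rule P.product_integral_prod) (auto simp: f_def integral_wave_1d)
  also have "\<dots> = (\<Prod>i\<in>UNIV. if k $ i = 0 then 1 else 0)"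
    unfolding Basis_eq f_def integral_wave_1d by (subst prod.reindex[OF inj]) (simp add: \<kappa>_axis)
  also have "\<dots> = (if k = 0 then 1 else 0)"
    by (auto simp: vec_eq_iff)
  finally show ?thesis .
qed

lemma continuous_wave: "continuous_on UNIV (\<lambda>x. wave k x)"
  by (intro continuous_intros linear_continuous_on freq_dot_linear continuous_on_cis)

lemma integrable_bounded_mult:
  fixes f g :: "real ^ 'd \<Rightarrow> 'b::{euclidean_space,real_normed_field}"
  assumes "integrable torus f" "g \<in> borel_measurable torus" "\<And>x. x \<in> cbox 0 (\<chi> i. 1) \<Longrightarrow> norm (g x) \<le> B"
  shows "integrable torus (\<lambda>x. f x * g x)"
proof (rule Bochner_Integration.integrable_bound[OF integrable_mult_left[of B, OF integrable_norm[OF assms(1)]]])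
  show "(\<lambda>x. f x * g x) \<in> borel_measurable torus" using assms by measurable
  show "AE x in torus. norm (f x * g x) \<le> norm (norm (f x) * B)"
  proof (rule AE_I2)
    fix x :: "real ^ 'd" assume "x \<in> space torus"
    then have "norm (g x) \<le> B" using assms(3) by simp
    then show "norm (f x * g x) \<le> norm (norm (f x) * B)"
      by (simp add: norm_mult abs_mult mult_left_mono)
  qed
qed

lemma integrable_mult_continuous:
  fixes f g :: "real ^ 'd \<Rightarrow> 'b::{euclidean_space,real_normed_field}"
  assumes "integrable torus f" "continuous_on UNIV g"
  shows "integrable torus (\<lambda>x. f x * g x)"
  using continuous_bounded_on_cube[OF assms(2)] integrable_bounded_mult[OF assms(1) continuous_torus_measurable[OF assms(2)]]
  by metis

lemma integrable_continuous_torus: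
  fixes f :: "real ^ 'd \<Rightarrow> 'b::{euclidean_space,real_normed_field}"
  assumes "continuous_on UNIV f"
  shows "integrable torus f"
proof -
  interpret finite_measure torus by (rule finite_measure_torus)
  show ?thesis using integrable_mult_continuous[of "\<lambda>_. 1", OF _ assms] by simp
qed

definition fcoeff :: "(real ^ 'd \<Rightarrow> real) \<Rightarrow> int ^ 'd \<Rightarrow> complex" where
  "fcoeff u k = (\<integral>x. of_real (u x) * cnj (wave k x) \<partial>torus)"

text \<open>
  Real trigonometric polynomials are real parts of complex ones, with arbitrary coefficients: the
  coefficient \<open>a k\<close> is in general not the Fourier coefficient of the function, as \<open>k\<close> and \<open>- k\<close> contribute
  to the same real wave.
\<close>

definition trig_poly :: "(int ^ 'd) set \<Rightarrow> (int ^ 'd \<Rightarrow> complex) \<Rightarrow> real ^ 'd \<Rightarrow> real" where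
  "trig_poly F a x = Re (\<Sum>k\<in>F. a k * wave k x)"

lemma trig_poly_cos: "trig_poly {k} (\<lambda>_. 1) = (\<lambda>x. cos (freq_dot k x))"
  and trig_poly_sin: "trig_poly {k} (\<lambda>_. - \<i>) = (\<lambda>x. sin (freq_dot k x))"
  by (auto simp: trig_poly_def)

lemma trig_poly_scale: "(\<lambda>x. c * trig_poly F a x) = trig_poly F (\<lambda>k. of_real c * a k)"
proof
  fix x
  have "(\<Sum>k\<in>F. of_real c * a k * wave k x) = of_real c * (\<Sum>k\<in>F. a k * wave k x)"
    by (simp add: sum_distrib_left mult.assoc)
  then show "c * trig_poly F a x = trig_poly F (\<lambda>k. of_real c * a k) x"
    by (simp add: trig_poly_def del: Re_sum)
qed

lemma periodic_trig_poly: "periodic (trig_poly F a)"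
  by (simp add: periodic_def trig_poly_def wave_periodic)

lemma trig_poly_has_derivative:
  "(trig_poly F a has_derivative (\<lambda>h. Re (\<Sum>k\<in>F. a k * (\<i> * of_real (freq_dot k h)) * wave k x))) (at x)"
proof -
  have "((\<lambda>x. wave k x) has_derivative (\<lambda>h. \<i> * of_real (freq_dot k h) * wave k x)) (at x)" for k :: "int ^ 'a"
  proof -
    have "((\<lambda>t. cis t) has_derivative (\<lambda>h. h *\<^sub>R (\<i> * cis (freq_dot k x)))) (at (freq_dot k x))"
    proof -
      have "((\<lambda>z. exp (\<i> * z)) has_field_derivative \<i> * exp (\<i> * of_real (freq_dot k x))) (at (of_real (freq_dot k x)))"
        by (auto intro!: derivative_eq_intros)
      from has_vector_derivative_real_field[OF this]
      show ?thesis unfolding has_vector_derivative_def cis_conv_exp by simp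
    qed
    from has_derivative_compose[OF bounded_linear_imp_has_derivative[OF freq_dot_linear] this]
    show ?thesis by (simp add: scaleR_conv_of_real mult_ac)
  qed
  then have "((\<lambda>x. \<Sum>k\<in>F. a k * wave k x) has_derivative (\<lambda>h. \<Sum>k\<in>F. a k * (\<i> * of_real (freq_dot k h) * wave k x))) (at x)"
    by (intro has_derivative_sum has_derivative_mult_right)
  from bounded_linear.has_derivative[OF bounded_linear_Re this]
  show ?thesis unfolding trig_poly_def by (simp add: mult.assoc)
qed

lemma partial_deriv_trig_poly:
  "partial_deriv i (trig_poly F a) = trig_poly F (\<lambda>k. a k * (\<i> * of_real (2 * pi * of_int (k $ i))))"
proof
  fix x
  show "partial_deriv i (trig_poly F a) x = trig_poly F (\<lambda>k. a k * (\<i> * of_real (2 * pi * of_int (k $ i)))) x"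
    unfolding partial_deriv_def
    using fun_cong[OF frechet_derivative_at[OF trig_poly_has_derivative[of F a x]], of "axis i 1"]
    by (simp add: trig_poly_def)
qed

lemma partial_derivs_trig_poly: "\<exists>b. partial_derivs js (trig_poly F a) = trig_poly F b"
  by (induction js) (auto simp: partial_derivs_def partial_deriv_trig_poly)

lemma trig_poly_test [simp]: "trig_poly F a \<in> test_functions"
proof -
  have "partial_derivs js (trig_poly F a) differentiable (at x)" for js x
  proof -
    obtain b where "partial_derivs js (trig_poly F a) = trig_poly F b"
      using partial_derivs_trig_poly[of js F a] by blast
    then show ?thesis using trig_poly_has_derivative[of F b x] by (auto simp: differentiable_def)
  qed
  then show ?thesis by (simp add: test_functions_def smooth_def periodic_trig_poly)
qed

lemma cos_test [simp]: "(\<lambda>x. cos (freq_dot k x)) \<in> test_functions"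
  and sin_test [simp]: "(\<lambda>x. sin (freq_dot k x)) \<in> test_functions"
  using trig_poly_test[of "{k}" "\<lambda>_. 1"] trig_poly_test[of "{k}" "\<lambda>_. - \<i>"]
  by (simp_all only: trig_poly_cos trig_poly_sin)

lemma test_continuous:
  assumes "\<phi> \<in> test_functions" shows "continuous_on UNIV \<phi>"
proof -
  have "\<phi> differentiable (at x)" for x
  proof -
    have "partial_derivs [] \<phi> differentiable (at x)"
      using assms unfolding test_functions_def smooth_def by blast
    then show ?thesis by (simp add: partial_derivs_def)
  qed
  then show ?thesis by (simp add: continuous_on_eq_continuous_at differentiable_imp_continuous_within)
qed

lemma partial_deriv_continuous:
  assumes "\<phi> \<in> test_functions" shows "continuous_on UNIV (partial_deriv i \<phi>)"
proof -
  have "partial_derivs [i] \<phi> differentiable (at x)" for x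
    using assms unfolding test_functions_def smooth_def by blast
  then show ?thesis
    by (simp add: partial_derivs_def continuous_on_eq_continuous_at differentiable_imp_continuous_within)
qed

lemma L2_D:
  assumes "u \<in> L2"
  shows "periodic u" "u \<in> borel_measurable torus" "integrable torus (\<lambda>x. (u x)\<^sup>2)"
  using assms by (auto simp: L2_def)

lemma L2_integrable_mult:
  assumes "u \<in> L2" "v \<in> L2" shows "integrable torus (\<lambda>x. u x * v x)"
proof (rule Bochner_Integration.integrable_bound)
  show "integrable torus (\<lambda>x. (u x)\<^sup>2 + (v x)\<^sup>2)" using assms by (auto simp: L2_def)
  show "(\<lambda>x. u x * v x) \<in> borel_measurable torus" using L2_D(2) assms by measurable
  show "AE x in torus. norm (u x * v x) \<le> norm ((u x)\<^sup>2 + (v x)\<^sup>2)"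
  proof (rule AE_I2)
    fix x
    have "2 * (\<bar>u x\<bar> * \<bar>v x\<bar>) \<le> (u x)\<^sup>2 + (v x)\<^sup>2"
      using sum_squares_bound[of "\<bar>u x\<bar>" "\<bar>v x\<bar>"] by simp
    moreover have "0 \<le> \<bar>u x\<bar> * \<bar>v x\<bar>" by simp
    ultimately have "\<bar>u x\<bar> * \<bar>v x\<bar> \<le> (u x)\<^sup>2 + (v x)\<^sup>2" by linarith
    then show "norm (u x * v x) \<le> norm ((u x)\<^sup>2 + (v x)\<^sup>2)"
      by (simp add: abs_mult)
  qed
qed

lemma continuous_L2: "continuous_on UNIV u \<Longrightarrow> periodic u \<Longrightarrow> u \<in> L2"
  by (auto simp: L2_def intro!: continuous_torus_measurable integrable_continuous_torus continuous_intros)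

lemma test_L2: "\<phi> \<in> test_functions \<Longrightarrow> \<phi> \<in> L2"
  by (auto simp: test_continuous test_functions_def intro!: continuous_L2)

lemma trig_poly_L2 [simp]: "trig_poly F a \<in> L2" by (rule test_L2) simp

lemma L2_integrable: "u \<in> L2 \<Longrightarrow> integrable torus u"
  using L2_integrable_mult[of u "\<lambda>_. 1"] continuous_L2[of "\<lambda>_. 1"] by (simp add: periodic_def)

lemma L2_add: "u \<in> L2 \<Longrightarrow> v \<in> L2 \<Longrightarrow> (\<lambda>x. u x + v x) \<in> L2"
  and L2_scale: "u \<in> L2 \<Longrightarrow> (\<lambda>x. c * u x) \<in> L2"
  using L2_integrable_mult[of u v]
  by (auto simp: L2_def periodic_def power2_sum power_mult_distrib mult.assoc)

lemma L2_minus: "u \<in> L2 \<Longrightarrow> (\<lambda>x. - u x) \<in> L2"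
  using L2_scale[of u "-1"] by simp

lemma L2_diff: "u \<in> L2 \<Longrightarrow> v \<in> L2 \<Longrightarrow> (\<lambda>x. u x - v x) \<in> L2"
  using L2_add[OF _ L2_minus] by fastforce

lemma L2_inner_commute: "L2_inner u v = L2_inner v u"
  by (simp add: L2_inner_def mult.commute)

lemma L2_inner_add: "u \<in> L2 \<Longrightarrow> v \<in> L2 \<Longrightarrow> w \<in> L2 \<Longrightarrow> L2_inner (\<lambda>x. u x + v x) w = L2_inner u w + L2_inner v w"
  and L2_inner_diff: "u \<in> L2 \<Longrightarrow> v \<in> L2 \<Longrightarrow> w \<in> L2 \<Longrightarrow> L2_inner (\<lambda>x. u x - v x) w = L2_inner u w - L2_inner v w"
  and L2_inner_scale: "L2_inner (\<lambda>x. c * u x) w = c * L2_inner u w"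
  unfolding L2_inner_def using L2_integrable_mult[of u w] L2_integrable_mult[of v w]
  by (auto simp: algebra_simps)

lemma L2_inner_nonneg: "0 \<le> L2_inner u u"
  by (simp add: L2_inner_def)

lemma L2_norm_sq: "(L2_norm u)\<^sup>2 = L2_inner u u"
  by (simp add: L2_norm_def L2_inner_nonneg)

lemma L2_norm_nonneg: "0 \<le> L2_norm u"
  by (simp add: L2_norm_def L2_inner_nonneg)

lemma L2_Cauchy_Schwarz:
  assumes u: "u \<in> L2" and v: "v \<in> L2"
  shows "\<bar>L2_inner u v\<bar> \<le> L2_norm u * L2_norm v"
proof -
  have q: "0 \<le> L2_inner u u + 2 * t * L2_inner u v + t\<^sup>2 * L2_inner v v" for t
  proof -
    have tv: "(\<lambda>x. t * v x) \<in> L2" by (rule L2_scale[OF v])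
    have "0 \<le> L2_inner (\<lambda>x. u x + t * v x) (\<lambda>x. u x + t * v x)" by (rule L2_inner_nonneg)
    also have "\<dots> = L2_inner u u + 2 * t * L2_inner u v + t\<^sup>2 * L2_inner v v"
      using L2_inner_add[OF u tv L2_add[OF u tv]] L2_inner_add[OF u tv u] L2_inner_add[OF u tv tv]
      by (simp add: L2_inner_commute[of u "\<lambda>x. u x + t * v x"] L2_inner_commute[of "\<lambda>x. t * v x" "\<lambda>x. u x + t * v x"]
          L2_inner_scale L2_inner_commute[of u "\<lambda>x. t * v x"] L2_inner_commute[of v "\<lambda>x. t * v x"] L2_inner_commute[of v u]
          power2_eq_square algebra_simps)
    finally show ?thesis .
  qed
  have "(L2_inner u v)\<^sup>2 \<le> L2_inner u u * L2_inner v v"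
  proof (cases "L2_inner v v = 0")
    case True
    have "L2_inner u v = 0"
    proof (rule ccontr)
      assume "L2_inner u v \<noteq> 0"
      then show False using q[of "- (L2_inner u u + 1) / (2 * L2_inner u v)"] True by (simp add: field_simps)
    qed
    then show ?thesis using True by simp
  next
    case False
    then have "L2_inner v v > 0" using L2_inner_nonneg[of v] by linarith
    then show ?thesis using q[of "- L2_inner u v / L2_inner v v"]
      by (simp add: field_simps power2_eq_square)
  qed
  then have "sqrt ((L2_inner u v)\<^sup>2) \<le> sqrt (L2_inner u u * L2_inner v v)" by (rule real_sqrt_le_mono)
  then show ?thesis by (simp add: L2_norm_def real_sqrt_mult)
qed

lemma fcoeff_integrable: "integrable torus u \<Longrightarrow> integrable torus (\<lambda>x. of_real (u x) * cnj (wave k x))"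
  by (intro integrable_mult_continuous continuous_intros continuous_wave) auto

lemma fourier_regular:
  assumes "integrable torus u" shows "fourier (regular u) k = fcoeff u k"
proof -
  have i: "integrable torus (\<lambda>x. complex_of_real (u x) * cnj (wave k x))" by (rule fcoeff_integrable[OF assms])
  show ?thesis
    unfolding fourier_def fcoeff_def regular_def
    by (rule complex_eqI) (auto simp: integral_Re[OF i, symmetric] integral_Im[OF i, symmetric]
        simp flip: Bochner_Integration.integral_minus intro!: Bochner_Integration.integral_cong)
qed

lemma fcoeff_diff: "integrable torus u \<Longrightarrow> integrable torus v \<Longrightarrow> fcoeff (\<lambda>x. u x - v x) k = fcoeff u k - fcoeff v k"
  unfolding fcoeff_def using fcoeff_integrable[of u k] fcoeff_integrable[of v k]
  by (auto simp: algebra_simps)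

lemma integral_mult_trig_poly:
  assumes "integrable torus u"
  shows "(\<integral>x. u x * trig_poly F a x \<partial>torus) = Re (\<Sum>k\<in>F. a k * cnj (fcoeff u k))"
proof -
  have i: "integrable torus (\<lambda>x. a k * (of_real (u x) * wave k x))" for k
    using integrable_cnj[OF fcoeff_integrable[OF assms, of k]] by (intro integrable_mult_right) simp
  have "(\<integral>x. u x * trig_poly F a x \<partial>torus) = (\<integral>x. Re (\<Sum>k\<in>F. a k * (of_real (u x) * wave k x)) \<partial>torus)"
    by (intro Bochner_Integration.integral_cong) (auto simp: trig_poly_def sum_distrib_left algebra_simps)
  also have "\<dots> = Re (\<Sum>k\<in>F. a k * (\<integral>x. (of_real (u x) * wave k x) \<partial>torus))"
    using i by (subst integral_Re) (auto simp: Bochner_Integration.integral_sum)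
  also have "(\<lambda>k. \<integral>x. (of_real (u x) * wave k x) \<partial>torus) = (\<lambda>k. cnj (fcoeff u k))"
    unfolding fcoeff_def Bochner_Integration.integral_cnj[symmetric] by simp
  finally show ?thesis by simp
qed

lemma integral_wave_mult: "(\<integral>x. wave k x * cnj (wave l x) \<partial>torus) = (if k = l then 1 else 0)"
proof -
  have "wave k x * cnj (wave l x) = wave (k - l) x" for x
    using wave_add_freq[of k "- l" x] by (simp add: cis_cnj)
  then show ?thesis using integral_wave[of "k - l"] by simp
qed

lemma Re_sq_integral:
  assumes "finite F"
  shows "(\<integral>x. (Re (\<Sum>k\<in>F. a k * wave k x))\<^sup>2 \<partial>torus) \<le> (\<Sum>k\<in>F. (cmod (a k))\<^sup>2)"
proof -
  let ?f = "\<lambda>x. \<Sum>k\<in>F. a k * wave k x"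
  have cont: "continuous_on UNIV ?f" by (intro continuous_intros continuous_wave)
  have "(\<integral>x. (Re (?f x))\<^sup>2 \<partial>torus) \<le> (\<integral>x. Re (?f x * cnj (?f x)) \<partial>torus)"
  proof (rule integral_mono)
    show "integrable torus (\<lambda>x. (Re (?f x))\<^sup>2)"
      by (intro integrable_continuous_torus continuous_intros cont)
    show "integrable torus (\<lambda>x. Re (?f x * cnj (?f x)))"
      by (intro integrable_continuous_torus continuous_intros cont)
    show "(Re z)\<^sup>2 \<le> Re (z * cnj z)" for z
      by (simp add: power2_eq_square)
  qed
  also have "\<dots> = Re (\<integral>x. (?f x * cnj (?f x)) \<partial>torus)"
    by (intro integral_Re integrable_continuous_torus continuous_intros cont)
  also have "(\<integral>x. (?f x * cnj (?f x)) \<partial>torus) = (\<integral>x. (\<Sum>k\<in>F. \<Sum>l\<in>F. a k * cnj (a l) * (wave k x * cnj (wave l x))) \<partial>torus)"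
    by (simp only: cnj_sum sum_product complex_cnj_mult mult_ac)
  also have "\<dots> = (\<Sum>k\<in>F. \<Sum>l\<in>F. a k * cnj (a l) * (\<integral>x. wave k x * cnj (wave l x) \<partial>torus))"
    by (subst Bochner_Integration.integral_sum, (intro integrable_continuous_torus continuous_intros continuous_wave)?)+
       (simp del: cis_cnj)
  also have "\<dots> = (\<Sum>k\<in>F. a k * cnj (a k))"
    unfolding integral_wave_mult using assms by (simp add: if_distrib[of "\<lambda>x. _ * x"] sum.delta cong: if_cong)
  also have "Re \<dots> = (\<Sum>k\<in>F. (cmod (a k))\<^sup>2)"
    by (simp add: complex_mult_cnj cmod_power2)
  finally show ?thesis .
qed

lemma L2_inner_trig_poly_le:
  "finite F \<Longrightarrow> L2_inner (trig_poly F a) (trig_poly F a) \<le> (\<Sum>k\<in>F. (cmod (a k))\<^sup>2)"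
  using Re_sq_integral[of F a] by (simp add: L2_inner_def trig_poly_def power2_eq_square)

lemma Bessel:
  assumes u: "u \<in> L2" and F: "finite F"
  shows "(\<Sum>k\<in>F. (cmod (fcoeff u k))\<^sup>2) \<le> (L2_norm u)\<^sup>2"
proof -
  let ?p = "trig_poly F (fcoeff u)" and ?S = "\<Sum>k\<in>F. (cmod (fcoeff u k))\<^sup>2"
  have "L2_inner u ?p = Re (\<Sum>k\<in>F. fcoeff u k * cnj (fcoeff u k))"
    unfolding L2_inner_def by (rule integral_mult_trig_poly[OF L2_integrable[OF u]])
  also have "\<dots> = ?S"
    by (simp add: complex_mult_cnj cmod_power2)
  finally have 1: "L2_inner u ?p = ?S" .
  have p: "?p \<in> L2" by simp
  have "0 \<le> L2_inner (\<lambda>x. u x - ?p x) (\<lambda>x. u x - ?p x)" by (rule L2_inner_nonneg)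
  also have "\<dots> = L2_inner u u - 2 * L2_inner u ?p + L2_inner ?p ?p"
    using L2_inner_diff[OF u p L2_diff[OF u p]] L2_inner_diff[OF u p u] L2_inner_diff[OF u p p]
    by (simp add: L2_inner_commute[of u "\<lambda>x. u x - ?p x"] L2_inner_commute[of ?p "\<lambda>x. u x - ?p x"] L2_inner_commute[of ?p u])
  also have "\<dots> \<le> L2_inner u u - ?S" using 1 L2_inner_trig_poly_le[OF F, of "fcoeff u"] by simp
  finally show ?thesis by (simp add: L2_norm_sq)
qed

section \<open>Uniqueness of Fourier coefficients and Parseval's identity\<close>

text \<open>
  Complex trigonometric polynomials, as the closure of the scaled waves under addition. In this form
  closure under products is an induction, without bookkeeping of frequency sets.
\<close>

inductive wave_sum :: "(real ^ 'd \<Rightarrow> complex) \<Rightarrow> bool" where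
  wave: "wave_sum (\<lambda>x. c * wave k x)"
| add: "wave_sum f \<Longrightarrow> wave_sum g \<Longrightarrow> wave_sum (\<lambda>x. f x + g x)"

lemma wave_sum_mult_wave: "wave_sum f \<Longrightarrow> wave_sum (\<lambda>x. c * wave l x * f x)"
proof (induction rule: wave_sum.induct)
  case (wave c' k)
  have "(\<lambda>x. c * wave l x * (c' * wave k x)) = (\<lambda>x. (c * c') * wave (l + k) x)"
    by (simp add: wave_add_freq mult_ac)
  then show ?case using wave_sum.wave by metis
next
  case (add f g)
  then show ?case using wave_sum.add by (simp add: distrib_left)
qed

lemma wave_sum_mult: "wave_sum f \<Longrightarrow> wave_sum g \<Longrightarrow> wave_sum (\<lambda>x. f x * g x)"
proof (induction rule: wave_sum.induct)
  case (wave c k)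
  then show ?case by (rule wave_sum_mult_wave)
next
  case (add f h)
  then show ?case using wave_sum.add by (simp add: distrib_right)
qed

lemma wave_sum_const: "wave_sum (\<lambda>x. c)"
  using wave_sum.wave[of c 0] by simp

lemma wave_sum_scale: "wave_sum f \<Longrightarrow> wave_sum (\<lambda>x. c * f x)"
  using wave_sum_mult[OF wave_sum_const] by blast

lemma wave_sum_sum: "(\<And>i. i \<in> I \<Longrightarrow> wave_sum (f i)) \<Longrightarrow> wave_sum (\<lambda>x. \<Sum>i\<in>I. f i x)"
  by (induction I rule: infinite_finite_induct) (auto intro: wave_sum.add wave_sum_const)

text \<open>
  The torus as a compact subset of Euclidean space. On the cube itself trigonometric polynomials do
  not separate opposite faces, so Stone-Weierstrass is applied on the image of this map.
\<close>

definition torus_embedding :: "real ^ 'd \<Rightarrow> complex ^ 'd" where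
  "torus_embedding x = (\<chi> i. wave (axis i 1) x)"

lemma freq_dot_unit: "freq_dot (axis i 1) x = 2 * pi * x $ i"
proof -
  have "(\<Sum>j\<in>UNIV. of_int (axis i 1 $ j) * x $ j) = (\<Sum>j\<in>UNIV. if j = i then x $ i else 0)"
    by (intro sum.cong) (auto simp: axis_def)
  then show ?thesis by (simp add: freq_dot_def)
qed

lemma continuous_torus_embedding: "continuous_on UNIV torus_embedding"
  unfolding torus_embedding_def by (intro continuous_on_vec_lambda continuous_wave)

lemma wave_sum_polynomial:
  assumes "real_polynomial_function g"
  shows "wave_sum (\<lambda>x. complex_of_real (g (torus_embedding x)))"
  using assms
proof (induction rule: real_polynomial_function.induct)
  case (linear f)
  have comp: "wave_sum (\<lambda>x. complex_of_real (torus_embedding x \<bullet> b))" if b: "b \<in> Basis" for b :: "complex ^ 'a"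
  proof -
    obtain i where "b = axis i 1 \<or> b = axis i \<i>" using b by (auto simp: Basis_vec_def Basis_complex_def)
    then have "(\<forall>x. complex_of_real (torus_embedding x \<bullet> b) = (1/2) * wave (axis i 1) x + (1/2) * wave (- axis i 1) x) \<or>
      (\<forall>x. complex_of_real (torus_embedding x \<bullet> b) = (-\<i>/2) * wave (axis i 1) x + (\<i>/2) * wave (- axis i 1) x)"
      by (auto simp: inner_axis torus_embedding_def complex_eq_iff)
    then obtain c1 c2 where "(\<lambda>x. complex_of_real (torus_embedding x \<bullet> b)) =
        (\<lambda>x. c1 * wave (axis i 1) x + c2 * wave (- axis i 1) x)"
    proof (elim disjE)
      assume "\<forall>x. complex_of_real (torus_embedding x \<bullet> b) = (1/2) * wave (axis i 1) x + (1/2) * wave (- axis i 1) x"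
      then show thesis by (intro that[of "1/2" "1/2"] ext) blast
    next
      assume "\<forall>x. complex_of_real (torus_embedding x \<bullet> b) = (-\<i>/2) * wave (axis i 1) x + (\<i>/2) * wave (- axis i 1) x"
      then show thesis by (intro that[of "-\<i>/2" "\<i>/2"] ext) blast
    qed
    moreover have "wave_sum (\<lambda>x. c1 * wave (axis i 1) x + c2 * wave (- axis i 1) x)"
      by (intro wave_sum.add wave_sum.wave)
    ultimately show ?thesis by simp
  qed
  have "f v = (\<Sum>b\<in>Basis. (v \<bullet> b) * f b)" for v
  proof -
    have "f v = f (\<Sum>b\<in>Basis. (v \<bullet> b) *\<^sub>R b)" by (simp add: euclidean_representation)
    also have "\<dots> = (\<Sum>b\<in>Basis. f ((v \<bullet> b) *\<^sub>R b))"
      by (rule linear_sum[OF bounded_linear.linear[OF linear]])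
    also have "\<dots> = (\<Sum>b\<in>Basis. (v \<bullet> b) * f b)"
      by (simp only: linear_scale[OF bounded_linear.linear[OF linear]] real_scaleR_def)
    finally show ?thesis .
  qed
  note expand = this
  have "(\<lambda>x. complex_of_real (f (torus_embedding x))) = (\<lambda>x. \<Sum>b\<in>Basis. of_real (f b) * of_real (torus_embedding x \<bullet> b))"
  proof
    fix x
    have "complex_of_real (f (torus_embedding x)) = of_real (\<Sum>b\<in>Basis. (torus_embedding x \<bullet> b) * f b)"
      by (rule arg_cong[OF expand])
    then show "complex_of_real (f (torus_embedding x)) = (\<Sum>b\<in>Basis. of_real (f b) * of_real (torus_embedding x \<bullet> b))"
      by (simp only: of_real_sum of_real_mult mult.commute)
  qed
  moreover have "wave_sum (\<lambda>x. \<Sum>b\<in>Basis. complex_of_real (f b) * of_real (torus_embedding x \<bullet> b))"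
    by (rule wave_sum_sum, rule wave_sum_scale, rule comp)
  ultimately show ?case by simp
next
  case (const c)
  show ?case by (rule wave_sum_const)
next
  case (add f g)
  then show ?case using wave_sum.add by simp
next
  case (mult f g)
  then show ?case using wave_sum_mult by simp
qed

lemma integral_wave_sum_eq_0:
  assumes h: "integrable torus h" and 0: "\<And>k. fcoeff h k = 0" and f: "wave_sum f"
  shows "integrable torus (\<lambda>x. of_real (h x) * f x) \<and> (\<integral>x. of_real (h x) * f x \<partial>torus) = 0"
  using f
proof (induction rule: wave_sum.induct)
  case (wave c k)
  have i: "integrable torus (\<lambda>x. complex_of_real (h x) * wave k x)"
    by (rule integrable_mult_continuous[OF integrable_of_real[OF h] continuous_wave])
  have "(\<integral>x. of_real (h x) * wave k x \<partial>torus) = cnj (fcoeff h k)"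
    unfolding fcoeff_def Bochner_Integration.integral_cnj[symmetric] by simp
  then show ?case using i 0 by (simp add: mult.left_commute)
next
  case (add f g)
  then show ?case by (simp add: distrib_left)
qed

lemma scaled_fraction_less: "0 \<le> H \<Longrightarrow> 0 < e \<Longrightarrow> e / (H + 1) * H < (e :: real)"
  by (simp add: field_simps)

text \<open>
  Polynomials on the image of the torus are trigonometric polynomials, which \<open>h\<close> annihilates, and
  they approximate every continuous function uniformly.
\<close>

lemma integral_comp_embedding_eq_0:
  assumes h: "integrable torus h" and 0: "\<And>k. fcoeff h k = 0"
    and \<phi>: "continuous_on UNIV (\<phi> :: complex ^ 'd \<Rightarrow> real)"
  shows "(\<integral>x. h x * \<phi> (torus_embedding x) \<partial>torus) = 0"
proof -
  let ?E = "torus_embedding :: real ^ 'd \<Rightarrow> complex ^ 'd"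
  let ?S = "?E ` cbox 0 (\<chi> i. 1)"
  let ?H = "\<integral>x. \<bar>h x\<bar> \<partial>torus"
  have S: "compact ?S" by (intro compact_continuous_image continuous_on_subset[OF continuous_torus_embedding]) auto
  have cE: "continuous_on UNIV (\<lambda>x. \<psi> (?E x))" if "continuous_on UNIV \<psi>" for \<psi> :: "complex ^ 'd \<Rightarrow> real"
    using continuous_on_compose2[OF that continuous_torus_embedding] by simp
  have "\<bar>\<integral>x. h x * \<phi> (?E x) \<partial>torus\<bar> \<le> e * ?H" if e: "e > 0" for e
  proof -
    obtain g where g: "real_polynomial_function g" and close: "\<And>z. z \<in> ?S \<Longrightarrow> \<bar>\<phi> z - g z\<bar> < e"
      using Stone_Weierstrass_real_polynomial_function[OF S continuous_on_subset[OF \<phi>] e] by blast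
    have cg: "continuous_on UNIV g"
      using g by (simp add: continuous_on_polymonial_function real_polynomial_function_eq)
    have i1: "integrable torus (\<lambda>x. h x * g (?E x))" and i2: "integrable torus (\<lambda>x. h x * \<phi> (?E x))"
      by (intro integrable_mult_continuous h cE cg \<phi>)+
    have "complex_of_real (\<integral>x. h x * g (?E x) \<partial>torus) = (\<integral>x. complex_of_real (h x * g (?E x)) \<partial>torus)"
      by (rule Bochner_Integration.integral_of_real[OF i1, symmetric])
    also have "\<dots> = 0"
      using integral_wave_sum_eq_0[OF h 0 wave_sum_polynomial[OF g]] by (simp only: of_real_mult)
    finally have g0: "(\<integral>x. h x * g (?E x) \<partial>torus) = 0" by simp
    have "(\<integral>x. h x * \<phi> (?E x) \<partial>torus) = (\<integral>x. h x * \<phi> (?E x) - h x * g (?E x) \<partial>torus)"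
      using g0 i1 i2 by simp
    also have "\<bar>\<dots>\<bar> \<le> (\<integral>x. \<bar>h x * \<phi> (?E x) - h x * g (?E x)\<bar> \<partial>torus)"
      by (rule integral_abs_bound)
    also have "\<dots> \<le> (\<integral>x. e * \<bar>h x\<bar> \<partial>torus)"
    proof (rule integral_mono)
      fix x :: "real ^ 'd" assume "x \<in> space torus"
      then have "\<bar>\<phi> (?E x) - g (?E x)\<bar> < e" by (intro close) auto
      then have "\<bar>h x\<bar> * \<bar>\<phi> (?E x) - g (?E x)\<bar> \<le> \<bar>h x\<bar> * e" by (intro mult_left_mono) auto
      then show "\<bar>h x * \<phi> (?E x) - h x * g (?E x)\<bar> \<le> e * \<bar>h x\<bar>"
        by (simp add: right_diff_distrib[symmetric] abs_mult mult.commute)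
    qed (use h i1 i2 in auto)
    finally show ?thesis using h by simp
  qed
  note bound = this
  have "\<bar>\<integral>x. h x * \<phi> (?E x) \<partial>torus\<bar> \<le> 0"
  proof (rule field_le_epsilon)
    fix e :: real assume e: "e > 0"
    have H: "0 \<le> ?H" by simp
    have "\<bar>\<integral>x. h x * \<phi> (?E x) \<partial>torus\<bar> \<le> e / (?H + 1) * ?H" by (intro bound divide_pos_pos[OF e add_nonneg_pos[OF H]] zero_less_one)
    also have "\<dots> \<le> e" using scaled_fraction_less[OF H e] by simp
    finally show "\<bar>\<integral>x. h x * \<phi> (?E x) \<partial>torus\<bar> \<le> 0 + e" by simp
  qed
  then show ?thesis by simp
qed

lemma torus_embedding_inj:
  assumes x: "x \<in> box 0 (\<chi> i. 1)" and y: "y \<in> cbox 0 (\<chi> i. 1)" and eq: "torus_embedding x = torus_embedding y"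
  shows "x = (y :: real ^ 'd)"
proof (subst vec_eq_iff, rule allI)
  fix i
  have "cis (2 * pi * x $ i) = cis (2 * pi * y $ i)"
    using eq by (simp add: torus_embedding_def vec_eq_iff freq_dot_unit)
  then obtain n :: int where "2 * pi * x $ i = 2 * pi * y $ i + 2 * pi * n"
    using sin_cos_eq_iff[of "2 * pi * x $ i" "2 * pi * y $ i"] by (auto simp: complex_eq_iff)
  then have "2 * pi * (x $ i - y $ i) = 2 * pi * n" by (simp add: algebra_simps)
  then have n: "x $ i - y $ i = of_int n" by simp
  have "0 < x $ i" "x $ i < 1" "0 \<le> y $ i" "y $ i \<le> 1"
    using x y by (auto simp: mem_box_cart)
  then have "\<bar>of_int n :: real\<bar> < 1" using n by linarith
  then have "n = 0" by linarith
  then show "x $ i = y $ i" using n by simp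
qed

text \<open>
  The embedding is injective on the open cube, so the image of \<open>B\<close> is disjoint from the compact image of
  the rest of the cube, and the truncated distance to the latter approximates the indicator of \<open>B\<close> from below.
\<close>

lemma integral_open_eq_0:
  assumes h: "integrable torus h" and 0: "\<And>k. fcoeff h k = 0"
    and B: "open B" "B \<subseteq> box 0 (\<chi> i. 1)"
  shows "(\<integral>x. h x * indicator B (x :: real ^ 'd) \<partial>torus) = 0"
proof -
  let ?E = "torus_embedding :: real ^ 'd \<Rightarrow> complex ^ 'd"
  let ?Q = "cbox 0 (\<chi> i. 1) :: (real ^ 'd) set"
  define C where "C = ?E ` (?Q - B)"
  have "compact (?Q - B)" using B by (simp add: compact_diff)
  then have "compact C" unfolding C_def
    by (intro compact_continuous_image continuous_on_subset[OF continuous_torus_embedding]) auto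
  then have C: "closed C" by (rule compact_imp_closed)
  have "0 \<in> ?Q - B" using B(2) by (auto simp: mem_box_cart subset_iff)
  then have C_ne: "C \<noteq> {}" by (auto simp: C_def)
  define \<phi> where "\<phi> = (\<lambda>(n::nat) z. min 1 (real n * infdist z C))"
  have c\<phi>: "continuous_on UNIV (\<phi> n)" for n unfolding \<phi>_def by (intro continuous_intros)
  have lim: "(\<lambda>n. \<phi> n (?E x)) \<longlonglongrightarrow> indicator B x" if x: "x \<in> ?Q" for x
  proof (cases "x \<in> B")
    case True
    have "?E x \<notin> C"
    proof
      assume "?E x \<in> C"
      then obtain y where "y \<in> ?Q" "y \<notin> B" "?E x = ?E y" by (auto simp: C_def)
      then show False using torus_embedding_inj[of x y] B True by auto
    qed
    then have pos: "infdist (?E x) C > 0"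
      using in_closed_iff_infdist_zero[OF C C_ne] infdist_nonneg[of "?E x" C] by (metis less_eq_real_def)
    have "\<forall>\<^sub>F n in sequentially. 1 \<le> real n * infdist (?E x) C"
      using eventually_ge_at_top[of "nat \<lceil>1 / infdist (?E x) C\<rceil>"]
    proof eventually_elim
      case (elim n)
      then have "1 / infdist (?E x) C \<le> real n" by linarith
      then show ?case using pos by (simp add: field_simps)
    qed
    then have "\<forall>\<^sub>F n in sequentially. \<phi> n (?E x) = indicator B x"
      by eventually_elim (use True in \<open>simp add: \<phi>_def\<close>)
    then show ?thesis by (rule tendsto_eventually)
  next
    case False
    then have "?E x \<in> C" using x by (auto simp: C_def)
    then show ?thesis using False by (simp add: \<phi>_def)
  qed
  have "(\<lambda>n. \<integral>x. h x * \<phi> n (?E x) \<partial>torus) \<longlonglongrightarrow> (\<integral>x. h x * indicator B x \<partial>torus)"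
  proof (rule integral_dominated_convergence[where w = "\<lambda>x. \<bar>h x\<bar>"])
    have "B \<in> sets lebesgue" using B(1) by (simp add: borel_open)
    then have "indicat_real B \<in> borel_measurable torus"
      unfolding torus_def by (intro measurable_restrict_space1) simp
    then show "(\<lambda>x. h x * indicator B x) \<in> borel_measurable torus" using h by (auto intro: borel_measurable_times)
    show "(\<lambda>x. h x * \<phi> n (?E x)) \<in> borel_measurable torus" for n
      using continuous_on_compose2[OF c\<phi> continuous_torus_embedding]
      by (intro borel_measurable_integrable integrable_mult_continuous h) simp
    show "AE x in torus. (\<lambda>n. h x * \<phi> n (?E x)) \<longlonglongrightarrow> h x * indicator B x"
      using lim by (intro AE_I2 tendsto_intros) simp
    show "AE x in torus. norm (h x * \<phi> n (?E x)) \<le> \<bar>h x\<bar>" for n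
      by (intro AE_I2) (auto simp: \<phi>_def abs_mult infdist_nonneg intro!: mult_left_le)
  qed (use h in auto)
  then show ?thesis
    using integral_comp_embedding_eq_0[OF h 0 c\<phi>] by (simp add: LIMSEQ_const_iff)
qed

lemma AE_torus_box: "AE x in torus. x \<in> box 0 (\<chi> i. 1)"
proof -
  have "negligible (cbox 0 (\<chi> i. 1) - box 0 (\<chi> i. 1) :: (real ^ 'a) set)"
    by (rule negligible_frontier_interval)
  then have "cbox 0 (\<chi> i. 1) - box 0 (\<chi> i. 1) \<in> null_sets (lebesgue :: (real ^ 'a) measure)"
    using negligible_iff_null_sets by blast
  then have "AE x :: real ^ 'a in lebesgue. x \<notin> cbox 0 (\<chi> i. 1) - box 0 (\<chi> i. 1)" by (rule AE_not_in)
  then show ?thesis unfolding torus_eq_restrict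
    by (subst AE_restrict_space_iff) auto
qed

text \<open>
  Integrals of \<open>h\<close> over open sets vanish; outer regularity extends this to all measurable sets.
\<close>

theorem fcoeff_unique:
  assumes h: "integrable torus h" and 0: "\<And>k. fcoeff h k = 0"
  shows "AE x :: real ^ 'd in torus. h x = 0"
proof (rule density_unique_real[OF h, of "\<lambda>_. 0"])
  fix A :: "(real ^ 'd) set" assume A: "A \<in> sets torus"
  let ?b = "box 0 (\<chi> i. 1) :: (real ^ 'd) set"
  let ?A = "A \<inter> ?b"
  have AL: "?A \<in> sets lebesgue"
    using A by (auto simp: torus_def sets_restrict_space intro!: sets.Int)
  have "\<exists>T. open T \<and> ?A \<subseteq> T \<and> emeasure lebesgue (T - ?A) < ennreal ((1/2) ^ n)" for n :: nat
    using sets_lebesgue_outer_open[OF AL, of "(1/2)^n"] by (metis zero_less_divide_1_iff zero_less_numeral zero_less_power)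
  then obtain T where T: "\<And>n::nat. open (T n)" "\<And>n. ?A \<subseteq> T n" "\<And>n. emeasure lebesgue (T n - ?A) < ennreal ((1/2) ^ n)"
    by metis
  define D where "D = (\<lambda>n. (\<Inter>m\<in>{..n}. T m) \<inter> ?b)"
  define I where "I = (\<Inter>n. D n)"
  have Dopen: "open (D n)" and Db: "D n \<subseteq> ?b" for n unfolding D_def using T(1) by auto
  have DL: "D n \<in> sets lebesgue" for n using Dopen by (simp add: borel_open)
  have AI: "?A \<subseteq> I" unfolding I_def D_def using T(2) by auto
  have IL: "I \<in> sets lebesgue" unfolding I_def using DL by auto
  have "emeasure lebesgue (I - ?A) \<le> ennreal ((1/2)^n)" for n
  proof -
    have "emeasure lebesgue (I - ?A) \<le> emeasure lebesgue (T n - ?A)"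
      using T(1) AL by (intro emeasure_mono) (auto simp: I_def D_def borel_open)
    then show ?thesis using T(3)[of n] by simp
  qed
  moreover have "(\<lambda>n. ennreal ((1/2)^n)) \<longlonglongrightarrow> ennreal 0"
    by (intro tendsto_ennrealI LIMSEQ_power_zero) auto
  ultimately have "emeasure lebesgue (I - ?A) \<le> ennreal 0"
    by (intro LIMSEQ_le_const[of "\<lambda>n. ennreal ((1/2)^n)"]) auto
  then have "I - ?A \<in> null_sets lebesgue" using IL AL by (intro null_setsI) auto
  then have "AE x in lebesgue. x \<notin> I - ?A" by (rule AE_not_in)
  then have "AE x in torus. x \<notin> I - ?A"
    unfolding torus_eq_restrict by (subst AE_restrict_space_iff) auto
  then have eqI: "AE x in torus. h x * indicator I x = indicator A x *\<^sub>R h x"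
    using AE_torus_box by eventually_elim (use AI in \<open>auto simp: indicator_def\<close>)
  have mt: "indicat_real S \<in> borel_measurable torus" if "S \<in> sets lebesgue" for S
    unfolding torus_def using that by (intro measurable_restrict_space1) simp
  have "(\<lambda>n. \<integral>x. h x * indicator (D n) x \<partial>torus) \<longlonglongrightarrow> (\<integral>x. h x * indicator I x \<partial>torus)"
  proof (rule integral_dominated_convergence[where w = "\<lambda>x. \<bar>h x\<bar>"])
    show "AE x in torus. (\<lambda>n. h x * indicator (D n) x) \<longlonglongrightarrow> h x * indicator I x"
    proof (intro AE_I2 tendsto_intros)
      have "decseq D" by (auto simp: decseq_def D_def)
      then show "(\<lambda>n. indicat_real (D n) x) \<longlonglongrightarrow> indicator I x" for x
        unfolding I_def by (rule LIMSEQ_indicator_decseq)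
    qed
    show "(\<lambda>x. h x * indicator I x) \<in> borel_measurable torus"
      by (rule borel_measurable_times[OF borel_measurable_integrable[OF h] mt[OF IL]])
    show "(\<lambda>x. h x * indicator (D n) x) \<in> borel_measurable torus" for n
      by (rule borel_measurable_times[OF borel_measurable_integrable[OF h] mt[OF DL]])
    show "AE x in torus. norm (h x * indicator (D n) x) \<le> \<bar>h x\<bar>" for n
      by (intro AE_I2) (simp add: abs_mult mult_left_le)
  qed (use h in simp)
  then have "(\<integral>x. h x * indicator I x \<partial>torus) = 0"
    using integral_open_eq_0[OF h 0 Dopen Db] by (simp add: LIMSEQ_const_iff)
  moreover have "(\<integral>x. h x * indicator I x \<partial>torus) = (\<integral>x. indicator A x *\<^sub>R h x \<partial>torus)"
    using h mt IL A by (intro integral_cong_AE eqI) (auto intro!: borel_measurable_times borel_measurable_scaleR)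
  ultimately show "(LINT x:A|torus. h x) = (LINT x:A|torus. 0)"
    by (simp add: set_lebesgue_integral_def)
qed simp

lemma fourier_series_integral:
  fixes u :: "real ^ 'd \<Rightarrow> complex"
  assumes c: "(\<lambda>k. cmod (c k)) summable_on UNIV" and u: "integrable torus u"
  defines "S \<equiv> (\<lambda>x. \<Sum>\<^sub>\<infinity>k. c k * wave k x)"
  shows "continuous_on UNIV S"
    and "((\<lambda>k. c k * (\<integral>x. wave k x * u x \<partial>torus)) has_sum (\<integral>x. S x * u x \<partial>torus)) UNIV"
proof -
  have unif: "uniform_limit UNIV (\<lambda>F x. \<Sum>k\<in>F. c k * wave k x) S (finite_subsets_at_top UNIV)"
    unfolding S_def by (rule Weierstrass_m_test_general[OF _ c]) (simp add: norm_mult)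
  show cont: "continuous_on UNIV S"
    by (rule uniform_limit_theorem[OF _ unif]) (auto intro!: always_eventually continuous_intros continuous_wave)
  let ?U = "\<integral>x. cmod (u x) \<partial>torus"
  show "((\<lambda>k. c k * (\<integral>x. wave k x * u x \<partial>torus)) has_sum (\<integral>x. S x * u x \<partial>torus)) UNIV"
    unfolding has_sum_def
  proof (rule tendstoI)
    fix e :: real assume e: "e > 0"
    have U: "0 \<le> ?U" by simp
    have "\<forall>\<^sub>F F in finite_subsets_at_top UNIV. \<forall>x\<in>UNIV. dist (\<Sum>k\<in>F. c k * wave k x) (S x) < e / (?U + 1)"
      by (intro uniform_limitD[OF unif] divide_pos_pos[OF e add_nonneg_pos[OF U]] zero_less_one)
    then show "\<forall>\<^sub>F F in finite_subsets_at_top UNIV. dist (\<Sum>k\<in>F. c k * (\<integral>x. wave k x * u x \<partial>torus)) (\<integral>x. S x * u x \<partial>torus) < e"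
    proof eventually_elim
      case (elim F)
      let ?P = "\<lambda>x. \<Sum>k\<in>F. c k * wave k x"
      have iP: "integrable torus (\<lambda>x. u x * ?P x)" and iS: "integrable torus (\<lambda>x. u x * S x)"
        by (intro integrable_mult_continuous u cont continuous_intros continuous_wave)+
      have iw: "integrable torus (\<lambda>x. wave k x * u x)" for k
        using integrable_mult_continuous[OF u continuous_wave[of k]] by (simp add: mult.commute)
      have "(\<integral>x. u x * ?P x \<partial>torus) = (\<integral>x. (\<Sum>k\<in>F. c k * (wave k x * u x)) \<partial>torus)"
        by (intro Bochner_Integration.integral_cong refl) (simp add: sum_distrib_left mult_ac)
      also have "\<dots> = (\<Sum>k\<in>F. \<integral>x. c k * (wave k x * u x) \<partial>torus)"
        using iw by (intro Bochner_Integration.integral_sum integrable_mult_right)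
      finally have "(\<Sum>k\<in>F. c k * (\<integral>x. wave k x * u x \<partial>torus)) = (\<integral>x. u x * ?P x \<partial>torus)"
        by simp
      then have "dist (\<Sum>k\<in>F. c k * (\<integral>x. wave k x * u x \<partial>torus)) (\<integral>x. S x * u x \<partial>torus)
          = cmod (\<integral>x. u x * ?P x - u x * S x \<partial>torus)"
        by (simp only: dist_norm Bochner_Integration.integral_diff[OF iP iS] mult.commute[of "S _"])
      also have "\<dots> \<le> (\<integral>x. cmod (u x * ?P x - u x * S x) \<partial>torus)"
        by (rule integral_norm_bound)
      also have "\<dots> \<le> (\<integral>x. e / (?U + 1) * cmod (u x) \<partial>torus)"
      proof (rule integral_mono)
        fix x :: "real ^ 'd"
        have "cmod (?P x - S x) \<le> e / (?U + 1)" using elim by (simp add: dist_norm less_imp_le)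
        then have "cmod (u x) * cmod (?P x - S x) \<le> cmod (u x) * (e / (?U + 1))" by (intro mult_left_mono) auto
        then show "cmod (u x * ?P x - u x * S x) \<le> e / (?U + 1) * cmod (u x)"
          by (simp only: right_diff_distrib[symmetric] norm_mult mult.commute[of _ "e / (?U + 1)"])
      qed (use iP iS u in auto)
      also have "\<dots> = e / (?U + 1) * ?U" by simp
      also have "\<dots> < e" by (rule scaled_fraction_less[OF U e])
      finally show ?case .
    qed
  qed
qed

text \<open>
  The Fourier series of \<open>f\<close> converges uniformly to a continuous function with the same coefficients,
  which is \<open>f\<close> almost everywhere by uniqueness; integrate the series against \<open>g\<close> term by term.
\<close>

theorem Parseval_abs_summable:
  assumes f: "f \<in> L2" and g: "g \<in> L2" and c: "(\<lambda>k. cmod (fcoeff f k)) summable_on UNIV"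
  shows "L2_inner f g = Re (\<Sum>\<^sub>\<infinity>k. fcoeff f k * cnj (fcoeff g k))"
proof -
  define S where "S = (\<lambda>x. \<Sum>\<^sub>\<infinity>k. fcoeff f k * wave k x)"
  have cont: "continuous_on UNIV S"
    unfolding S_def by (rule fourier_series_integral(1)[OF c, of "\<lambda>_. 0"]) simp
  have sum: "((\<lambda>k. fcoeff f k * (\<integral>x. wave k x * u x \<partial>torus)) has_sum (\<integral>x. S x * u x \<partial>torus)) UNIV"
    if "integrable torus u" for u
    using fourier_series_integral(2)[OF c that] by (simp add: S_def)
  have S_coeff: "(\<integral>x. S x * cnj (wave l x) \<partial>torus) = fcoeff f l" for l
  proof (rule has_sum_unique)
    show "((\<lambda>k. fcoeff f k * (\<integral>x. wave k x * cnj (wave l x) \<partial>torus)) has_sum (\<integral>x. S x * cnj (wave l x) \<partial>torus)) UNIV"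
      by (intro sum integrable_continuous_torus continuous_intros continuous_wave)
    show "((\<lambda>k. fcoeff f k * (\<integral>x. wave k x * cnj (wave l x) \<partial>torus)) has_sum fcoeff f l) UNIV"
      unfolding integral_wave_mult by (rule has_sum_finite_neutralI[of "{l}"]) auto
  qed
  have fi: "integrable torus (\<lambda>x. complex_of_real (f x))" using L2_integrable[OF f] by simp
  have Si: "integrable torus S" by (rule integrable_continuous_torus[OF cont])
  define h where "h = (\<lambda>x. complex_of_real (f x) - S x)"
  have hi: "integrable torus h" unfolding h_def using fi Si by simp
  have h0: "(\<integral>x. h x * cnj (wave l x) \<partial>torus) = 0" for l
  proof -
    have "integrable torus (\<lambda>x. S x * cnj (wave l x))"
      by (intro integrable_mult_continuous Si continuous_intros continuous_wave)
    then show ?thesis using fcoeff_integrable[OF L2_integrable[OF f], of l] S_coeff[of l]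
      by (simp add: h_def left_diff_distrib fcoeff_def)
  qed
  have h0': "(\<integral>x. cnj (h x) * cnj (wave l x) \<partial>torus) = 0" for l
  proof -
    have "(\<integral>x. cnj (h x) * cnj (wave l x) \<partial>torus) = cnj (\<integral>x. h x * cnj (wave (- l) x) \<partial>torus)"
    proof -
      have "wave (- l) x = cnj (wave l x)" for x by (simp only: freq_dot_simps cis_cnj)
      then show ?thesis
        unfolding Bochner_Integration.integral_cnj[symmetric] by (simp only: complex_cnj_mult complex_cnj_cnj)
    qed
    then show ?thesis by (simp only: h0 complex_cnj_zero)
  qed
  have hw: "integrable torus (\<lambda>x. h x * cnj (wave l x))" "integrable torus (\<lambda>x. cnj (h x) * cnj (wave l x))" for l
    using hi by (intro integrable_mult_continuous continuous_intros continuous_wave; simp)+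
  have "fcoeff (\<lambda>x. Re (h x)) l = 0" for l
  proof -
    have "fcoeff (\<lambda>x. Re (h x)) l = (\<integral>x. (1/2) * (h x * cnj (wave l x) + cnj (h x) * cnj (wave l x)) \<partial>torus)"
      unfolding fcoeff_def
      by (intro Bochner_Integration.integral_cong) (auto simp: complex_eq_iff)
    also have "\<dots> = 0" using hw h0 h0' by simp
    finally show ?thesis .
  qed
  then have Re0: "AE x in torus. Re (h x) = 0" using hi by (intro fcoeff_unique) auto
  have "fcoeff (\<lambda>x. Im (h x)) l = 0" for l
  proof -
    have "fcoeff (\<lambda>x. Im (h x)) l = (\<integral>x. (-\<i>/2) * (h x * cnj (wave l x) - cnj (h x) * cnj (wave l x)) \<partial>torus)"
      unfolding fcoeff_def
      by (intro Bochner_Integration.integral_cong) (auto simp: complex_eq_iff)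
    also have "\<dots> = 0" using hw h0 h0' by simp
    finally show ?thesis .
  qed
  then have Im0: "AE x in torus. Im (h x) = 0" using hi by (intro fcoeff_unique) auto
  have eq: "AE x in torus. complex_of_real (f x * g x) = S x * of_real (g x)"
    using Re0 Im0 by eventually_elim (simp add: h_def complex_eq_iff)
  have gi: "integrable torus (\<lambda>x. complex_of_real (g x))" using L2_integrable[OF g] by simp
  have gw: "(\<integral>x. wave k x * of_real (g x) \<partial>torus) = cnj (fcoeff g k)" for k
    unfolding fcoeff_def Bochner_Integration.integral_cnj[symmetric] by (simp add: mult.commute)
  have "complex_of_real (L2_inner f g) = (\<integral>x. complex_of_real (f x * g x) \<partial>torus)"
    unfolding L2_inner_def by (rule Bochner_Integration.integral_of_real[OF L2_integrable_mult[OF f g], symmetric])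
  also have "\<dots> = (\<integral>x. S x * of_real (g x) \<partial>torus)"
    using borel_measurable_times[OF continuous_torus_measurable[OF cont] borel_measurable_integrable[OF gi]]
      borel_measurable_integrable[OF integrable_of_real[OF L2_integrable_mult[OF f g]]]
    by (intro integral_cong_AE eq)
  also have "\<dots> = (\<Sum>\<^sub>\<infinity>k. fcoeff f k * cnj (fcoeff g k))"
    using sum[OF gi] unfolding gw by (simp add: infsumI)
  finally have eq: "complex_of_real (L2_inner f g) = (\<Sum>\<^sub>\<infinity>k. fcoeff f k * cnj (fcoeff g k))" .
  show ?thesis using arg_cong[OF eq, of Re] by (simp only: Re_complex_of_real)
qed

section \<open>Sobolev weights on the frequency lattice\<close>

lemma infsum_Cauchy_Schwarz:
  fixes f g :: "'a \<Rightarrow> real"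
  assumes nn: "\<And>k. k \<in> A \<Longrightarrow> 0 \<le> f k" "\<And>k. k \<in> A \<Longrightarrow> 0 \<le> g k"
    and f: "(\<lambda>k. (f k)\<^sup>2) summable_on A" and g: "(\<lambda>k. (g k)\<^sup>2) summable_on A"
  shows "(\<lambda>k. f k * g k) summable_on A"
    and "(\<Sum>\<^sub>\<infinity>k\<in>A. f k * g k) \<le> sqrt (\<Sum>\<^sub>\<infinity>k\<in>A. (f k)\<^sup>2) * sqrt (\<Sum>\<^sub>\<infinity>k\<in>A. (g k)\<^sup>2)" (is "_ \<le> ?C")
proof -
  have fin: "(\<Sum>k\<in>F. f k * g k) \<le> ?C" if F: "finite F" "F \<subseteq> A" for F
  proof -
    have "(\<Sum>k\<in>F. f k * g k)\<^sup>2 \<le> (\<Sum>k\<in>F. (f k)\<^sup>2) * (\<Sum>k\<in>F. (g k)\<^sup>2)"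
      by (rule Cauchy_Schwarz_ineq_sum)
    also have "\<dots> \<le> (\<Sum>\<^sub>\<infinity>k\<in>A. (f k)\<^sup>2) * (\<Sum>\<^sub>\<infinity>k\<in>A. (g k)\<^sup>2)"
      by (intro mult_mono finite_sum_le_infsum f g F sum_nonneg infsum_nonneg) auto
    finally have "\<bar>\<Sum>k\<in>F. f k * g k\<bar> \<le> ?C"
      using real_sqrt_le_mono by (fastforce simp: real_sqrt_mult)
    then show ?thesis by simp
  qed
  show s: "(\<lambda>k. f k * g k) summable_on A"
    by (rule nonneg_bdd_above_summable_on) (use nn fin in \<open>auto intro!: bdd_aboveI2\<close>)
  show "(\<Sum>\<^sub>\<infinity>k\<in>A. f k * g k) \<le> ?C" by (rule infsum_le_finite_sums[OF s fin])
qed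

lemma bracket_ge_1: "1 \<le> japanese_bracket k"
  by (simp add: japanese_bracket_def sum_nonneg)

lemma bracket_pos: "0 < japanese_bracket k"
  using bracket_ge_1[of k] by linarith

lemma bracket_minus [simp]: "japanese_bracket (- k) = japanese_bracket k"
  by (simp add: japanese_bracket_def)

lemma abs_component_le_bracket: "\<bar>of_int (k $ i)\<bar> \<le> japanese_bracket k"
proof -
  have "(of_int (k $ i))\<^sup>2 \<le> (\<Sum>i\<in>UNIV. (of_int (k $ i))\<^sup>2 :: real)"
    by (rule member_le_sum) auto
  then have "sqrt ((of_int (k $ i))\<^sup>2) \<le> japanese_bracket k"
    unfolding japanese_bracket_def by (intro real_sqrt_le_mono) linarith
  then show ?thesis by simp
qed

lemma
  fixes R :: real
  assumes R: "1 \<le> R"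
  shows finite_bracket_le: "finite {k :: int ^ 'd. japanese_bracket k \<le> R}"
    and card_bracket_le: "real (card {k :: int ^ 'd. japanese_bracket k \<le> R}) \<le> (3 * R) ^ CARD('d)"
proof -
  let ?I = "{- \<lfloor>R\<rfloor>..\<lfloor>R\<rfloor>}"
  let ?P = "PiE (UNIV :: 'd set) (\<lambda>_. ?I)"
  have sub: "{k :: int ^ 'd. japanese_bracket k \<le> R} \<subseteq> vec_lambda ` ?P"
  proof
    fix k :: "int ^ 'd" assume "k \<in> {k. japanese_bracket k \<le> R}"
    then have "\<bar>of_int (k $ i)\<bar> \<le> R" for i using abs_component_le_bracket[of k i] by simp
    then have "vec_nth k \<in> ?P" by (auto simp: abs_le_iff le_floor_iff) (smt (verit) floor_of_int le_floor_iff of_int_minus)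
    then show "k \<in> vec_lambda ` ?P" by (metis image_eqI vec_nth_inverse)
  qed
  have fP: "finite ?P" by (intro finite_PiE) auto
  show "finite {k :: int ^ 'd. japanese_bracket k \<le> R}" using finite_subset[OF sub] fP by blast
  have "card {k :: int ^ 'd. japanese_bracket k \<le> R} \<le> card (vec_lambda ` ?P :: (int ^ 'd) set)"
    using fP by (intro card_mono sub) auto
  also have "\<dots> \<le> card ?P" by (rule card_image_le[OF fP])
  also have "\<dots> = card ?I ^ CARD('d)" by (subst card_PiE) auto
  finally have "real (card {k :: int ^ 'd. japanese_bracket k \<le> R}) \<le> real (card ?I) ^ CARD('d)"
    by (metis of_nat_le_iff of_nat_power)
  also have "real (card ?I) \<le> 3 * R" using R by simp linarith
  then have "real (card ?I) ^ CARD('d) \<le> (3 * R) ^ CARD('d)" by (intro power_mono) auto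
  finally show "real (card {k :: int ^ 'd. japanese_bracket k \<le> R}) \<le> (3 * R) ^ CARD('d)" .
qed

text \<open>
  The blocks exhaust the lattice, and their finite unions serve as a countable exhaustion by finite sets
  along which unordered sums can be computed.
\<close>

definition dyadic_block :: "nat \<Rightarrow> (int ^ 'd) set" where
  "dyadic_block j = {k. 2 ^ j \<le> japanese_bracket k \<and> japanese_bracket k < 2 ^ Suc j}"

lemma finite_dyadic_block [simp]: "finite (dyadic_block j)"
  by (rule finite_subset[OF _ finite_bracket_le[OF one_le_power[of 2 "Suc j"]]]) (auto simp: dyadic_block_def)

lemma card_dyadic_block: "real (card (dyadic_block j :: (int ^ 'd) set)) \<le> 6 ^ CARD('d) * (2 ^ CARD('d)) ^ j"
proof -
  have "card (dyadic_block j :: (int ^ 'd) set) \<le> card {k :: int ^ 'd. japanese_bracket k \<le> 2 ^ Suc j}"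
    by (intro card_mono finite_bracket_le one_le_power) (auto simp: dyadic_block_def)
  also have "real \<dots> \<le> (3 * 2 ^ Suc j) ^ CARD('d)" by (intro card_bracket_le one_le_power) simp
  also have "\<dots> = 6 ^ CARD('d) * (2 ^ CARD('d)) ^ j"
    by (simp add: power_mult_distrib mult.assoc[symmetric] power_mult[symmetric] mult.commute[of j] flip: power_mult_distrib)
  finally show ?thesis by simp
qed

lemma dyadic_block_disjoint: "k \<in> dyadic_block i \<Longrightarrow> k \<in> dyadic_block j \<Longrightarrow> i = j"
proof (induction i j rule: linorder_wlog)
  case (le i j)
  show ?case
  proof (rule ccontr)
    assume "i \<noteq> j"
    then have "Suc i \<le> j" using le by simp
    then have "(2::real) ^ Suc i \<le> 2 ^ j" by (intro power_increasing) auto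
    then show False using le by (auto simp: dyadic_block_def)
  qed
qed auto

lemma dyadic_block_cover: "\<exists>j. k \<in> dyadic_block j"
proof -
  have "\<exists>n::nat. japanese_bracket k < 2 ^ n" using real_arch_pow[of 2] by simp
  define n where "n = (LEAST n::nat. japanese_bracket k < 2 ^ n)"
  have n: "japanese_bracket k < 2 ^ n" unfolding n_def by (rule LeastI_ex) fact
  have "n \<noteq> 0" using n bracket_ge_1[of k] by (intro notI) simp
  then obtain j where j: "n = Suc j" by (cases n) auto
  then have "\<not> japanese_bracket k < 2 ^ j" unfolding n_def using not_less_Least[of j] by (metis lessI n_def)
  then show ?thesis using n j by (auto simp: dyadic_block_def not_less)
qed

lemma finite_in_UN_dyadic_block:
  assumes "finite F" shows "\<exists>n. F \<subseteq> (\<Union>j<n. dyadic_block j)"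
  using assms
proof (induction F)
  case (insert k F)
  then obtain n where n: "F \<subseteq> (\<Union>j<n. dyadic_block j)" by auto
  obtain j where "k \<in> dyadic_block j" using dyadic_block_cover by blast
  then have "insert k F \<subseteq> (\<Union>j<max n (Suc j). dyadic_block j)" using n by fastforce
  then show ?case by blast
qed auto

lemma filterlim_dyadic: "filterlim (\<lambda>n. \<Union>j<n. dyadic_block j) (finite_subsets_at_top UNIV) sequentially"
  unfolding filterlim_finite_subsets_at_top
proof (intro allI impI)
  fix F :: "(int ^ 'a) set" assume "finite F \<and> F \<subseteq> UNIV"
  then obtain n where n: "F \<subseteq> (\<Union>j<n. dyadic_block j)" using finite_in_UN_dyadic_block by blast
  show "\<forall>\<^sub>F y in sequentially. finite (\<Union>j<y. dyadic_block j :: (int ^ 'a) set) \<and> F \<subseteq> (\<Union>j<y. dyadic_block j) \<and> (\<Union>j<y. dyadic_block j :: (int ^ 'a) set) \<subseteq> UNIV"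
    using eventually_ge_at_top[of n] by eventually_elim (use n in fastforce)
qed

lemma sum_dyadic_tendsto:
  fixes f :: "int ^ 'd \<Rightarrow> 'b::{comm_monoid_add, topological_space}"
  assumes "(f has_sum S) UNIV"
  shows "(\<lambda>n. sum f (\<Union>j<n. dyadic_block j)) \<longlonglongrightarrow> S"
  using filterlim_compose[OF assms[unfolded has_sum_def] filterlim_dyadic] .

lemma summable_bracket:
  assumes s: "2 * s > real CARD('d)"
  shows "(\<lambda>k :: int ^ 'd. japanese_bracket k powr (- (2 * s))) summable_on UNIV"
proof -
  let ?q = "2 powr (real CARD('d) - 2 * s)"
  have q: "?q < 1" using s by (simp add: powr_less_one)
  have q0: "0 < ?q" by simp
  let ?C = "6 ^ CARD('d) * (1 / (1 - ?q))"
  have bound: "(\<Sum>k\<in>F. japanese_bracket k powr (- (2 * s))) \<le> ?C" if F: "finite F" for F :: "(int ^ 'd) set"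
  proof -
    obtain n where n: "F \<subseteq> (\<Union>j<n. dyadic_block j)" using finite_in_UN_dyadic_block[OF F] by blast
    have "(\<Sum>k\<in>F. japanese_bracket k powr (- (2 * s))) \<le> (\<Sum>k\<in>(\<Union>j<n. dyadic_block j :: (int ^ 'd) set). japanese_bracket k powr (- (2 * s)))"
      using n by (intro sum_mono2) auto
    also have "\<dots> = (\<Sum>j<n. \<Sum>k\<in>(dyadic_block j :: (int ^ 'd) set). japanese_bracket k powr (- (2 * s)))"
      by (rule sum.UNION_disjoint) (auto dest: dyadic_block_disjoint)
    also have "\<dots> \<le> (\<Sum>j<n. 6 ^ CARD('d) * ?q ^ j)"
    proof (rule sum_mono)
      fix j
      have "(\<Sum>k\<in>dyadic_block j. japanese_bracket (k :: int ^ 'd) powr (- (2 * s))) \<le> (\<Sum>k\<in>(dyadic_block j :: (int ^ 'd) set). (2 ^ j) powr (- (2 * s)))"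
        using s by (intro sum_mono powr_mono2') (auto simp: dyadic_block_def)
      also have "\<dots> \<le> (6 ^ CARD('d) * (2 ^ CARD('d)) ^ j) * (2 ^ j) powr (- (2 * s))"
        using card_dyadic_block[of j, where 'd = 'd] by (simp add: mult_right_mono)
      also have "\<dots> = 6 ^ CARD('d) * ?q ^ j"
        by (simp add: powr_realpow[symmetric] powr_powr powr_add[symmetric] algebra_simps)
      finally show "(\<Sum>k\<in>dyadic_block j. japanese_bracket (k :: int ^ 'd) powr (- (2 * s))) \<le> 6 ^ CARD('d) * ?q ^ j" .
    qed
    also have "\<dots> = 6 ^ CARD('d) * (\<Sum>j<n. ?q ^ j)" by (simp add: sum_distrib_left)
    also have "(\<Sum>j<n. ?q ^ j) \<le> (\<Sum>j. ?q ^ j)" using q q0 by (intro sum_le_suminf summable_geometric) auto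
    also have "\<dots> = 1 / (1 - ?q)" using q q0 by (intro suminf_geometric) auto
    finally show ?thesis by (simp add: mult_left_mono)
  qed
  show ?thesis by (rule nonneg_bdd_above_summable_on) (use bound in \<open>auto intro!: bdd_aboveI2\<close>)
qed

text \<open>
  Sobolev spaces as weighted square-summable families of Fourier coefficients, detached from distributions.
\<close>

definition H_finite :: "real \<Rightarrow> (int ^ 'd \<Rightarrow> complex) \<Rightarrow> bool" where
  "H_finite s a \<longleftrightarrow> (\<lambda>k. japanese_bracket k powr (2 * s) * (cmod (a k))\<^sup>2) summable_on UNIV"

definition H_norm :: "real \<Rightarrow> (int ^ 'd \<Rightarrow> complex) \<Rightarrow> real" where
  "H_norm s a = sqrt (\<Sum>\<^sub>\<infinity>k. japanese_bracket k powr (2 * s) * (cmod (a k))\<^sup>2)"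

lemma sobolev_iff: "T \<in> sobolev s \<longleftrightarrow> T \<in> distributions \<and> H_finite s (fourier T)"
  by (simp add: sobolev_def H_finite_def)

lemma sobolev_norm_eq: "sobolev_norm s T = H_norm s (fourier T)"
  by (simp add: sobolev_norm_def H_norm_def)

lemma H_norm_nonneg: "0 \<le> H_norm s a"
  by (simp add: H_norm_def infsum_nonneg)

lemma H_norm_sq: "(H_norm s a)\<^sup>2 = (\<Sum>\<^sub>\<infinity>k. japanese_bracket k powr (2 * s) * (cmod (a k))\<^sup>2)"
  by (simp add: H_norm_def infsum_nonneg)

lemma H_sum_le: "H_finite s a \<Longrightarrow> finite F \<Longrightarrow> (\<Sum>k\<in>F. japanese_bracket k powr (2 * s) * (cmod (a k))\<^sup>2) \<le> (H_norm s a)\<^sup>2"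
  unfolding H_norm_sq H_finite_def by (intro finite_sum_le_infsum) auto

lemma H_norm_leI:
  assumes "\<And>F. finite F \<Longrightarrow> (\<Sum>k\<in>F. japanese_bracket k powr (2 * s) * (cmod (a k))\<^sup>2) \<le> C\<^sup>2" "0 \<le> C"
  shows "H_finite s a" "H_norm s a \<le> C"
proof -
  show f: "H_finite s a" unfolding H_finite_def
    by (rule nonneg_bdd_above_summable_on) (use assms in \<open>auto intro!: bdd_aboveI2\<close>)
  have "(H_norm s a)\<^sup>2 \<le> C\<^sup>2" unfolding H_norm_sq
    by (rule infsum_le_finite_sums) (use f assms in \<open>auto simp: H_finite_def\<close>)
  then show "H_norm s a \<le> C" using assms(2) by (simp add: power2_le_iff_abs_le H_norm_nonneg)
qed

lemma H_pairing:
  assumes a: "H_finite s a" and b: "H_finite (- s) b"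
  shows "(\<lambda>k. cmod (a k * cnj (b k))) summable_on A"
    and "(\<lambda>k. a k * cnj (b k)) summable_on A"
    and "(\<Sum>\<^sub>\<infinity>k\<in>A. cmod (a k * cnj (b k))) \<le> H_norm s a * H_norm (- s) b"
    and "cmod (\<Sum>\<^sub>\<infinity>k\<in>A. a k * cnj (b k)) \<le> H_norm s a * H_norm (- s) b"
proof -
  define f where "f = (\<lambda>k. japanese_bracket k powr s * cmod (a k))"
  define g where "g = (\<lambda>k. japanese_bracket k powr (- s) * cmod (b k))"
  have f2: "(f k)\<^sup>2 = japanese_bracket k powr (2 * s) * (cmod (a k))\<^sup>2" for k
    using bracket_pos[of k] by (simp add: f_def power_mult_distrib powr_powr mult.commute flip: powr_realpow powr_numeral)
  have g2: "(g k)\<^sup>2 = japanese_bracket k powr (2 * - s) * (cmod (b k))\<^sup>2" for k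
    using bracket_pos[of k] by (simp add: g_def power_mult_distrib powr_powr mult.commute flip: powr_realpow powr_numeral)
  have fg: "f k * g k = cmod (a k * cnj (b k))" for k
    using bracket_pos[of k] by (simp add: f_def g_def norm_mult powr_minus field_simps)
  have fs: "(\<lambda>k. (f k)\<^sup>2) summable_on UNIV" and gs: "(\<lambda>k. (g k)\<^sup>2) summable_on UNIV"
    using a b unfolding f2 g2 H_finite_def by auto
  note CS = infsum_Cauchy_Schwarz[of UNIV f g, OF _ _ fs gs]
  have all: "(\<lambda>k. cmod (a k * cnj (b k))) summable_on UNIV"
    using CS(1) unfolding fg by (auto simp: f_def g_def)
  have le: "(\<Sum>\<^sub>\<infinity>k. cmod (a k * cnj (b k))) \<le> H_norm s a * H_norm (- s) b"
    using CS(2) unfolding fg f2 g2 H_norm_def[symmetric] by (auto simp: f_def g_def)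
  show A: "(\<lambda>k. cmod (a k * cnj (b k))) summable_on A"
    by (rule summable_on_subset_banach[OF all]) simp
  then show "(\<lambda>k. a k * cnj (b k)) summable_on A" by (rule abs_summable_summable)
  have "(\<Sum>\<^sub>\<infinity>k\<in>A. cmod (a k * cnj (b k))) \<le> (\<Sum>\<^sub>\<infinity>k. cmod (a k * cnj (b k)))"
    by (rule infsum_mono2[OF A all]) auto
  then show 1: "(\<Sum>\<^sub>\<infinity>k\<in>A. cmod (a k * cnj (b k))) \<le> H_norm s a * H_norm (- s) b" using le by linarith
  have "cmod (\<Sum>\<^sub>\<infinity>k\<in>A. a k * cnj (b k)) \<le> (\<Sum>\<^sub>\<infinity>k\<in>A. cmod (a k * cnj (b k)))"
    by (rule norm_infsum_bound[OF A])
  then show "cmod (\<Sum>\<^sub>\<infinity>k\<in>A. a k * cnj (b k)) \<le> H_norm s a * H_norm (- s) b" using 1 by linarith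
qed

lemma H_mono:
  assumes a: "H_finite t a" and "s \<le> t"
  shows "H_finite s a" "H_norm s a \<le> H_norm t a"
proof -
  have "(\<Sum>k\<in>F. japanese_bracket k powr (2 * s) * (cmod (a k))\<^sup>2) \<le> (H_norm t a)\<^sup>2" if "finite F" for F
  proof -
    have "(\<Sum>k\<in>F. japanese_bracket k powr (2 * s) * (cmod (a k))\<^sup>2) \<le> (\<Sum>k\<in>F. japanese_bracket k powr (2 * t) * (cmod (a k))\<^sup>2)"
      using assms(2) bracket_ge_1 by (intro sum_mono mult_right_mono powr_mono) auto
    also have "\<dots> \<le> (H_norm t a)\<^sup>2" by (rule H_sum_le[OF a that])
    finally show ?thesis .
  qed
  then show "H_finite s a" "H_norm s a \<le> H_norm t a" using H_norm_leI[of s a "H_norm t a"] H_norm_nonneg by auto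
qed

definition cut_above :: "real \<Rightarrow> (int ^ 'd \<Rightarrow> complex) \<Rightarrow> int ^ 'd \<Rightarrow> complex" where
  "cut_above m a = (\<lambda>k. if m < japanese_bracket k then a k else 0)"

lemma cut_above_gain:
  assumes a: "H_finite t a" and st: "s \<le> t" and m: "0 < m"
  shows "H_finite s (cut_above m a)" "H_norm s (cut_above m a) \<le> m powr (s - t) * H_norm t a"
proof -
  have "(\<Sum>k\<in>F. japanese_bracket k powr (2 * s) * (cmod (cut_above m a k))\<^sup>2) \<le> (m powr (s - t) * H_norm t a)\<^sup>2" if "finite F" for F
  proof -
    have "(\<Sum>k\<in>F. japanese_bracket k powr (2 * s) * (cmod (cut_above m a k))\<^sup>2) \<le> (\<Sum>k\<in>F. m powr (2 * (s - t)) * (japanese_bracket k powr (2 * t) * (cmod (a k))\<^sup>2))"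
    proof (rule sum_mono)
      fix k
      show "japanese_bracket k powr (2 * s) * (cmod (cut_above m a k))\<^sup>2 \<le> m powr (2 * (s - t)) * (japanese_bracket k powr (2 * t) * (cmod (a k))\<^sup>2)"
      proof (cases "m < japanese_bracket k")
        case True
        then have "japanese_bracket k powr (2 * (s - t)) \<le> m powr (2 * (s - t))" using st m by (intro powr_mono2') auto
        then have "japanese_bracket k powr (2 * (s - t)) * japanese_bracket k powr (2 * t) \<le> m powr (2 * (s - t)) * japanese_bracket k powr (2 * t)"
          by (intro mult_right_mono) auto
        then have "japanese_bracket k powr (2 * s) \<le> m powr (2 * (s - t)) * japanese_bracket k powr (2 * t)"
          by (simp add: powr_add[symmetric] algebra_simps)
        then show ?thesis using True by (simp add: cut_above_def mult_right_mono mult.assoc[symmetric])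
      qed (simp add: cut_above_def)
    qed
    also have "\<dots> = m powr (2 * (s - t)) * (\<Sum>k\<in>F. japanese_bracket k powr (2 * t) * (cmod (a k))\<^sup>2)"
      by (simp add: sum_distrib_left)
    also have "\<dots> \<le> m powr (2 * (s - t)) * (H_norm t a)\<^sup>2" by (intro mult_left_mono H_sum_le a that) auto
    also have "\<dots> = (m powr (s - t) * H_norm t a)\<^sup>2"
      by (simp only: power_mult_distrib power2_eq_square[of "m powr _"] powr_add[symmetric]) (simp add: algebra_simps)
    finally show ?thesis .
  qed
  note bound = this
  have "0 \<le> m powr (s - t) * H_norm t a" by (simp add: H_norm_nonneg)
  from H_norm_leI[OF bound this] show "H_finite s (cut_above m a)" "H_norm s (cut_above m a) \<le> m powr (s - t) * H_norm t a"
    by auto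
qed

definition pairing :: "(int ^ 'd \<Rightarrow> complex) \<Rightarrow> (int ^ 'd \<Rightarrow> complex) \<Rightarrow> real" where
  "pairing a b = Re (\<Sum>\<^sub>\<infinity>k. a k * cnj (b k))"

lemma sobolev_pairing_eq: "sobolev_pairing S T = pairing (fourier S) (fourier T)"
  by (simp add: sobolev_pairing_def pairing_def)

definition low_norm :: "real \<Rightarrow> (int ^ 'd \<Rightarrow> complex) \<Rightarrow> real" where
  "low_norm m b = sqrt (\<Sum>k | japanese_bracket k \<le> m. (cmod (b k))\<^sup>2)"

lemma finite_bracket_le': "finite {k :: int ^ 'd. japanese_bracket k \<le> m}"
  by (rule finite_subset[OF _ finite_bracket_le[of "max 1 m"]]) auto

lemma low_norm_le:
  assumes b: "H_finite (- s) b" and s: "0 \<le> s" and m: "0 < m"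
  shows "low_norm m b \<le> m powr s * H_norm (- s) b"
proof -
  let ?F = "{k :: int ^ 'a. japanese_bracket k \<le> m}"
  have "(\<Sum>k\<in>?F. (cmod (b k))\<^sup>2) \<le> (\<Sum>k\<in>?F. m powr (2 * s) * (japanese_bracket k powr (2 * - s) * (cmod (b k))\<^sup>2))"
  proof (rule sum_mono)
    fix k assume "k \<in> ?F"
    then have "m powr (- (2 * s)) \<le> japanese_bracket k powr (- (2 * s))"
      using s bracket_pos[of k] by (intro powr_mono2') auto
    then have "m powr (2 * s) * m powr (- (2 * s)) \<le> m powr (2 * s) * japanese_bracket k powr (- (2 * s))"
      by (intro mult_left_mono) auto
    then have "1 \<le> m powr (2 * s) * japanese_bracket k powr (- (2 * s))"
      using m by (simp add: powr_add[symmetric])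
    then have "1 * (cmod (b k))\<^sup>2 \<le> m powr (2 * s) * japanese_bracket k powr (- (2 * s)) * (cmod (b k))\<^sup>2"
      by (rule mult_right_mono) auto
    then show "(cmod (b k))\<^sup>2 \<le> m powr (2 * s) * (japanese_bracket k powr (2 * - s) * (cmod (b k))\<^sup>2)"
      by (simp add: mult.assoc)
  qed
  also have "\<dots> = m powr (2 * s) * (\<Sum>k\<in>?F. japanese_bracket k powr (2 * - s) * (cmod (b k))\<^sup>2)"
    by (simp only: sum_distrib_left)
  also have "\<dots> \<le> m powr (2 * s) * (H_norm (- s) b)\<^sup>2"
    by (intro mult_left_mono H_sum_le b finite_bracket_le') auto
  also have "\<dots> = (m powr s * H_norm (- s) b)\<^sup>2"
    by (simp only: power_mult_distrib power2_eq_square[of "m powr _"] powr_add[symmetric]) simp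
  finally have "low_norm m b \<le> sqrt ((m powr s * H_norm (- s) b)\<^sup>2)"
    unfolding low_norm_def by (rule real_sqrt_le_mono)
  then show ?thesis using H_norm_nonneg[of "-s" b] by simp
qed

text \<open>
  Low frequencies are paired in \<open>L\<^sup>2\<close>, where the noise truncated at \<open>m\<close> has finite norm; the rest keeps
  the smoothness of \<open>a\<close>.
\<close>

lemma pairing_split:
  assumes a: "H_finite s a" and b: "H_finite (- s) b"
    and a0: "H_finite 0 a"
  shows "pairing a b \<le> H_norm 0 a * low_norm m b + pairing (cut_above m a) b"
proof -
  let ?F = "{k :: int ^ 'a. japanese_bracket k \<le> m}"
  have ne: "japanese_bracket k \<noteq> 0" for k :: "int ^ 'a" using bracket_pos[of k] by simp
  have "(\<Sum>\<^sub>\<infinity>k. a k * cnj (b k)) = (\<Sum>\<^sub>\<infinity>k\<in>?F \<union> - ?F. a k * cnj (b k))" by simp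
  also have "\<dots> = (\<Sum>\<^sub>\<infinity>k\<in>?F. a k * cnj (b k)) + (\<Sum>\<^sub>\<infinity>k\<in>-?F. a k * cnj (b k))"
    by (rule infsum_Un_disjoint) (use H_pairing(2)[OF a b] in auto)
  also have "(\<Sum>\<^sub>\<infinity>k\<in>-?F. a k * cnj (b k)) = (\<Sum>\<^sub>\<infinity>k. cut_above m a k * cnj (b k))"
    by (rule infsum_cong_neutral) (auto simp: cut_above_def)
  also have "(\<Sum>\<^sub>\<infinity>k\<in>?F. a k * cnj (b k)) = (\<Sum>k\<in>?F. a k * cnj (b k))"
    by (rule infsum_finite[OF finite_bracket_le'])
  finally have "pairing a b = Re (\<Sum>k\<in>?F. a k * cnj (b k)) + pairing (cut_above m a) b"
    unfolding pairing_def by simp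
  moreover have "Re (\<Sum>k\<in>?F. a k * cnj (b k)) \<le> H_norm 0 a * low_norm m b"
  proof -
    have "Re (\<Sum>k\<in>?F. a k * cnj (b k)) \<le> cmod (\<Sum>k\<in>?F. a k * cnj (b k))" by (rule complex_Re_le_cmod)
    also have "\<dots> \<le> (\<Sum>k\<in>?F. cmod (a k) * cmod (b k))"
      by (rule order_trans[OF norm_sum]) (simp add: norm_mult)
    also have "\<dots> \<le> sqrt (\<Sum>k\<in>?F. (cmod (a k))\<^sup>2) * low_norm m b"
    proof -
      have "(\<Sum>k\<in>?F. cmod (a k) * cmod (b k))\<^sup>2 \<le> (\<Sum>k\<in>?F. (cmod (a k))\<^sup>2) * (\<Sum>k\<in>?F. (cmod (b k))\<^sup>2)"
        by (rule Cauchy_Schwarz_ineq_sum)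
      then have "sqrt ((\<Sum>k\<in>?F. cmod (a k) * cmod (b k))\<^sup>2) \<le> sqrt (\<Sum>k\<in>?F. (cmod (a k))\<^sup>2) * low_norm m b"
        unfolding low_norm_def real_sqrt_mult[symmetric] by (rule real_sqrt_le_mono)
      moreover have "0 \<le> (\<Sum>k\<in>?F. cmod (a k) * cmod (b k))" by (intro sum_nonneg) auto
      ultimately show ?thesis by simp
    qed
    also have "sqrt (\<Sum>k\<in>?F. (cmod (a k))\<^sup>2) \<le> H_norm 0 a"
    proof -
      have "(\<Sum>k\<in>?F. (cmod (a k))\<^sup>2) \<le> (H_norm 0 a)\<^sup>2"
        using H_sum_le[OF a0 finite_bracket_le', of m] by (simp add: ne)
      then have "sqrt (\<Sum>k\<in>?F. (cmod (a k))\<^sup>2) \<le> sqrt ((H_norm 0 a)\<^sup>2)" by (rule real_sqrt_le_mono)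
      then show ?thesis using H_norm_nonneg[of 0 a] by simp
    qed
    then have "sqrt (\<Sum>k\<in>?F. (cmod (a k))\<^sup>2) * low_norm m b \<le> H_norm 0 a * low_norm m b"
      by (rule mult_right_mono) (auto simp: low_norm_def intro!: sum_nonneg)
    finally show ?thesis .
  qed
  ultimately show ?thesis by linarith
qed

lemma pairing_abs_le: "H_finite s a \<Longrightarrow> H_finite (- s) b \<Longrightarrow> \<bar>pairing a b\<bar> \<le> H_norm s a * H_norm (- s) b"
  unfolding pairing_def using H_pairing(4)[of s a b UNIV] abs_Re_le_cmod order_trans by fastforce

text \<open>
  An interpolation inequality with a free parameter: optimising \<open>m\<close> would give the usual product of powers
  of the norms of orders \<open>0\<close> and \<open>t\<close>. Keeping \<open>m\<close> avoids fractional powers and Young's inequality later.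
\<close>

lemma pairing_crude:
  assumes a: "H_finite t a" and b: "H_finite (- s) b" and st: "0 \<le> s" "s \<le> t" and m: "0 < m"
  shows "pairing a b \<le> (m powr s * H_norm 0 a + m powr (s - t) * H_norm t a) * H_norm (- s) b"
proof -
  have as: "H_finite s a" and a0: "H_finite 0 a" using H_mono[OF a] st by auto
  have "pairing a b \<le> H_norm 0 a * low_norm m b + pairing (cut_above m a) b"
    by (rule pairing_split[OF as b a0])
  also have "H_norm 0 a * low_norm m b \<le> H_norm 0 a * (m powr s * H_norm (- s) b)"
    by (intro mult_left_mono low_norm_le[OF b] st m H_norm_nonneg)
  also have "pairing (cut_above m a) b \<le> H_norm s (cut_above m a) * H_norm (- s) b"
    using pairing_abs_le[OF cut_above_gain(1)[OF a st(2) m] b] by linarith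
  also have "\<dots> \<le> m powr (s - t) * H_norm t a * H_norm (- s) b"
    by (intro mult_right_mono cut_above_gain(2)[OF a st(2) m] H_norm_nonneg)
  finally show ?thesis by (simp add: algebra_simps)
qed

section \<open>Total variation and smoothing operators on the Fourier side\<close>

lemma partial_derivs_scale:
  fixes f :: "real ^ 'd \<Rightarrow> real"
  assumes "smooth f"
  shows "partial_derivs js (\<lambda>x. c * f x) = (\<lambda>x. c * partial_derivs js f x)"
proof (induction js)
  case (Cons j js)
  have "partial_derivs js f differentiable (at x)" for x
    using assms by (simp add: smooth_def)
  then have "((\<lambda>x. c * partial_derivs js f x) has_derivative (\<lambda>h. c * frechet_derivative (partial_derivs js f) (at x) h)) (at x)" for x
    using frechet_derivative_works by (intro has_derivative_mult_right) blast
  from frechet_derivative_at[OF this]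
  have "frechet_derivative (\<lambda>x. c * partial_derivs js f x) (at x) (axis j 1) = c * frechet_derivative (partial_derivs js f) (at x) (axis j 1)" for x
    by (metis (no_types, lifting))
  then show ?case using Cons by (simp add: partial_derivs_def partial_deriv_def)
qed (simp add: partial_derivs_def)

lemma test_scale: "f \<in> test_functions \<Longrightarrow> (\<lambda>x. c * f x) \<in> test_functions"
  by (auto simp: test_functions_def periodic_def smooth_def partial_derivs_scale)

lemma divergence_scale:
  assumes "\<And>i. (\<lambda>x. \<phi> x $ i) \<in> test_functions"
  shows "divergence (\<lambda>x. c *\<^sub>R \<phi> x) x = c * divergence \<phi> x"
proof -
  have "partial_deriv i (\<lambda>y. c * \<phi> y $ i) x = c * partial_deriv i (\<lambda>y. \<phi> y $ i) x" for i
    using partial_derivs_scale[of "\<lambda>y. \<phi> y $ i" "[i]" c] assms[of i]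
    by (simp add: partial_derivs_def test_functions_def)
  then show ?thesis by (simp add: divergence_def sum_distrib_left)
qed

lemma continuous_divergence:
  assumes "\<And>i. (\<lambda>x. \<phi> x $ i) \<in> test_functions"
  shows "continuous_on UNIV (divergence \<phi>)"
  unfolding divergence_def by (intro continuous_on_sum partial_deriv_continuous assms)

lemma unit_fieldsD: "\<phi> \<in> unit_fields \<Longrightarrow> (\<lambda>x. \<phi> x $ i) \<in> test_functions"
  by (simp add: unit_fields_def)

lemma unit_fields_scale:
  "\<phi> \<in> unit_fields \<Longrightarrow> \<bar>c\<bar> \<le> 1 \<Longrightarrow> (\<lambda>x. c *\<^sub>R \<phi> x) \<in> unit_fields"
  by (auto simp: unit_fields_def test_scale intro: mult_le_one)

lemma zero_unit_field: "(\<lambda>x. 0) \<in> unit_fields"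
proof -
  have "trig_poly {} (\<lambda>_. 0) = (\<lambda>x :: real ^ 'a. 0)" by (simp add: trig_poly_def fun_eq_iff)
  then have "(\<lambda>x :: real ^ 'a. 0 :: real) \<in> test_functions" using trig_poly_test by metis
  then show ?thesis by (simp add: unit_fields_def)
qed

lemma divergence_zero: "divergence (\<lambda>x. 0) x = 0"
  using divergence_scale[of "\<lambda>x. 0" 0 x] unit_fieldsD[OF zero_unit_field] by simp

lemma BV_integrable: "u \<in> BV \<Longrightarrow> integrable torus u"
  by (simp add: BV_def)

lemma divergence_integrable:
  assumes "u \<in> BV" "\<And>i. (\<lambda>x. \<phi> x $ i) \<in> test_functions"
  shows "integrable torus (\<lambda>x. divergence \<phi> x * u x)"
  using integrable_mult_continuous[OF BV_integrable[OF assms(1)] continuous_divergence[of \<phi>]] assms(2)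
  by (simp add: mult.commute)

lemma TV_upper: "u \<in> BV \<Longrightarrow> \<phi> \<in> unit_fields \<Longrightarrow> (\<integral>x. divergence \<phi> x * u x \<partial>torus) \<le> TV u"
  unfolding TV_def by (rule cSUP_upper) (auto simp: BV_def)

lemma TV_least: "(\<And>\<phi>. \<phi> \<in> unit_fields \<Longrightarrow> (\<integral>x. divergence \<phi> x * u x \<partial>torus) \<le> C) \<Longrightarrow> TV u \<le> C"
  unfolding TV_def using zero_unit_field by (intro cSUP_least) auto

lemma TV_nonneg: "u \<in> BV \<Longrightarrow> 0 \<le> TV u"
  using TV_upper[OF _ zero_unit_field] by (simp add: divergence_zero)

lemma TV_scale:
  assumes "u \<in> BV" shows "TV (\<lambda>x. c * u x) \<le> \<bar>c\<bar> * TV u"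
proof (rule TV_least)
  fix \<phi> :: "real ^ 'a \<Rightarrow> real ^ 'a" assume \<phi>: "\<phi> \<in> unit_fields"
  have "(\<integral>x. divergence \<phi> x * (c * u x) \<partial>torus) = \<bar>c\<bar> * (\<integral>x. divergence (\<lambda>x. sgn c *\<^sub>R \<phi> x) x * u x \<partial>torus)"
    unfolding divergence_scale[OF unit_fieldsD[OF \<phi>]]
    by (cases "c = 0") (simp_all add: sgn_if mult.left_commute[of _ c])
  also have "\<dots> \<le> \<bar>c\<bar> * TV u"
    using \<phi> assms by (intro mult_left_mono TV_upper unit_fields_scale) (auto simp: abs_sgn_eq)
  finally show "(\<integral>x. divergence \<phi> x * (c * u x) \<partial>torus) \<le> \<bar>c\<bar> * TV u" .
qed

lemma TV_add:
  assumes "u \<in> BV" "v \<in> BV" shows "TV (\<lambda>x. u x + v x) \<le> TV u + TV v"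
proof (rule TV_least)
  fix \<phi> :: "real ^ 'a \<Rightarrow> real ^ 'a" assume \<phi>: "\<phi> \<in> unit_fields"
  show "(\<integral>x. divergence \<phi> x * (u x + v x) \<partial>torus) \<le> TV u + TV v"
    using TV_upper[OF assms(1) \<phi>] TV_upper[OF assms(2) \<phi>]
      divergence_integrable[OF assms(1) unit_fieldsD[OF \<phi>]] divergence_integrable[OF assms(2) unit_fieldsD[OF \<phi>]]
    by (simp add: distrib_left)
qed

text \<open>
  The definition of \<open>TV\<close> as a supremum over unit fields, rescaled. Fields with \<open>B = 0\<close> are reached by letting a slightly
  larger bound decrease to \<open>B\<close>.
\<close>

lemma TV_duality:
  assumes \<phi>: "\<And>i. (\<lambda>x. \<phi> x $ i) \<in> test_functions" and B: "\<And>x. norm (\<phi> x) \<le> B" and u: "u \<in> BV"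
  shows "(\<integral>x. divergence \<phi> x * u x \<partial>torus) \<le> B * TV u"
proof (rule field_le_epsilon)
  fix e :: real assume e: "e > 0"
  define B' where "B' = B + e / (TV u + 1)"
  have e': "e / (TV u + 1) > 0" by (intro divide_pos_pos[OF e] add_nonneg_pos TV_nonneg u) simp
  have B0: "0 \<le> B" using B[of 0] norm_ge_zero order_trans by blast
  have B'0: "B' > 0" unfolding B'_def using B0 e' by linarith
  have unit: "(\<lambda>x. inverse B' *\<^sub>R \<phi> x) \<in> unit_fields"
  proof -
    have "norm (\<phi> x) \<le> B'" for x using B[of x] e' by (simp add: B'_def)
    moreover have "(\<lambda>x. (inverse B' *\<^sub>R \<phi> x) $ i) \<in> test_functions" for i
      using test_scale[OF \<phi>, of "inverse B'" i] by simp
    ultimately show ?thesis using B'0 unfolding unit_fields_def by (simp add: field_simps)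
  qed
  have "(\<integral>x. divergence \<phi> x * u x \<partial>torus) = B' * (\<integral>x. divergence (\<lambda>x. inverse B' *\<^sub>R \<phi> x) x * u x \<partial>torus)"
    unfolding divergence_scale[OF \<phi>] using B'0 by (simp add: mult.assoc)
  also have "\<dots> \<le> B' * TV u" using B'0 by (intro mult_left_mono TV_upper[OF u unit]) auto
  also have "\<dots> = B * TV u + e / (TV u + 1) * TV u" by (simp add: B'_def distrib_right)
  also have "\<dots> \<le> B * TV u + e" using scaled_fraction_less[OF TV_nonneg[OF u] e] by simp
  finally show "(\<integral>x. divergence \<phi> x * u x \<partial>torus) \<le> B * TV u + e" .
qed

lemma regular_distribution:
  assumes u: "u \<in> L2" shows "regular u \<in> distributions"
proof -
  have i: "integrable torus (\<lambda>x. u x * \<phi> x)" if "\<phi> \<in> test_functions" for \<phi>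
    by (rule integrable_mult_continuous[OF L2_integrable[OF u] test_continuous[OF that]])
  have add: "(\<lambda>x. \<phi> x + \<psi> x) \<in> test_functions" if "\<phi> \<in> test_functions" "\<psi> \<in> test_functions" for \<phi> \<psi> :: "real ^ 'a \<Rightarrow> real"
  proof -
    have d: "partial_derivs js \<phi> differentiable (at x)" "partial_derivs js \<psi> differentiable (at x)" for js x
      using that by (auto simp: test_functions_def smooth_def)
    have "partial_derivs js (\<lambda>x. \<phi> x + \<psi> x) = (\<lambda>x. partial_derivs js \<phi> x + partial_derivs js \<psi> x)" for js
    proof (induction js)
      case (Cons j js)
      have "((\<lambda>x. partial_derivs js \<phi> x + partial_derivs js \<psi> x) has_derivative
          (\<lambda>h. frechet_derivative (partial_derivs js \<phi>) (at x) h + frechet_derivative (partial_derivs js \<psi>) (at x) h)) (at x)" for x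
        using d frechet_derivative_works by (intro has_derivative_add) blast+
      from frechet_derivative_at[OF this]
      have "frechet_derivative (\<lambda>x. partial_derivs js \<phi> x + partial_derivs js \<psi> x) (at x) (axis j 1) =
          frechet_derivative (partial_derivs js \<phi>) (at x) (axis j 1) + frechet_derivative (partial_derivs js \<psi>) (at x) (axis j 1)" for x
        by (metis (no_types, lifting))
      then show ?case using Cons by (simp add: partial_derivs_def partial_deriv_def)
    qed (simp add: partial_derivs_def)
    then show ?thesis using that d by (auto simp: test_functions_def periodic_def smooth_def intro!: differentiable_add)
  qed
  have bound: "\<bar>regular u \<phi>\<bar> \<le> (\<integral>x. \<bar>u x\<bar> \<partial>torus) * B" if \<phi>: "\<phi> \<in> test_functions"
    and B: "\<forall>js x. length js \<le> 0 \<longrightarrow> \<bar>partial_derivs js \<phi> x\<bar> \<le> B" for \<phi> B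
  proof -
    have B': "\<bar>\<phi> x\<bar> \<le> B" for x using B[rule_format, of "[]" x] by (simp add: partial_derivs_def)
    have "\<bar>regular u \<phi>\<bar> \<le> (\<integral>x. \<bar>u x * \<phi> x\<bar> \<partial>torus)"
      using \<phi> by (simp add: regular_def integral_abs_bound)
    also have "\<dots> \<le> (\<integral>x. \<bar>u x\<bar> * B \<partial>torus)"
    proof (rule integral_mono)
      show "integrable torus (\<lambda>x. \<bar>u x * \<phi> x\<bar>)" using i[OF \<phi>] by (rule integrable_abs)
    qed (use L2_integrable[OF u] B' in \<open>auto simp: abs_mult mult_left_mono\<close>)
    finally show ?thesis by simp
  qed
  show ?thesis unfolding distributions_def
  proof (intro CollectI conjI ballI allI impI)
    show "\<exists>C m. \<forall>\<phi>\<in>test_functions. \<forall>B. (\<forall>js x. length js \<le> m \<longrightarrow> \<bar>partial_derivs js \<phi> x\<bar> \<le> B) \<longrightarrow> \<bar>regular u \<phi>\<bar> \<le> C * B"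
      using bound by (intro exI[of _ "\<integral>x. \<bar>u x\<bar> \<partial>torus"] exI[of _ 0]) blast
  qed (use i in \<open>auto simp: regular_def add test_scale distrib_left mult.left_commute\<close>)
qed

lemma H_fcoeff:
  assumes u: "u \<in> L2" shows "H_finite 0 (fcoeff u)" "H_norm 0 (fcoeff u) \<le> L2_norm u"
proof -
  have ne: "japanese_bracket k \<noteq> 0" for k :: "int ^ 'a" using bracket_pos[of k] by simp
  show "H_finite 0 (fcoeff u)" "H_norm 0 (fcoeff u) \<le> L2_norm u"
    using H_norm_leI[of 0 "fcoeff u" "L2_norm u"] Bessel[OF u] by (auto simp: ne L2_norm_nonneg)
qed

lemma fourier_regular_fun: "u \<in> L2 \<Longrightarrow> fourier (regular u) = fcoeff u"
  using fourier_regular[OF L2_integrable] by blast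

lemma regular_sobolev: "u \<in> L2 \<Longrightarrow> r \<le> 0 \<Longrightarrow> regular u \<in> sobolev r"
  by (simp add: sobolev_iff regular_distribution fourier_regular_fun H_mono(1)[OF H_fcoeff(1)])

lemma regular_integrable: "u \<in> L2 \<Longrightarrow> \<phi> \<in> test_functions \<Longrightarrow> integrable torus (\<lambda>x. u x * \<phi> x)"
  by (rule L2_integrable_mult[OF _ test_L2])

lemma regular_add: "u \<in> L2 \<Longrightarrow> v \<in> L2 \<Longrightarrow> regular (\<lambda>x. u x + v x) = (\<lambda>\<phi>. regular u \<phi> + regular v \<phi>)"
  by (auto simp: regular_def distrib_right regular_integrable)

lemma regular_scale: "regular (\<lambda>x. c * u x) = (\<lambda>\<phi>. c * regular u \<phi>)"
  by (auto simp: regular_def mult.assoc)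

locale smoothing_operator =
  fixes K :: "(real ^ 'd \<Rightarrow> real) \<Rightarrow> real ^ 'd \<Rightarrow> real" and Kext :: "'d distribution \<Rightarrow> 'd distribution" and t :: real
  assumes K_ext: "extends_L2_operator Kext K"
    and K_bij: "\<And>r. sobolev_bijection r (r + t) Kext"
begin

definition KH :: "(real ^ 'd \<Rightarrow> real) \<Rightarrow> int ^ 'd \<Rightarrow> complex" where
  "KH u = fcoeff (K u)"

lemma K_L2: "u \<in> L2 \<Longrightarrow> K u \<in> L2"
  using K_ext by (simp add: extends_L2_operator_def)

lemma KH_eq: "u \<in> L2 \<Longrightarrow> KH u = fourier (Kext (regular u))"
  using K_ext fourier_regular_fun[OF K_L2] by (simp add: extends_L2_operator_def KH_def)

lemma KH_add:
  assumes "u \<in> L2" "v \<in> L2" shows "KH (\<lambda>x. u x + v x) = (\<lambda>k. KH u k + KH v k)"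
proof -
  have "Kext (\<lambda>\<phi>. regular u \<phi> + regular v \<phi>) = (\<lambda>\<phi>. Kext (regular u) \<phi> + Kext (regular v) \<phi>)"
    using K_bij[of 0] regular_sobolev[OF assms(1), of 0] regular_sobolev[OF assms(2), of 0] by (simp add: sobolev_bijection_def)
  then show ?thesis using assms by (simp add: KH_eq L2_add regular_add fourier_def fun_eq_iff complex_eq_iff)
qed

lemma KH_scale:
  assumes "u \<in> L2" shows "KH (\<lambda>x. c * u x) = (\<lambda>k. of_real c * KH u k)"
proof -
  have "Kext (\<lambda>\<phi>. c * regular u \<phi>) = (\<lambda>\<phi>. c * Kext (regular u) \<phi>)"
    using K_bij[of 0] regular_sobolev[OF assms(1), of 0] by (simp add: sobolev_bijection_def)
  then show ?thesis using assms by (simp add: KH_eq L2_scale regular_scale fourier_def fun_eq_iff complex_eq_iff)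
qed

text \<open>
  For nonpositive order \<open>r\<close> every function in \<open>L\<^sup>2\<close> lies in \<open>H\<^sup>r\<close>, so the boundedness of the extension of \<open>K\<close>
  can be read off on functions. Negative \<open>r\<close> gives bounds in norms weaker than \<open>L\<^sup>2\<close>.
\<close>

lemma KH_bound:
  assumes r: "r \<le> 0"
  obtains C where "C > 0" "\<And>u. u \<in> L2 \<Longrightarrow> H_finite (r + t) (KH u)"
    "\<And>u. u \<in> L2 \<Longrightarrow> H_norm (r + t) (KH u) \<le> C * H_norm r (fcoeff u)"
proof -
  obtain C where C: "\<forall>T\<in>sobolev r. sobolev_norm (r + t) (Kext T) \<le> C * sobolev_norm r T"
    using K_bij[of r] by (auto simp: sobolev_bijection_def)
  have maps: "Kext T \<in> sobolev (r + t)" if "T \<in> sobolev r" for T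
    using K_bij[of r] that by (auto simp: sobolev_bijection_def bij_betw_def)
  show ?thesis
  proof (rule that[of "max 1 C"])
    fix u :: "real ^ 'd \<Rightarrow> real" assume u: "u \<in> L2"
    show "H_finite (r + t) (KH u)"
      using maps[OF regular_sobolev[OF u r]] u by (simp add: KH_eq sobolev_iff)
    have "H_norm (r + t) (KH u) \<le> C * H_norm r (fcoeff u)"
      using bspec[OF C regular_sobolev[OF u r]] u by (simp add: KH_eq sobolev_norm_eq fourier_regular_fun)
    also have "\<dots> \<le> max 1 C * H_norm r (fcoeff u)" by (intro mult_right_mono H_norm_nonneg) simp
    finally show "H_norm (r + t) (KH u) \<le> max 1 C * H_norm r (fcoeff u)" .
  qed simp
qed

lemma KH_finite: "u \<in> L2 \<Longrightarrow> H_finite t (KH u)"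
  using KH_bound[of 0] by (metis add_0 order_refl)

lemma Parseval_K:
  assumes t: "2 * t > real CARD('d)" and u: "u \<in> L2" and g: "g \<in> L2"
  shows "L2_inner (K u) g = pairing (KH u) (fcoeff g)"
proof -
  have "H_finite (- t) (\<lambda>k :: int ^ 'd. 1)"
    using summable_bracket[OF t] by (simp add: H_finite_def)
  from H_pairing(1)[OF KH_finite[OF u] this] have "(\<lambda>k. cmod (fcoeff (K u) k)) summable_on UNIV"
    by (simp add: KH_def)
  from Parseval_abs_summable[OF K_L2[OF u] g this] show ?thesis
    by (simp add: pairing_def KH_def)
qed

lemma L2_norm_K:
  assumes t: "2 * t > real CARD('d)" and u: "u \<in> L2"
  shows "L2_norm (K u) = H_norm 0 (KH u)"
proof (rule power2_eq_imp_eq)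
  have ne: "japanese_bracket k \<noteq> 0" for k :: "int ^ 'd" using bracket_pos[of k] by simp
  have 0: "H_finite 0 (KH u)" unfolding KH_def by (rule H_fcoeff(1)[OF K_L2[OF u]])
  have "(\<Sum>\<^sub>\<infinity>k. KH u k * cnj (KH u k)) = (\<Sum>\<^sub>\<infinity>k. complex_of_real ((cmod (KH u k))\<^sup>2))"
    by (simp only: complex_norm_square)
  also have "\<dots> = of_real (\<Sum>\<^sub>\<infinity>k. (cmod (KH u k))\<^sup>2)"
  proof (rule infsumI, rule has_sum_of_real, rule has_sum_infsum)
    show "(\<lambda>k. (cmod (KH u k))\<^sup>2) summable_on UNIV" using 0 by (simp add: H_finite_def ne)
  qed
  finally have "pairing (KH u) (KH u) = (H_norm 0 (KH u))\<^sup>2"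
    by (simp only: pairing_def Re_complex_of_real H_norm_sq) (simp add: ne)
  then show "(L2_norm (K u))\<^sup>2 = (H_norm 0 (KH u))\<^sup>2"
    using Parseval_K[OF t u K_L2[OF u]] by (simp add: L2_norm_sq KH_def)
qed (auto simp: H_norm_nonneg L2_norm_nonneg)

end

section \<open>Moments of white noise\<close>

text \<open>
  Jensen's inequality for the \<open>r\<close>-th power, with weights normalised to total mass one.
\<close>

lemma weighted_power_mean:
  fixes a x :: "'a \<Rightarrow> real"
  assumes F: "finite F" and a: "\<And>k. k \<in> F \<Longrightarrow> 0 \<le> a k" and x: "\<And>k. k \<in> F \<Longrightarrow> 0 \<le> x k" and r: "r \<ge> 1"
  shows "(\<Sum>k\<in>F. a k * x k) ^ r \<le> (\<Sum>k\<in>F. a k) ^ (r - 1) * (\<Sum>k\<in>F. a k * x k ^ r)"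
proof (cases "(\<Sum>k\<in>F. a k) = 0")
  case True
  then have "\<forall>k\<in>F. a k = 0" using sum_nonneg_eq_0_iff[OF F] a by blast
  then show ?thesis using r by (simp add: power_0_left)
next
  case False
  let ?A = "\<Sum>k\<in>F. a k"
  have A: "?A > 0" using False sum_nonneg[of F a] a by (simp add: less_le)
  have cv: "convex_on {0..} (\<lambda>y::real. y ^ r)"
    by (cases "even r") (auto intro: convex_on_subset[OF convex_power_even] convex_power_odd)
  have "(\<Sum>k\<in>F. (a k / ?A) *\<^sub>R x k) ^ r \<le> (\<Sum>k\<in>F. (a k / ?A) * x k ^ r)"
    by (rule convex_on_sum[OF F _ cv]) (use False A a x in \<open>auto simp: sum_divide_distrib[symmetric]\<close>)
  also have "(\<Sum>k\<in>F. (a k / ?A) *\<^sub>R x k) = (\<Sum>k\<in>F. a k * x k) / ?A"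
    by (simp add: sum_divide_distrib)
  also have "(\<Sum>k\<in>F. (a k / ?A) * x k ^ r) = (\<Sum>k\<in>F. a k * x k ^ r) / ?A"
    by (simp add: sum_divide_distrib)
  finally have "(\<Sum>k\<in>F. a k * x k) ^ r / ?A ^ r \<le> (\<Sum>k\<in>F. a k * x k ^ r) / ?A"
    by (simp add: power_divide)
  then have "(\<Sum>k\<in>F. a k * x k) ^ r \<le> ?A ^ r * ((\<Sum>k\<in>F. a k * x k ^ r) / ?A)"
    using A by (simp add: pos_divide_le_eq mult.commute)
  also have "?A ^ r = ?A ^ (r - 1) * ?A" using r by (metis Suc_diff_1 One_nat_def Suc_le_eq power_Suc2)
  finally show ?thesis using A by simp
qed

lemma nn_integral_limit_le:
  fixes X :: "nat \<Rightarrow> 'a \<Rightarrow> real"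
  assumes [measurable]: "\<And>n. X n \<in> borel_measurable M"
    and lim: "\<And>\<omega>. \<omega> \<in> space M \<Longrightarrow> (\<lambda>n. X n \<omega>) \<longlonglongrightarrow> Y \<omega>"
    and C: "\<And>n. (\<integral>\<^sup>+\<omega>. ennreal (X n \<omega>) \<partial>M) \<le> C"
  shows "(\<integral>\<^sup>+\<omega>. ennreal (Y \<omega>) \<partial>M) \<le> C"
proof -
  have "(\<integral>\<^sup>+\<omega>. ennreal (Y \<omega>) \<partial>M) = (\<integral>\<^sup>+\<omega>. liminf (\<lambda>n. ennreal (X n \<omega>)) \<partial>M)"
    by (intro nn_integral_cong lim_imp_Liminf[symmetric] tendsto_ennrealI lim) auto
  also have "\<dots> \<le> liminf (\<lambda>n. \<integral>\<^sup>+\<omega>. ennreal (X n \<omega>) \<partial>M)"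
    by (rule nn_integral_liminf) measurable
  also have "\<dots> \<le> liminf (\<lambda>n. C)" by (intro Liminf_mono) (simp add: C)
  also have "\<dots> = C" by (simp add: Liminf_const)
  finally show ?thesis .
qed

lemma trig_poly_unfold:
  assumes "finite F"
  shows "trig_poly F c = (\<lambda>x. \<Sum>k\<in>F. Re (c k) * cos (freq_dot k x) + (- Im (c k)) * sin (freq_dot k x))"
  by (simp add: trig_poly_def fun_eq_iff)

text \<open>
  Linearity on test functions determines the values on trigonometric polynomials from the Fourier
  coefficients. Besides distributions it covers the functionals \<open>u \<mapsto> \<langle>K u, N\<rangle>\<close> restricted to high
  frequencies.
\<close>

definition test_linear :: "((real ^ 'd \<Rightarrow> real) \<Rightarrow> real) \<Rightarrow> bool" where
  "test_linear T \<longleftrightarrow> (\<forall>\<phi>\<in>test_functions. \<forall>\<psi>\<in>test_functions. T (\<lambda>x. \<phi> x + \<psi> x) = T \<phi> + T \<psi>) \<and>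
     (\<forall>c. \<forall>\<phi>\<in>test_functions. T (\<lambda>x. c * \<phi> x) = c * T \<phi>)"

lemma distribution_test_linear: "T \<in> distributions \<Longrightarrow> test_linear T"
  by (simp add: distributions_def test_linear_def)

lemma test_linear_trig_poly:
  fixes T :: "(real ^ 'd \<Rightarrow> real) \<Rightarrow> real"
  assumes T: "test_linear T" and F: "finite F"
  shows "T (trig_poly F c) = Re (\<Sum>k\<in>F. c k * cnj (fourier T k))"
  using F
proof (induction F)
  case empty
  have "T (\<lambda>x. 0 * trig_poly {} c x) = 0 * T (trig_poly {} c)"
    using T trig_poly_test[of "{}" c] unfolding test_linear_def by blast
  moreover have "(\<lambda>x. 0 * trig_poly {} c x) = trig_poly {} c"
    by (simp add: trig_poly_def fun_eq_iff)
  ultimately show ?case by simp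
next
  case (insert k F)
  have add: "\<And>\<phi> \<psi>. \<phi> \<in> test_functions \<Longrightarrow> \<psi> \<in> test_functions \<Longrightarrow> T (\<lambda>x. \<phi> x + \<psi> x) = T \<phi> + T \<psi>"
    and scale: "\<And>\<phi> c. \<phi> \<in> test_functions \<Longrightarrow> T (\<lambda>x. c * \<phi> x) = c * T \<phi>"
    using T by (auto simp: test_linear_def)
  have tc: "(\<lambda>x. a * cos (freq_dot k x)) \<in> test_functions" "(\<lambda>x. b * sin (freq_dot k x)) \<in> test_functions" for a b
    using trig_poly_test[of "{k}" "\<lambda>_. of_real a * 1"] trig_poly_test[of "{k}" "\<lambda>_. of_real b * - \<i>"]
    unfolding trig_poly_scale[symmetric] trig_poly_cos trig_poly_sin by blast+
  have "trig_poly (insert k F) c = (\<lambda>x. trig_poly {k} c x + trig_poly F c x)"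
    using insert by (simp add: trig_poly_def fun_eq_iff)
  then have "T (trig_poly (insert k F) c) = T (trig_poly {k} c) + T (trig_poly F c)"
    using add[of "trig_poly {k} c" "trig_poly F c"] by simp
  also have "T (trig_poly {k} c) = T (\<lambda>x. Re (c k) * cos (freq_dot k x) + (- Im (c k)) * sin (freq_dot k x))"
    by (simp only: trig_poly_unfold[of "{k}"] finite.intros sum.insert sum.empty empty_iff not_False_eq_True add_0_right)
  also have "\<dots> = Re (c k) * T (\<lambda>x. cos (freq_dot k x)) + (- Im (c k)) * T (\<lambda>x. sin (freq_dot k x))"
    by (simp only: add[OF tc] scale[OF cos_test] scale[OF sin_test])
  also have "\<dots> = Re (c k * cnj (fourier T k))"
    by (simp add: fourier_def)
  finally show ?case using insert by simp
qed

text \<open>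
  The moment of order \<open>2 * r\<close> of the standard normal distribution.
\<close>

definition gauss_moment :: "nat \<Rightarrow> real" where
  "gauss_moment r = fact (2 * r) / (2 ^ r * fact r)"

lemma gauss_moment_pos: "0 < gauss_moment r" by (simp add: gauss_moment_def)

lemma centered_gaussian_moment:
  assumes M: "prob_space M" and Z: "centered_gaussian M Z"
  shows "(\<integral>\<^sup>+\<omega>. ennreal (Z \<omega> ^ (2 * r)) \<partial>M) = ennreal (gauss_moment r * (\<integral>\<omega>. Z \<omega> * Z \<omega> \<partial>M) ^ r)"
proof -
  interpret prob_space M by (rule M)
  consider "AE \<omega> in M. Z \<omega> = 0" | \<sigma> where "\<sigma> > 0" "distributed M lborel Z (normal_density 0 \<sigma>)"
    using Z by (auto simp: centered_gaussian_def)
  then show ?thesis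
  proof cases
    case 1
    have "(\<integral>\<^sup>+\<omega>. ennreal (Z \<omega> ^ (2 * r)) \<partial>M) = (\<integral>\<^sup>+\<omega>. ennreal (0 ^ (2 * r)) \<partial>M)"
      by (intro nn_integral_cong_AE) (use 1 in eventually_elim, simp)
    moreover have "(\<integral>\<omega>. Z \<omega> * Z \<omega> \<partial>M) = (\<integral>\<omega>. 0 \<partial>M)"
      using Z by (intro integral_cong_AE) (use 1 in \<open>auto simp: centered_gaussian_def\<close>)
    ultimately show ?thesis by (cases r) (auto simp: gauss_moment_def emeasure_space_1)
  next
    case (2 \<sigma>)
    have hb: "has_bochner_integral M (\<lambda>\<omega>. Z \<omega> ^ (2 * q)) (gauss_moment q * (\<sigma>\<^sup>2) ^ q)" for q
    proof -
      have "has_bochner_integral lborel (\<lambda>x. normal_density 0 \<sigma> x * (x - 0) ^ (2 * q)) (fact (2 * q) / ((2 / \<sigma>\<^sup>2)^q * fact q))"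
        by (rule normal_moment_even[OF 2(1)])
      moreover have "fact (2 * q) / ((2 / \<sigma>\<^sup>2)^q * fact q) = gauss_moment q * (\<sigma>\<^sup>2) ^ q"
        using 2(1) by (simp add: gauss_moment_def field_simps)
      ultimately have h: "has_bochner_integral lborel (\<lambda>x. normal_density 0 \<sigma> x * x ^ (2 * q)) (gauss_moment q * (\<sigma>\<^sup>2) ^ q)"
        by simp
      have "integrable M (\<lambda>\<omega>. Z \<omega> ^ (2 * q))"
        using distributed_integrable[OF 2(2), of "\<lambda>x. x ^ (2 * q)"] h
        by (auto simp: has_bochner_integral_iff)
      moreover have "(\<integral>\<omega>. Z \<omega> ^ (2 * q) \<partial>M) = gauss_moment q * (\<sigma>\<^sup>2) ^ q"
        using distributed_integral[OF 2(2), of "\<lambda>x. x ^ (2 * q)"] h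
        by (auto simp: has_bochner_integral_iff)
      ultimately show ?thesis by (simp add: has_bochner_integral_iff)
    qed
    have var: "(\<integral>\<omega>. Z \<omega> * Z \<omega> \<partial>M) = \<sigma>\<^sup>2"
      using has_bochner_integral_integral_eq[OF hb[of 1]] by (simp add: gauss_moment_def power2_eq_square)
    show ?thesis unfolding var
      using hb[of r] by (subst nn_integral_eq_integral) (auto simp: has_bochner_integral_iff zero_le_even_power)
  qed
qed

locale white_noise_space = prob_space M for M :: "'w measure" +
  fixes s :: real and N :: "'w \<Rightarrow> 'd::finite distribution"
  assumes noise: "white_noise M (- s) N" and s_gt: "2 * s > real CARD('d)"
begin

definition \<xi> :: "'w \<Rightarrow> int ^ 'd \<Rightarrow> complex" where "\<xi> \<omega> = fourier (N \<omega>)"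

lemma s_pos: "0 < s" using s_gt by (metis of_nat_0_le_iff order_le_less_trans zero_less_mult_pos zero_less_numeral)

lemma noise_distribution: "\<omega> \<in> space M \<Longrightarrow> N \<omega> \<in> distributions"
  and \<xi>_finite: "\<omega> \<in> space M \<Longrightarrow> H_finite (- s) (\<xi> \<omega>)"
  using noise by (auto simp: white_noise_def sobolev_iff \<xi>_def)

lemma noise_measurable: "\<phi> \<in> test_functions \<Longrightarrow> (\<lambda>\<omega>. N \<omega> \<phi>) \<in> borel_measurable M"
  using noise by (auto simp: white_noise_def centered_gaussian_def)

lemma \<xi>_Re_Im_measurable [measurable]: "(\<lambda>\<omega>. Re (\<xi> \<omega> k)) \<in> borel_measurable M" "(\<lambda>\<omega>. Im (\<xi> \<omega> k)) \<in> borel_measurable M"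
  using noise_measurable[OF cos_test] noise_measurable[OF sin_test] by (auto simp: \<xi>_def fourier_def)

lemma \<xi>_measurable [measurable]: "(\<lambda>\<omega>. \<xi> \<omega> k) \<in> borel_measurable M"
  by (subst borel_measurable_complex_iff) measurable

lemma cnj_\<xi>_measurable [measurable]: "(\<lambda>\<omega>. cnj (\<xi> \<omega> k)) \<in> borel_measurable M"
  by (subst borel_measurable_complex_iff) simp

text \<open>
  The only place where Gaussianity and the covariance of the noise enter: a real trigonometric polynomial
  has \<open>L\<^sup>2\<close> norm at most the Euclidean norm of its complex coefficients.
\<close>

lemma moment_finite_sum:
  assumes F: "finite F"
  shows "(\<integral>\<^sup>+\<omega>. ennreal ((Re (\<Sum>k\<in>F. c k * cnj (\<xi> \<omega> k))) ^ (2 * r)) \<partial>M)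
    \<le> ennreal (gauss_moment r * (\<Sum>k\<in>F. (cmod (c k))\<^sup>2) ^ r)"
proof -
  let ?\<phi> = "trig_poly F c"
  have G: "centered_gaussian M (\<lambda>\<omega>. N \<omega> ?\<phi>)" and V: "(\<integral>\<omega>. N \<omega> ?\<phi> * N \<omega> ?\<phi> \<partial>M) = L2_inner ?\<phi> ?\<phi>"
    using noise trig_poly_test[of F c] by (auto simp: white_noise_def)
  have "(\<integral>\<^sup>+\<omega>. ennreal ((Re (\<Sum>k\<in>F. c k * cnj (\<xi> \<omega> k))) ^ (2 * r)) \<partial>M) = (\<integral>\<^sup>+\<omega>. ennreal (N \<omega> ?\<phi> ^ (2 * r)) \<partial>M)"
    by (intro nn_integral_cong) (simp add: test_linear_trig_poly[OF distribution_test_linear[OF noise_distribution] F] \<xi>_def)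
  also have "\<dots> = ennreal (gauss_moment r * (L2_inner ?\<phi> ?\<phi>) ^ r)"
    using centered_gaussian_moment[OF prob_space_axioms G] V by simp
  also have "\<dots> \<le> ennreal (gauss_moment r * (\<Sum>k\<in>F. (cmod (c k))\<^sup>2) ^ r)"
    by (intro ennreal_leI mult_left_mono power_mono L2_inner_trig_poly_le F L2_inner_nonneg)
       (simp add: gauss_moment_def)
  finally show ?thesis .
qed

lemma pairing_\<xi>_tendsto:
  assumes a: "H_finite s a" and \<omega>: "\<omega> \<in> space M"
  shows "(\<lambda>n. Re (\<Sum>k\<in>(\<Union>j<n. dyadic_block j). a k * cnj (\<xi> \<omega> k))) \<longlonglongrightarrow> pairing a (\<xi> \<omega>)"
  unfolding pairing_def
  by (intro tendsto_Re sum_dyadic_tendsto has_sum_infsum H_pairing(2)[OF a \<xi>_finite[OF \<omega>]])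

lemma pairing_\<xi>_measurable:
  assumes a: "H_finite s a" shows "(\<lambda>\<omega>. pairing a (\<xi> \<omega>)) \<in> borel_measurable M"
  by (rule borel_measurable_LIMSEQ_real[OF pairing_\<xi>_tendsto[OF a]]) measurable

text \<open>
  The same bound for infinite sums, by Fatou's lemma.
\<close>

lemma pairing_\<xi>_moment:
  assumes a: "H_finite s a"
  shows "(\<integral>\<^sup>+\<omega>. ennreal (pairing a (\<xi> \<omega>) ^ (2 * r)) \<partial>M) \<le> ennreal (gauss_moment r * (H_norm 0 a) ^ (2 * r))"
proof (rule nn_integral_limit_le)
  show "(\<lambda>n. (Re (\<Sum>k\<in>(\<Union>j<n. dyadic_block j). a k * cnj (\<xi> \<omega> k))) ^ (2 * r)) \<longlonglongrightarrow> pairing a (\<xi> \<omega>) ^ (2 * r)"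
    if "\<omega> \<in> space M" for \<omega>
    by (intro tendsto_power pairing_\<xi>_tendsto[OF a that])
  fix n
  let ?F = "\<Union>j<n. dyadic_block j :: (int ^ 'd) set"
  have ne: "japanese_bracket k \<noteq> 0" for k :: "int ^ 'd" using bracket_pos[of k] by simp
  have "(\<Sum>k\<in>?F. (cmod (a k))\<^sup>2) \<le> (H_norm 0 a)\<^sup>2"
    using H_sum_le[OF H_mono(1)[OF a, of 0], of ?F] s_pos by (simp add: ne)
  then have "(\<Sum>k\<in>?F. (cmod (a k))\<^sup>2) ^ r \<le> ((H_norm 0 a)\<^sup>2) ^ r" by (intro power_mono sum_nonneg) auto
  then have "gauss_moment r * (\<Sum>k\<in>?F. (cmod (a k))\<^sup>2) ^ r \<le> gauss_moment r * (H_norm 0 a) ^ (2 * r)"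
    using gauss_moment_pos[of r] by (simp add: power_mult)
  then show "(\<integral>\<^sup>+\<omega>. ennreal ((Re (\<Sum>k\<in>?F. a k * cnj (\<xi> \<omega> k))) ^ (2 * r)) \<partial>M) \<le> ennreal (gauss_moment r * (H_norm 0 a) ^ (2 * r))"
    by (intro order_trans[OF moment_finite_sum]) (auto intro: ennreal_leI)
qed measurable

lemma \<xi>_component_moment:
  "(\<integral>\<^sup>+\<omega>. ennreal ((cmod (\<xi> \<omega> k)) ^ (2 * r)) \<partial>M) \<le> ennreal (2 ^ r * (2 * gauss_moment r))"
proof -
  have Re: "(\<integral>\<^sup>+\<omega>. ennreal (Re (\<xi> \<omega> k) ^ (2 * r)) \<partial>M) \<le> ennreal (gauss_moment r)"
    using moment_finite_sum[of "{k}" "\<lambda>_. 1" r] by simp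
  have Im: "(\<integral>\<^sup>+\<omega>. ennreal (Im (\<xi> \<omega> k) ^ (2 * r)) \<partial>M) \<le> ennreal (gauss_moment r)"
    using moment_finite_sum[of "{k}" "\<lambda>_. \<i>" r] by simp
  have pw: "(cmod z) ^ (2 * r) \<le> 2 ^ r * (Re z ^ (2 * r) + Im z ^ (2 * r))" for z
  proof -
    have "(cmod z)\<^sup>2 \<le> 2 * max ((Re z)\<^sup>2) ((Im z)\<^sup>2)" by (simp add: cmod_power2)
    then have "((cmod z)\<^sup>2) ^ r \<le> (2 * max ((Re z)\<^sup>2) ((Im z)\<^sup>2)) ^ r" by (intro power_mono) auto
    also have "\<dots> = 2 ^ r * (max ((Re z)\<^sup>2) ((Im z)\<^sup>2)) ^ r" by (simp add: power_mult_distrib)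
    also have "(max ((Re z)\<^sup>2) ((Im z)\<^sup>2)) ^ r \<le> ((Re z)\<^sup>2) ^ r + ((Im z)\<^sup>2) ^ r"
      by (simp add: max_def)
    finally show ?thesis by (simp add: power_mult)
  qed
  have "(\<integral>\<^sup>+\<omega>. ennreal ((cmod (\<xi> \<omega> k)) ^ (2 * r)) \<partial>M) \<le> (\<integral>\<^sup>+\<omega>. ennreal (2 ^ r) * (ennreal (Re (\<xi> \<omega> k) ^ (2 * r)) + ennreal (Im (\<xi> \<omega> k) ^ (2 * r))) \<partial>M)"
    using pw by (intro nn_integral_mono) (simp add: ennreal_leI zero_le_even_power flip: ennreal_plus ennreal_mult)
  also have "\<dots> = ennreal (2 ^ r) * ((\<integral>\<^sup>+\<omega>. ennreal (Re (\<xi> \<omega> k) ^ (2 * r)) \<partial>M) + (\<integral>\<^sup>+\<omega>. ennreal (Im (\<xi> \<omega> k) ^ (2 * r)) \<partial>M))"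
    by (subst nn_integral_cmult, measurable, subst nn_integral_add, measurable)
  also have "\<dots> \<le> ennreal (2 ^ r) * (ennreal (gauss_moment r) + ennreal (gauss_moment r))"
    by (intro mult_left_mono add_mono Re Im) auto
  also have "\<dots> = ennreal (2 ^ r * (2 * gauss_moment r))"
    using gauss_moment_pos[of r] by (simp flip: ennreal_plus ennreal_mult)
  finally show ?thesis .
qed

definition noise_norm :: "'w \<Rightarrow> real" where "noise_norm \<omega> = H_norm (- s) (\<xi> \<omega>)"

lemma noise_norm_sq_tendsto:
  assumes "\<omega> \<in> space M"
  shows "(\<lambda>n. \<Sum>k\<in>(\<Union>j<n. dyadic_block j). japanese_bracket k powr (2 * - s) * (cmod (\<xi> \<omega> k))\<^sup>2) \<longlonglongrightarrow> (noise_norm \<omega>)\<^sup>2"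
  unfolding noise_norm_def H_norm_sq
  by (intro sum_dyadic_tendsto has_sum_infsum) (use \<xi>_finite[OF assms] in \<open>simp add: H_finite_def\<close>)

lemma noise_norm_measurable [measurable]: "noise_norm \<in> borel_measurable M"
proof -
  have "(\<lambda>\<omega>. (noise_norm \<omega>)\<^sup>2) \<in> borel_measurable M"
    by (rule borel_measurable_LIMSEQ_real[OF noise_norm_sq_tendsto]) measurable
  then have "(\<lambda>\<omega>. sqrt ((noise_norm \<omega>)\<^sup>2)) \<in> borel_measurable M" by measurable
  moreover have "(\<lambda>\<omega>. sqrt ((noise_norm \<omega>)\<^sup>2)) = noise_norm"
    by (simp add: noise_norm_def H_norm_nonneg fun_eq_iff)
  ultimately show ?thesis by simp
qed

text \<open>
  The squared norm is a sum of squared coefficients with summable weights, and each coefficient has bounded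
  moments; convexity of the power lets the weights be taken out.
\<close>

lemma noise_norm_moment:
  assumes r: "r \<ge> 1"
  obtains C where "C \<ge> 0" "(\<integral>\<^sup>+\<omega>. ennreal (noise_norm \<omega> ^ (2 * r)) \<partial>M) \<le> ennreal C"
proof
  define A where "A = (\<Sum>\<^sub>\<infinity>k :: int ^ 'd. japanese_bracket k powr (- (2 * s)))"
  have A0: "0 \<le> A" unfolding A_def by (rule infsum_nonneg) simp
  let ?C = "A ^ (r - 1) * (A * (2 ^ r * (2 * gauss_moment r)))"
  show "0 \<le> ?C" using A0 gauss_moment_pos[of r] by simp
  show "(\<integral>\<^sup>+\<omega>. ennreal (noise_norm \<omega> ^ (2 * r)) \<partial>M) \<le> ennreal ?C"
    unfolding power_mult
  proof (rule nn_integral_limit_le)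
    show "(\<lambda>n. (\<Sum>k\<in>(\<Union>j<n. dyadic_block j). japanese_bracket k powr (2 * - s) * (cmod (\<xi> \<omega> k))\<^sup>2) ^ r) \<longlonglongrightarrow> (noise_norm \<omega>)\<^sup>2 ^ r"
      if "\<omega> \<in> space M" for \<omega> by (intro tendsto_power noise_norm_sq_tendsto that)
    fix n
    let ?F = "\<Union>j<n. dyadic_block j :: (int ^ 'd) set"
    let ?a = "\<lambda>k :: int ^ 'd. japanese_bracket k powr (- (2 * s))"
    have aA: "(\<Sum>k\<in>?F. ?a k) \<le> A"
      unfolding A_def by (rule finite_sum_le_infsum[OF summable_bracket[OF s_gt]]) auto
    have "(\<integral>\<^sup>+\<omega>. ennreal ((\<Sum>k\<in>?F. japanese_bracket k powr (2 * - s) * (cmod (\<xi> \<omega> k))\<^sup>2) ^ r) \<partial>M)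
      \<le> (\<integral>\<^sup>+\<omega>. (\<Sum>k\<in>?F. ennreal (A ^ (r - 1) * ?a k) * ennreal ((cmod (\<xi> \<omega> k)) ^ (2 * r))) \<partial>M)"
    proof (rule nn_integral_mono)
      fix \<omega>
      have "(\<Sum>k\<in>?F. ?a k * (cmod (\<xi> \<omega> k))\<^sup>2) ^ r \<le> (\<Sum>k\<in>?F. ?a k) ^ (r - 1) * (\<Sum>k\<in>?F. ?a k * ((cmod (\<xi> \<omega> k))\<^sup>2) ^ r)"
        by (rule weighted_power_mean[OF _ _ _ r]) auto
      also have "\<dots> \<le> A ^ (r - 1) * (\<Sum>k\<in>?F. ?a k * ((cmod (\<xi> \<omega> k))\<^sup>2) ^ r)"
        by (intro mult_right_mono power_mono aA sum_nonneg) auto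
      also have "\<dots> = (\<Sum>k\<in>?F. A ^ (r - 1) * ?a k * (cmod (\<xi> \<omega> k)) ^ (2 * r))"
        by (simp add: sum_distrib_left power_mult mult.assoc)
      finally have "ennreal ((\<Sum>k\<in>?F. ?a k * (cmod (\<xi> \<omega> k))\<^sup>2) ^ r) \<le> ennreal (\<Sum>k\<in>?F. A ^ (r - 1) * ?a k * (cmod (\<xi> \<omega> k)) ^ (2 * r))"
        by (rule ennreal_leI)
      also have "\<dots> = (\<Sum>k\<in>?F. ennreal (A ^ (r - 1) * ?a k) * ennreal ((cmod (\<xi> \<omega> k)) ^ (2 * r)))"
        using A0 by (subst sum_ennreal[symmetric]) (auto simp: ennreal_mult)
      finally show "ennreal ((\<Sum>k\<in>?F. japanese_bracket k powr (2 * - s) * (cmod (\<xi> \<omega> k))\<^sup>2) ^ r) \<le> (\<Sum>k\<in>?F. ennreal (A ^ (r - 1) * ?a k) * ennreal ((cmod (\<xi> \<omega> k)) ^ (2 * r)))"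
        by simp
    qed
    also have "\<dots> = (\<Sum>k\<in>?F. ennreal (A ^ (r - 1) * ?a k) * (\<integral>\<^sup>+\<omega>. ennreal ((cmod (\<xi> \<omega> k)) ^ (2 * r)) \<partial>M))"
      by (subst nn_integral_sum) (auto simp: nn_integral_cmult)
    also have "\<dots> \<le> (\<Sum>k\<in>?F. ennreal (A ^ (r - 1) * ?a k) * ennreal (2 ^ r * (2 * gauss_moment r)))"
      by (intro sum_mono mult_left_mono \<xi>_component_moment) auto
    also have "\<dots> = ennreal (A ^ (r - 1) * ((\<Sum>k\<in>?F. ?a k) * (2 ^ r * (2 * gauss_moment r))))"
      using A0 gauss_moment_pos[of r]
      by (subst ennreal_mult[symmetric]; (subst sum_ennreal)?) (auto simp: sum_distrib_left sum_distrib_right mult.assoc)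
    also have "\<dots> \<le> ennreal ?C"
      using gauss_moment_pos[of r] A0 by (intro ennreal_leI mult_left_mono mult_right_mono aA) auto
    finally show "(\<integral>\<^sup>+\<omega>. ennreal ((\<Sum>k\<in>?F. japanese_bracket k powr (2 * - s) * (cmod (\<xi> \<omega> k))\<^sup>2) ^ r) \<partial>M) \<le> ennreal ?C" .
  qed measurable
qed

lemma low_norm_measurable [measurable]: "(\<lambda>\<omega>. low_norm m (\<xi> \<omega>)) \<in> borel_measurable M"
  unfolding low_norm_def by measurable

lemma low_norm_moment:
  assumes m: "1 \<le> m"
  shows "(\<integral>\<^sup>+\<omega>. ennreal ((low_norm m (\<xi> \<omega>))\<^sup>2) \<partial>M) \<le> ennreal (4 * gauss_moment 1 * (3 * m) ^ CARD('d))"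
proof -
  let ?F = "{k :: int ^ 'd. japanese_bracket k \<le> m}"
  have "(\<integral>\<^sup>+\<omega>. ennreal ((low_norm m (\<xi> \<omega>))\<^sup>2) \<partial>M) = (\<integral>\<^sup>+\<omega>. (\<Sum>k\<in>?F. ennreal ((cmod (\<xi> \<omega> k)) ^ (2 * 1))) \<partial>M)"
    by (intro nn_integral_cong) (simp add: low_norm_def sum_nonneg)
  also have "\<dots> = (\<Sum>k\<in>?F. \<integral>\<^sup>+\<omega>. ennreal ((cmod (\<xi> \<omega> k)) ^ (2 * 1)) \<partial>M)"
    by (rule nn_integral_sum) measurable
  also have "\<dots> \<le> (\<Sum>k\<in>?F. ennreal (2 ^ 1 * (2 * gauss_moment 1)))"
    by (intro sum_mono \<xi>_component_moment)
  also have "\<dots> = ennreal (real (card ?F) * (4 * gauss_moment 1))"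
    using gauss_moment_pos[of 1] by (simp add: ennreal_mult ennreal_of_nat_eq_real_of_nat)
  also have "\<dots> \<le> ennreal (4 * gauss_moment 1 * (3 * m) ^ CARD('d))"
  proof (rule ennreal_leI)
    have "(4 * gauss_moment 1) * real (card ?F) \<le> (4 * gauss_moment 1) * (3 * m) ^ CARD('d)"
      using gauss_moment_pos[of 1] by (intro mult_left_mono card_bracket_le m) auto
    then show "real (card ?F) * (4 * gauss_moment 1) \<le> 4 * gauss_moment 1 * (3 * m) ^ CARD('d)"
      by (simp add: mult.commute)
  qed
  finally show ?thesis .
qed

end

section \<open>Dyadic blocks as divergences of vector fields\<close>

lemma fcoeff_trig_poly:
  assumes F: "finite F"
  shows "fcoeff (trig_poly F a) k = ((if k \<in> F then a k else 0) + cnj (if - k \<in> F then a (- k) else 0)) / 2"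
proof -
  let ?S = "\<lambda>x. \<Sum>l\<in>F. a l * wave l x"
  have c: "continuous_on UNIV ?S" by (intro continuous_intros continuous_wave)
  have i: "integrable torus (\<lambda>x. ?S x * cnj (wave k x))" "integrable torus (\<lambda>x. cnj (?S x) * cnj (wave k x))" for k
    by (intro integrable_continuous_torus continuous_intros c continuous_wave)+
  have I: "(\<integral>x. ?S x * cnj (wave k x) \<partial>torus) = (if k \<in> F then a k else 0)" for k
  proof -
    have "(\<integral>x. ?S x * cnj (wave k x) \<partial>torus) = (\<integral>x. (\<Sum>l\<in>F. a l * (wave l x * cnj (wave k x))) \<partial>torus)"
      by (simp only: sum_distrib_right mult.assoc)
    also have "\<dots> = (\<Sum>l\<in>F. \<integral>x. a l * (wave l x * cnj (wave k x)) \<partial>torus)"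
      by (intro Bochner_Integration.integral_sum integrable_continuous_torus continuous_intros continuous_wave)
    also have "\<dots> = (\<Sum>l\<in>F. a l * (if l = k then 1 else 0))"
      by (simp only: integral_mult_right_zero integral_wave_mult)
    also have "\<dots> = (if k \<in> F then a k else 0)"
      using F by (simp add: if_distrib[of "\<lambda>x. _ * x"] cong: if_cong)
    finally show ?thesis .
  qed
  have I': "(\<integral>x. cnj (?S x) * cnj (wave k x) \<partial>torus) = cnj (if - k \<in> F then a (- k) else 0)"
  proof -
    have "wave (- k) x = cnj (wave k x)" for x by (simp only: freq_dot_simps cis_cnj)
    then have "cnj (?S x) * cnj (wave k x) = cnj (?S x * cnj (wave (- k) x))" for x
      by (simp only: complex_cnj_mult complex_cnj_cnj)
    then have "(\<integral>x. cnj (?S x) * cnj (wave k x) \<partial>torus) = cnj (\<integral>x. ?S x * cnj (wave (- k) x) \<partial>torus)"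
      by (simp only: Bochner_Integration.integral_cnj)
    then show ?thesis unfolding I .
  qed
  have "fcoeff (trig_poly F a) k = (\<integral>x. (?S x * cnj (wave k x) + cnj (?S x) * cnj (wave k x)) / 2 \<partial>torus)"
    unfolding fcoeff_def
  proof (intro Bochner_Integration.integral_cong refl)
    fix x
    have "complex_of_real (trig_poly F a x) = (?S x + cnj (?S x)) / 2"
      unfolding trig_poly_def by (simp add: complex_add_cnj del: cnj_sum Re_sum)
    then show "complex_of_real (trig_poly F a x) * cnj (wave k x) = (?S x * cnj (wave k x) + cnj (?S x) * cnj (wave k x)) / 2"
      by (simp only: times_divide_eq_left distrib_right)
  qed
  also have "\<dots> = ((\<integral>x. ?S x * cnj (wave k x) \<partial>torus) + (\<integral>x. cnj (?S x) * cnj (wave k x) \<partial>torus)) / 2"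
    using i by (simp only: integral_divide_zero Bochner_Integration.integral_add)
  finally show ?thesis unfolding I I' .
qed

lemma fcoeff_minus: "fcoeff u (- k) = cnj (fcoeff u k)"
  unfolding fcoeff_def Bochner_Integration.integral_cnj[symmetric] by (simp add: cis_cnj)

lemma H_norm_trig_poly:
  assumes F: "finite F"
  shows "H_finite b (fcoeff (trig_poly F a))"
    and "(H_norm b (fcoeff (trig_poly F a)))\<^sup>2 \<le> (\<Sum>l\<in>F. japanese_bracket l powr (2 * b) * (cmod (a l))\<^sup>2)"
proof -
  let ?w = "\<lambda>k. japanese_bracket k powr (2 * b)"
  let ?f = "\<lambda>k. ?w k * (cmod (if k \<in> F then a k else 0))\<^sup>2"
  let ?S = "\<Sum>l\<in>F. ?w l * (cmod (a l))\<^sup>2"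
  have S0: "0 \<le> ?S" by (intro sum_nonneg) auto
  have fS: "(\<Sum>k\<in>G. ?f k) \<le> ?S" if "finite G" for G
  proof -
    have "(\<Sum>k\<in>G. ?f k) = (\<Sum>k\<in>G \<inter> F. ?f k)" using that by (intro sum.mono_neutral_right) auto
    also have "\<dots> = (\<Sum>k\<in>G \<inter> F. ?w k * (cmod (a k))\<^sup>2)" by (intro sum.cong) auto
    also have "\<dots> \<le> ?S" using F by (intro sum_mono2) auto
    finally show ?thesis .
  qed
  have "(\<Sum>k\<in>G. ?w k * (cmod (fcoeff (trig_poly F a) k))\<^sup>2) \<le> (sqrt ?S)\<^sup>2" if G: "finite G" for G
  proof -
    have "(\<Sum>k\<in>G. ?w k * (cmod (fcoeff (trig_poly F a) k))\<^sup>2) \<le> (\<Sum>k\<in>G. (?f k + ?f (- k)) / 2)"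
    proof (rule sum_mono)
      fix k
      have tri: "(cmod ((x + cnj y) / 2))\<^sup>2 \<le> ((cmod x)\<^sup>2 + (cmod y)\<^sup>2) / 2" for x y
      proof -
        have "cmod (x + cnj y) \<le> cmod x + cmod y" using norm_triangle_ineq[of x "cnj y"] by simp
        then have "(cmod (x + cnj y))\<^sup>2 \<le> (cmod x + cmod y)\<^sup>2" by (intro power_mono) auto
        also have "\<dots> \<le> 2 * ((cmod x)\<^sup>2 + (cmod y)\<^sup>2)"
          using sum_squares_bound[of "cmod x" "cmod y"] by (simp add: power2_sum)
        finally show ?thesis by (simp add: norm_divide power_divide)
      qed
      have "?w k * (cmod (fcoeff (trig_poly F a) k))\<^sup>2 \<le> ?w k * (((cmod (if k \<in> F then a k else 0))\<^sup>2 + (cmod (if - k \<in> F then a (- k) else 0))\<^sup>2) / 2)"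
        unfolding fcoeff_trig_poly[OF F] by (intro mult_left_mono tri) auto
      then show "?w k * (cmod (fcoeff (trig_poly F a) k))\<^sup>2 \<le> (?f k + ?f (- k)) / 2"
        by (simp only: bracket_minus distrib_left times_divide_eq_right)
    qed
    also have "\<dots> = ((\<Sum>k\<in>G. ?f k) + (\<Sum>k\<in>G. ?f (- k))) / 2"
      by (simp only: sum_divide_distrib[symmetric] sum.distrib)
    also have "(\<Sum>k\<in>G. ?f (- k)) = (\<Sum>k\<in>uminus ` G. ?f k)"
      by (subst sum.reindex) (auto simp: inj_on_def)
    also have "((\<Sum>k\<in>G. ?f k) + (\<Sum>k\<in>uminus ` G. ?f k)) / 2 \<le> ?S"
      using fS[OF G] fS[of "uminus ` G"] G by simp
    finally show ?thesis using S0 by simp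
  qed
  from H_norm_leI[OF this] S0 have fin: "H_finite b (fcoeff (trig_poly F a))" and le: "H_norm b (fcoeff (trig_poly F a)) \<le> sqrt ?S"
    by auto
  show "H_finite b (fcoeff (trig_poly F a))" by (rule fin)
  have "(H_norm b (fcoeff (trig_poly F a)))\<^sup>2 \<le> (sqrt ?S)\<^sup>2" using le H_norm_nonneg by (rule power_mono)
  then show "(H_norm b (fcoeff (trig_poly F a)))\<^sup>2 \<le> ?S" using S0 by simp
qed

text \<open>
  Up to a factor \<open>- \<i>\<close>, the multiplier of \<open>\<partial>\<^sub>i\<close> composed with the inverse Laplacian, so that \<open>block_field\<close> below solves
  \<open>div g = q\<close> for a trigonometric polynomial \<open>q\<close> with mean zero.
\<close>

definition grad_inv :: "'d \<Rightarrow> int ^ 'd \<Rightarrow> real" where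
  "grad_inv i l = of_int (l $ i) / (2 * pi * (\<Sum>j\<in>UNIV. (of_int (l $ j))\<^sup>2))"

definition block_field :: "(int ^ 'd) set \<Rightarrow> (int ^ 'd \<Rightarrow> complex) \<Rightarrow> real ^ 'd \<Rightarrow> real ^ 'd" where
  "block_field F z y = (\<chi> i. trig_poly (F - {0}) (\<lambda>l. z l * (- \<i> * of_real (grad_inv i l))) y)"

lemma bracket_sq: "(japanese_bracket l)\<^sup>2 = 1 + (\<Sum>j\<in>UNIV. (of_int (l $ j))\<^sup>2)"
  by (simp add: japanese_bracket_def sum_nonneg)

lemma sum_sq_ge: "l \<noteq> 0 \<Longrightarrow> (japanese_bracket l)\<^sup>2 \<le> 2 * (\<Sum>j\<in>UNIV. (of_int (l $ j))\<^sup>2 :: real)"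
  and sum_sq_pos: "l \<noteq> 0 \<Longrightarrow> (0::real) < (\<Sum>j\<in>UNIV. (of_int (l $ j))\<^sup>2)"
proof -
  assume "l \<noteq> 0"
  then obtain i where "l $ i \<noteq> 0" by (auto simp: vec_eq_iff)
  then have "1 \<le> (l $ i)\<^sup>2" by (simp add: power2_eq_square) (metis int_one_le_iff_zero_less mult_eq_0_iff not_square_less_zero power2_eq_square verit_la_disequality zero_le_square order_antisym_conv order_less_le)
  then have "(1::real) \<le> (of_int (l $ i))\<^sup>2" by (metis of_int_1_le_iff of_int_power)
  also have "\<dots> \<le> (\<Sum>j\<in>UNIV. (of_int (l $ j))\<^sup>2)" by (rule member_le_sum) auto
  finally have "1 \<le> (\<Sum>j\<in>UNIV. (of_int (l $ j))\<^sup>2 :: real)" .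
  then show "(japanese_bracket l)\<^sup>2 \<le> 2 * (\<Sum>j\<in>UNIV. (of_int (l $ j))\<^sup>2 :: real)" "(0::real) < (\<Sum>j\<in>UNIV. (of_int (l $ j))\<^sup>2)"
    unfolding bracket_sq by linarith+
qed

lemma grad_inv_le: "l \<noteq> 0 \<Longrightarrow> \<bar>grad_inv i l\<bar> \<le> 1 / japanese_bracket l"
proof -
  assume l: "l \<noteq> 0"
  let ?s = "\<Sum>j\<in>UNIV. (of_int (l $ j))\<^sup>2 :: real"
  have "japanese_bracket l * \<bar>of_int (l $ i)\<bar> \<le> (japanese_bracket l)\<^sup>2"
    using abs_component_le_bracket[of l i] bracket_pos[of l] by (simp add: power2_eq_square)
  also have "\<dots> \<le> 2 * ?s" by (rule sum_sq_ge[OF l])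
  also have "\<dots> \<le> 2 * pi * ?s" using pi_ge_two sum_sq_pos[OF l] by simp
  finally show ?thesis using bracket_pos[of l] sum_sq_pos[OF l] by (simp add: grad_inv_def field_simps abs_mult)
qed

lemma block_field_test: "(\<lambda>y. block_field F z y $ i) \<in> test_functions"
  by (simp add: block_field_def)

lemma divergence_block_field:
  assumes F: "finite F" shows "divergence (block_field F z) y = trig_poly (F - {0}) z y"
proof -
  have "divergence (block_field F z) y = (\<Sum>i\<in>UNIV. trig_poly (F - {0}) (\<lambda>l. z l * (- \<i> * of_real (grad_inv i l)) * (\<i> * of_real (2 * pi * of_int (l $ i)))) y)"
    by (simp add: divergence_def block_field_def partial_deriv_trig_poly)
  also have "\<dots> = Re (\<Sum>l\<in>F - {0}. \<Sum>i\<in>UNIV. z l * (- \<i> * of_real (grad_inv i l)) * (\<i> * of_real (2 * pi * of_int (l $ i))) * wave l y)"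
    unfolding trig_poly_def by (subst sum.swap) (simp del: Re_sum flip: Re_sum)
  also have "\<dots> = Re (\<Sum>l\<in>F - {0}. z l * wave l y)"
  proof (intro arg_cong[of _ _ Re] sum.cong refl)
    fix l assume "l \<in> F - {0}"
    then have l: "l \<noteq> 0" by simp
    let ?s = "\<Sum>j\<in>UNIV. (of_int (l $ j))\<^sup>2 :: real"
    have "(\<Sum>i\<in>UNIV. grad_inv i l * (2 * pi * of_int (l $ i))) = (\<Sum>i\<in>UNIV. (of_int (l $ i))\<^sup>2 / ?s)"
      by (intro sum.cong refl) (simp add: grad_inv_def power2_eq_square)
    also have "\<dots> = 1" using sum_sq_pos[OF l] by (simp add: sum_divide_distrib[symmetric])
    finally have 1: "(\<Sum>i\<in>UNIV. grad_inv i l * (2 * pi * of_int (l $ i))) = 1" .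
    have "(\<Sum>i\<in>UNIV. z l * (- \<i> * of_real (grad_inv i l)) * (\<i> * of_real (2 * pi * of_int (l $ i))) * wave l y) =
        (\<Sum>i\<in>UNIV. z l * wave l y * of_real (grad_inv i l * (2 * pi * of_int (l $ i))))"
      by (intro sum.cong refl) (simp add: algebra_simps)
    also have "\<dots> = z l * wave l y * of_real (\<Sum>i\<in>UNIV. grad_inv i l * (2 * pi * of_int (l $ i)))"
      by (simp only: sum_distrib_left of_real_sum)
    finally show "(\<Sum>i\<in>UNIV. z l * (- \<i> * of_real (grad_inv i l)) * (\<i> * of_real (2 * pi * of_int (l $ i))) * wave l y) = z l * wave l y"
      unfolding 1 by simp
  qed
  finally show ?thesis by (simp add: trig_poly_def)
qed

text \<open>
  On the frequencies in \<open>F\<close>, \<open>T\<close> acts on \<open>e\<close> by integration against a trigonometric polynomial. Its mean is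
  treated separately and the rest is a divergence.
\<close>

lemma test_linear_block_le:
  assumes T: "test_linear T" and F: "finite F" and e: "e \<in> BV"
    and B: "\<And>y. norm (block_field F (fourier T) y) \<le> B"
  shows "T (trig_poly F (fcoeff e)) \<le> (if 0 \<in> F then cmod (fourier T 0) * cmod (fcoeff e 0) else 0) + B * TV e"
proof -
  let ?z = "fourier T"
  have "T (trig_poly F (fcoeff e)) = Re (\<Sum>k\<in>F. fcoeff e k * cnj (?z k))"
    by (rule test_linear_trig_poly[OF T F])
  also have "\<dots> = Re (cnj (\<Sum>k\<in>F. fcoeff e k * cnj (?z k)))" by (simp only: cnj.sel)
  also have "cnj (\<Sum>k\<in>F. fcoeff e k * cnj (?z k)) = (\<Sum>k\<in>F. ?z k * cnj (fcoeff e k))"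
    by (simp add: mult.commute)
  also have "\<dots> = (if 0 \<in> F then ?z 0 * cnj (fcoeff e 0) else 0) + (\<Sum>k\<in>F - {0}. ?z k * cnj (fcoeff e k))"
    using F by (simp add: sum.remove)
  also have "Re \<dots> = Re (if 0 \<in> F then ?z 0 * cnj (fcoeff e 0) else 0) + Re (\<Sum>k\<in>F - {0}. ?z k * cnj (fcoeff e k))"
    by simp
  also have "Re (\<Sum>k\<in>F - {0}. ?z k * cnj (fcoeff e k)) = (\<integral>x. e x * trig_poly (F - {0}) ?z x \<partial>torus)"
    by (rule integral_mult_trig_poly[OF BV_integrable[OF e], symmetric])
  also have "\<dots> = (\<integral>x. divergence (block_field F ?z) x * e x \<partial>torus)"
    by (simp only: divergence_block_field[OF F] mult.commute)
  also have "\<dots> \<le> B * TV e"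
    by (rule TV_duality[OF block_field_test B e])
  also have "Re (if 0 \<in> F then ?z 0 * cnj (fcoeff e 0) else 0) \<le> (if 0 \<in> F then cmod (?z 0) * cmod (fcoeff e 0) else 0)"
    using complex_Re_le_cmod[of "?z 0 * cnj (fcoeff e 0)"] by (simp add: norm_mult)
  finally show ?thesis by simp
qed

text \<open>
  Points with coordinates \<open>j / n\<close>, \<open>0 \<le> j < n\<close>: one period suffices, as waves are periodic.
\<close>

definition grid :: "nat \<Rightarrow> (real ^ 'd) set" where
  "grid n = (\<lambda>f. \<chi> i. real (f i) / real n) ` (PiE UNIV (\<lambda>_. {..<n}))"

lemma finite_grid: "finite (grid n)"
  unfolding grid_def by (intro finite_imageI finite_PiE) auto

lemma card_grid: "card (grid n :: (real ^ 'd) set) \<le> n ^ CARD('d)"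
proof -
  have "card (grid n :: (real ^ 'd) set) \<le> card (PiE (UNIV :: 'd set) (\<lambda>_. {..<n}))"
    unfolding grid_def by (intro card_image_le finite_PiE) auto
  then show ?thesis by (simp add: card_PiE)
qed

lemma wave_shift_int:
  assumes "\<And>i. \<exists>q::int. x $ i - y $ i = of_int q"
  shows "wave l x = wave l y"
proof -
  obtain q :: "'a \<Rightarrow> int" where q: "\<And>i. x $ i - y $ i = of_int (q i)" using assms by metis
  have "freq_dot l x = freq_dot l y + freq_dot l (x - y)" by (simp add: freq_dot_diff)
  also have "freq_dot l (x - y) = 2 * pi * of_int (\<Sum>i\<in>UNIV. l $ i * q i)"
    by (simp add: freq_dot_def q)
  finally have "wave l x = wave l y * cis (2 * pi * of_int (\<Sum>i\<in>UNIV. l $ i * q i))"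
    by (simp only: cis_mult)
  also have "cis (2 * pi * of_int (\<Sum>i\<in>UNIV. l $ i * q i)) = 1" by (intro cis_multiple_2pi Ints_of_int)
  finally show ?thesis by simp
qed

lemma grid_near:
  assumes n: "n > 0"
  obtains p where "p \<in> grid n" "\<And>l. cmod (wave l y - wave l p) \<le> 2 * pi * (\<Sum>i\<in>UNIV. \<bar>of_int (l $ i)\<bar>) / real n"
proof -
  define q where "q = (\<lambda>i. \<lfloor>real n * y $ i\<rfloor>)"
  define f where "f = (\<lambda>i. nat (q i mod int n))"
  define p :: "real ^ 'a" where "p = (\<chi> i. real (f i) / real n)"
  define p' :: "real ^ 'a" where "p' = (\<chi> i. of_int (q i) / real n)"
  have "f i < n" for i using n by (simp add: f_def nat_less_iff)
  then have pg: "p \<in> grid n" unfolding grid_def p_def by (intro image_eqI[of _ _ f]) auto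
  have pp: "wave l p' = wave l p" for l
  proof (rule wave_shift_int)
    fix i
    have "of_int (q i) = real n * of_int (q i div int n) + real (f i)"
    proof -
      have "q i = int n * (q i div int n) + int (f i)" using n by (simp add: f_def)
      then show ?thesis by (metis of_int_add of_int_mult of_int_of_nat_eq)
    qed
    then have "p' $ i - p $ i = of_int (q i div int n)"
      using n by (simp add: p'_def p_def field_simps)
    then show "\<exists>q::int. p' $ i - p $ i = of_int q" by blast
  qed
  have near: "\<bar>y $ i - p' $ i\<bar> \<le> 1 / real n" for i
  proof -
    have "\<bar>real n * y $ i - of_int (q i)\<bar> \<le> 1" unfolding q_def by linarith
    then have "\<bar>real n * (y $ i - p' $ i)\<bar> \<le> 1" using n by (simp add: p'_def right_diff_distrib)
    then have "real n * \<bar>y $ i - p' $ i\<bar> \<le> 1" by (simp only: abs_mult abs_of_nat)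
    then show ?thesis using n by (simp add: pos_le_divide_eq mult.commute)
  qed
  have "cmod (wave l y - wave l p) \<le> 2 * pi * (\<Sum>i\<in>UNIV. \<bar>of_int (l $ i)\<bar>) / real n" for l
  proof -
    have "cmod (wave l y - wave l p') \<le> \<bar>freq_dot l y - freq_dot l p'\<bar>"
    proof -
      have "wave l y - wave l p' = wave l p' * (cis (freq_dot l y - freq_dot l p') - 1)"
        by (simp add: right_diff_distrib cis_mult)
      then have "cmod (wave l y - wave l p') = cmod (cis (freq_dot l y - freq_dot l p') - 1)"
        by (simp add: norm_mult)
      also have "\<dots> \<le> \<bar>freq_dot l y - freq_dot l p'\<bar>"
        using dist_exp_i_1[of "freq_dot l y - freq_dot l p'"] abs_sin_le_one abs_sin_x_le_abs_x[of "(freq_dot l y - freq_dot l p') / 2"]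
        by (simp add: cis_conv_exp)
      finally show ?thesis .
    qed
    also have "freq_dot l y - freq_dot l p' = 2 * pi * (\<Sum>i\<in>UNIV. of_int (l $ i) * (y $ i - p' $ i))"
      by (simp add: freq_dot_def right_diff_distrib sum_subtractf)
    also have "\<bar>\<dots>\<bar> = 2 * pi * \<bar>\<Sum>i\<in>UNIV. of_int (l $ i) * (y $ i - p' $ i)\<bar>" by (simp add: abs_mult)
    also have "\<dots> \<le> 2 * pi * (\<Sum>i\<in>UNIV. \<bar>of_int (l $ i)\<bar> * (1 / real n))"
    proof (intro mult_left_mono order_trans[OF sum_abs] sum_mono)
      fix i show "\<bar>of_int (l $ i) * (y $ i - p' $ i)\<bar> \<le> \<bar>of_int (l $ i)\<bar> * (1 / real n)"
        unfolding abs_mult by (intro mult_left_mono near) auto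
    qed simp
    also have "\<dots> = 2 * pi * (\<Sum>i\<in>UNIV. \<bar>of_int (l $ i)\<bar>) / real n"
      by (simp add: sum_divide_distrib[symmetric])
    finally show ?thesis unfolding pp .
  qed
  with pg show ?thesis by (rule that)
qed

text \<open>
  The multiplier of \<open>block_field\<close> gains as much as one derivative of a wave costs, so the Lipschitz constant of
  the field is bounded by the plain sum of the coefficients.
\<close>

lemma block_field_grid:
  fixes z :: "int ^ 'd \<Rightarrow> complex"
  assumes F: "finite F" and n: "n > 0"
  obtains p where "p \<in> grid n" "\<And>i. \<bar>block_field F z y $ i\<bar> \<le> \<bar>block_field F z p $ i\<bar> + 2 * pi * real CARD('d) / real n * (\<Sum>l\<in>F. cmod (z l))"
proof -
  obtain p where p: "p \<in> grid n" and near: "\<And>l. cmod (wave l y - wave l p) \<le> 2 * pi * (\<Sum>i\<in>UNIV. \<bar>of_int (l $ i)\<bar>) / real n"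
    using grid_near[OF n, of y] by metis
  show ?thesis
  proof (rule that[OF p])
    fix i
    let ?c = "2 * pi * real CARD('d) / real n"
    have "block_field F z y $ i - block_field F z p $ i = Re (\<Sum>l\<in>F - {0}. z l * (- \<i> * of_real (grad_inv i l)) * (wave l y - wave l p))"
      by (simp only: block_field_def vec_lambda_beta trig_poly_def minus_complex.sel[symmetric] sum_subtractf[symmetric] right_diff_distrib)
    also have "\<bar>\<dots>\<bar> \<le> cmod (\<Sum>l\<in>F - {0}. z l * (- \<i> * of_real (grad_inv i l)) * (wave l y - wave l p))"
      by (rule abs_Re_le_cmod)
    also have "\<dots> \<le> (\<Sum>l\<in>F - {0}. ?c * cmod (z l))"
    proof (intro order_trans[OF norm_sum] sum_mono)
      fix l assume "l \<in> F - {0}"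
      then have l: "l \<noteq> 0" by simp
      have "(\<Sum>i\<in>UNIV. \<bar>of_int (l $ i)\<bar>) \<le> (\<Sum>i\<in>(UNIV :: 'd set). japanese_bracket l)"
        by (intro sum_mono abs_component_le_bracket)
      then have s: "(\<Sum>i\<in>UNIV. \<bar>of_int (l $ i)\<bar>) \<le> real CARD('d) * japanese_bracket l" by simp
      have "cmod (wave l y - wave l p) \<le> 2 * pi * (real CARD('d) * japanese_bracket l) / real n"
        using n by (intro order_trans[OF near] divide_right_mono mult_left_mono s) auto
      then have w: "cmod (wave l y - wave l p) \<le> ?c * japanese_bracket l" by (simp add: field_simps)
      have "\<bar>grad_inv i l\<bar> * cmod (wave l y - wave l p) \<le> 1 / japanese_bracket l * (?c * japanese_bracket l)"
        using bracket_pos[of l] by (intro mult_mono grad_inv_le[OF l] w) auto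
      also have "\<dots> = ?c" using bracket_pos[of l] by simp
      finally have "cmod (z l) * (\<bar>grad_inv i l\<bar> * cmod (wave l y - wave l p)) \<le> cmod (z l) * ?c"
        by (rule mult_left_mono) simp
      then show "cmod (z l * (- \<i> * of_real (grad_inv i l)) * (wave l y - wave l p)) \<le> ?c * cmod (z l)"
        by (simp add: norm_mult mult_ac)
    qed
    also have "\<dots> \<le> (\<Sum>l\<in>F. ?c * cmod (z l))" using F by (intro sum_mono2) auto
    finally show "\<bar>block_field F z y $ i\<bar> \<le> \<bar>block_field F z p $ i\<bar> + ?c * (\<Sum>l\<in>F. cmod (z l))"
      by (simp add: sum_distrib_left)
  qed
qed

section \<open>High-frequency noise in the dual of total variation\<close>

lemma square_le_two_squares: "\<bar>x\<bar> \<le> a + l \<Longrightarrow> x\<^sup>2 \<le> 2 * a\<^sup>2 + 2 * (l::real)\<^sup>2"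
proof -
  assume "\<bar>x\<bar> \<le> a + l"
  then have "\<bar>x\<bar>\<^sup>2 \<le> (a + l)\<^sup>2" by (intro power_mono) auto
  also have "\<dots> \<le> 2 * a\<^sup>2 + 2 * l\<^sup>2" using sum_squares_bound[of a l] by (simp add: power2_sum)
  finally show ?thesis by simp
qed

text \<open>
  This bounds a maximum of squares by a sum of high powers without taking roots: \<open>\<kappa>\<close> is the size that the squares are
  expected to have, and the second summand will have bounded expectation.
\<close>

lemma le_scaled_power:
  fixes x \<kappa> :: real
  assumes "0 \<le> x" "0 < \<kappa>" "r \<ge> 1"
  shows "x \<le> \<kappa> * (1 + x ^ r / \<kappa> ^ r)"
proof -
  have "x / \<kappa> \<le> 1 + (x / \<kappa>) ^ r"
  proof (cases "x / \<kappa> \<le> 1")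
    case True
    then show ?thesis using assms by (intro order_trans[OF True]) simp
  next
    case False
    then have "(x / \<kappa>) ^ 1 \<le> (x / \<kappa>) ^ r" using assms by (intro power_increasing) auto
    then show ?thesis by simp
  qed
  then show ?thesis using assms by (simp add: field_simps power_divide)
qed

lemma ennreal_affine_const_sum:
  assumes "0 \<le> k" "0 \<le> q" "0 \<le> x"
  shows "ennreal k + ennreal q * (\<Sum>p\<in>A. ennreal x) = ennreal (k + q * (real (card A) * x))"
  using assms by (simp add: ennreal_plus ennreal_mult ennreal_of_nat_eq_real_of_nat)

locale noisy_operator = white_noise_space M s N + smoothing_operator K Kext t
  for M :: "'w measure" and s :: real and N :: "'w \<Rightarrow> 'd::finite distribution"
    and K :: "(real ^ 'd \<Rightarrow> real) \<Rightarrow> real ^ 'd \<Rightarrow> real" and Kext t +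
  assumes st: "s < t" and d_le: "CARD('d) \<le> 2"
begin

lemma KH_s: "u \<in> L2 \<Longrightarrow> H_finite s (KH u)"
  using H_mono(1)[OF KH_finite] st by simp

lemma KH_cut_s: "u \<in> L2 \<Longrightarrow> 0 < m \<Longrightarrow> H_finite s (cut_above m (KH u))"
  using cut_above_gain(1)[OF KH_s order_refl] .

text \<open>
  The pairing \<open>\<langle>K u, N\<rangle>\<close> restricted to frequencies above \<open>m\<close>.
\<close>

definition high_freq :: "real \<Rightarrow> 'w \<Rightarrow> (real ^ 'd \<Rightarrow> real) \<Rightarrow> real" where
  "high_freq m \<omega> u = pairing (cut_above m (KH u)) (\<xi> \<omega>)"

lemma pairing_add:
  assumes "H_finite s a" "H_finite s a'" "\<omega> \<in> space M"
  shows "pairing (\<lambda>k. a k + a' k) (\<xi> \<omega>) = pairing a (\<xi> \<omega>) + pairing a' (\<xi> \<omega>)"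
  using H_pairing(2)[OF assms(1) \<xi>_finite[OF assms(3)], of UNIV] H_pairing(2)[OF assms(2) \<xi>_finite[OF assms(3)], of UNIV]
  by (simp add: pairing_def distrib_right infsum_add)

lemma pairing_scale: "pairing (\<lambda>k. of_real c * a k) b = c * pairing a b"
  by (simp add: pairing_def mult.assoc infsum_cmult_right')

lemma high_freq_add:
  assumes "u \<in> L2" "v \<in> L2" "0 < m" "\<omega> \<in> space M"
  shows "high_freq m \<omega> (\<lambda>x. u x + v x) = high_freq m \<omega> u + high_freq m \<omega> v"
proof -
  have "cut_above m (KH (\<lambda>x. u x + v x)) = (\<lambda>k. cut_above m (KH u) k + cut_above m (KH v) k)"
    using assms by (simp add: KH_add cut_above_def fun_eq_iff)
  then show ?thesis unfolding high_freq_def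
    using pairing_add[OF KH_cut_s[OF assms(1,3)] KH_cut_s[OF assms(2,3)] assms(4)] by simp
qed

lemma high_freq_scale:
  assumes "u \<in> L2"
  shows "high_freq m \<omega> (\<lambda>x. c * u x) = c * high_freq m \<omega> u"
proof -
  have "cut_above m (KH (\<lambda>x. c * u x)) = (\<lambda>k. of_real c * cut_above m (KH u) k)"
    using assms by (simp add: KH_scale cut_above_def fun_eq_iff)
  then show ?thesis unfolding high_freq_def by (simp only: pairing_scale)
qed

lemma high_freq_test_linear: "0 < m \<Longrightarrow> \<omega> \<in> space M \<Longrightarrow> test_linear (high_freq m \<omega>)"
  by (simp add: test_linear_def high_freq_add high_freq_scale test_L2)

lemma high_freq_measurable: "u \<in> L2 \<Longrightarrow> 0 < m \<Longrightarrow> (\<lambda>\<omega>. high_freq m \<omega> u) \<in> borel_measurable M"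
  unfolding high_freq_def by (rule pairing_\<xi>_measurable[OF KH_cut_s])

text \<open>
  For a fixed \<open>u\<close> the Gaussian moments are given by the \<open>L\<^sup>2\<close> norm of \<open>K u\<close> above frequency \<open>m\<close>, and the cut turns \<open>b + t\<close> orders
  of smoothness of \<open>K u\<close> into a power of \<open>m\<close>.
\<close>

lemma high_freq_moment:
  assumes u: "u \<in> L2" and m: "0 < m" and bt: "0 \<le> b + t"
    and fin: "H_finite (b + t) (KH u)" and C: "H_norm (b + t) (KH u) \<le> C * h" and C0: "0 \<le> C" and h: "0 \<le> h"
  shows "(\<integral>\<^sup>+\<omega>. ennreal (high_freq m \<omega> u ^ (2 * r)) \<partial>M) \<le> ennreal (gauss_moment r * ((C * m powr - (b + t))\<^sup>2 * h\<^sup>2) ^ r)"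
proof -
  have "H_norm 0 (cut_above m (KH u)) \<le> m powr (0 - (b + t)) * H_norm (b + t) (KH u)"
    by (rule cut_above_gain(2)[OF fin bt m])
  also have "\<dots> \<le> m powr (0 - (b + t)) * (C * h)" by (intro mult_left_mono C) simp
  finally have "H_norm 0 (cut_above m (KH u)) \<le> C * m powr - (b + t) * h" by (simp add: mult_ac)
  then have "(H_norm 0 (cut_above m (KH u))) ^ (2 * r) \<le> (C * m powr - (b + t) * h) ^ (2 * r)"
    by (intro power_mono H_norm_nonneg)
  then have "gauss_moment r * (H_norm 0 (cut_above m (KH u))) ^ (2 * r) \<le> gauss_moment r * ((C * m powr - (b + t))\<^sup>2 * h\<^sup>2) ^ r"
    using gauss_moment_pos[of r] by (simp add: power_mult power_mult_distrib)
  then show ?thesis unfolding high_freq_def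
    by (intro order_trans[OF pairing_\<xi>_moment[OF KH_cut_s[OF u m]]] ennreal_leI)
qed

lemma high_freq_trig_moment:
  assumes F: "finite F" and m: "0 < m" and bt: "0 \<le> b + t"
    and fin: "\<And>u. u \<in> L2 \<Longrightarrow> H_finite (b + t) (KH u)"
    and C: "\<And>u. u \<in> L2 \<Longrightarrow> H_norm (b + t) (KH u) \<le> C * H_norm b (fcoeff u)" and C0: "0 \<le> C"
    and S: "(\<Sum>l\<in>F. japanese_bracket l powr (2 * b) * (cmod (a l))\<^sup>2) \<le> S"
  shows "(\<integral>\<^sup>+\<omega>. ennreal (high_freq m \<omega> (trig_poly F a) ^ (2 * r)) \<partial>M) \<le> ennreal (gauss_moment r * ((C * m powr - (b + t))\<^sup>2 * S) ^ r)"
proof -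
  let ?h = "H_norm b (fcoeff (trig_poly F a))"
  have "?h\<^sup>2 \<le> S" using H_norm_trig_poly(2)[OF F] S by (rule order_trans)
  then have "((C * m powr - (b + t))\<^sup>2 * ?h\<^sup>2) ^ r \<le> ((C * m powr - (b + t))\<^sup>2 * S) ^ r"
    by (intro power_mono mult_left_mono) auto
  then have "gauss_moment r * ((C * m powr - (b + t))\<^sup>2 * ?h\<^sup>2) ^ r \<le> gauss_moment r * ((C * m powr - (b + t))\<^sup>2 * S) ^ r"
    using gauss_moment_pos[of r] by simp
  then show ?thesis
    by (intro order_trans[OF high_freq_moment[OF trig_poly_L2 m bt fin C C0 H_norm_nonneg]] ennreal_leI) auto
qed

abbreviation high_freq_coeff :: "real \<Rightarrow> 'w \<Rightarrow> int ^ 'd \<Rightarrow> complex" where "high_freq_coeff m \<omega> \<equiv> fourier (high_freq m \<omega>)"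

lemma high_freq_coeff_measurable: "0 < m \<Longrightarrow> (\<lambda>\<omega>. high_freq_coeff m \<omega> l) \<in> borel_measurable M"
  using high_freq_measurable[OF test_L2[OF cos_test]] high_freq_measurable[OF test_L2[OF sin_test]]
  by (subst borel_measurable_complex_iff) (simp add: fourier_def)

lemma high_freq_coeff_moment:
  assumes m: "0 < m" and bt: "0 \<le> b + t" "b \<le> 0"
    and fin: "\<And>u. u \<in> L2 \<Longrightarrow> H_finite (b + t) (KH u)"
    and C: "\<And>u. u \<in> L2 \<Longrightarrow> H_norm (b + t) (KH u) \<le> C * H_norm b (fcoeff u)" and C0: "0 \<le> C"
    and l: "l \<in> dyadic_block j"
  shows "(\<integral>\<^sup>+\<omega>. ennreal ((cmod (high_freq_coeff m \<omega> l))\<^sup>2) \<partial>M) \<le> ennreal (2 * gauss_moment 1 * (C * m powr - (b + t))\<^sup>2 * (2 powr b) ^ (2 * j))"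
proof -
  let ?S = "(2 powr b) ^ (2 * j)" and ?\<sigma> = "C * m powr - (b + t)"
  have S: "japanese_bracket l powr (2 * b) \<le> ?S"
  proof -
    have "japanese_bracket l powr (2 * b) \<le> (2 ^ j) powr (2 * b)"
      using l bt bracket_pos[of l] by (intro powr_mono2') (auto simp: dyadic_block_def)
    also have "\<dots> = ?S" by (simp add: powr_realpow[symmetric] powr_powr mult_ac)
    finally show ?thesis .
  qed
  have "(\<integral>\<^sup>+\<omega>. ennreal (high_freq m \<omega> (trig_poly {l} a) ^ (2 * 1)) \<partial>M) \<le> ennreal (gauss_moment 1 * (?\<sigma>\<^sup>2 * ?S) ^ 1)"
    if "cmod (a l) = 1" for a
    by (rule high_freq_trig_moment[OF _ m bt(1) fin C C0]) (use S that in auto)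
  from this[of "\<lambda>_. 1"] this[of "\<lambda>_. - \<i>"]
  have "(\<integral>\<^sup>+\<omega>. ennreal ((Re (high_freq_coeff m \<omega> l))\<^sup>2) \<partial>M) \<le> ennreal (gauss_moment 1 * (?\<sigma>\<^sup>2 * ?S))"
    and "(\<integral>\<^sup>+\<omega>. ennreal ((Im (high_freq_coeff m \<omega> l))\<^sup>2) \<partial>M) \<le> ennreal (gauss_moment 1 * (?\<sigma>\<^sup>2 * ?S))"
    by (simp_all add: trig_poly_cos trig_poly_sin fourier_def)
  then have "(\<integral>\<^sup>+\<omega>. ennreal ((Re (high_freq_coeff m \<omega> l))\<^sup>2) \<partial>M) + (\<integral>\<^sup>+\<omega>. ennreal ((Im (high_freq_coeff m \<omega> l))\<^sup>2) \<partial>M)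
      \<le> ennreal (gauss_moment 1 * (?\<sigma>\<^sup>2 * ?S)) + ennreal (gauss_moment 1 * (?\<sigma>\<^sup>2 * ?S))" by (rule add_mono)
  moreover have "(\<integral>\<^sup>+\<omega>. ennreal ((cmod (high_freq_coeff m \<omega> l))\<^sup>2) \<partial>M) = (\<integral>\<^sup>+\<omega>. ennreal ((Re (high_freq_coeff m \<omega> l))\<^sup>2) \<partial>M) + (\<integral>\<^sup>+\<omega>. ennreal ((Im (high_freq_coeff m \<omega> l))\<^sup>2) \<partial>M)"
    using high_freq_coeff_measurable[OF m, of l]
    by (subst nn_integral_add[symmetric]) (auto simp: cmod_power2 borel_measurable_complex_iff)
  moreover have "ennreal (gauss_moment 1 * (?\<sigma>\<^sup>2 * ?S)) + ennreal (gauss_moment 1 * (?\<sigma>\<^sup>2 * ?S)) = ennreal (2 * gauss_moment 1 * ?\<sigma>\<^sup>2 * ?S)"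
    using gauss_moment_pos[of 1] by (simp flip: ennreal_plus add: mult.assoc)
  ultimately show ?thesis by simp
qed

text \<open>
  The values of the field at a point are again values of the functional, at test functions that are
  translates of one kernel. Hence they have Gaussian moments.
\<close>

lemma block_field_high_freq:
  assumes m: "0 < m" and \<omega>: "\<omega> \<in> space M" and F: "finite F"
  shows "block_field F (high_freq_coeff m \<omega>) p $ i = high_freq m \<omega> (trig_poly (F - {0}) (\<lambda>l. of_real (grad_inv i l) * (\<i> * cnj (wave l p))))"
proof -
  have "high_freq m \<omega> (trig_poly (F - {0}) (\<lambda>l. of_real (grad_inv i l) * (\<i> * cnj (wave l p))))
      = Re (\<Sum>l\<in>F - {0}. of_real (grad_inv i l) * (\<i> * cnj (wave l p)) * cnj (high_freq_coeff m \<omega> l))"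
    using F by (intro test_linear_trig_poly high_freq_test_linear m \<omega>) auto
  also have "\<dots> = Re (cnj (\<Sum>l\<in>F - {0}. of_real (grad_inv i l) * (\<i> * cnj (wave l p)) * cnj (high_freq_coeff m \<omega> l)))"
    by (simp only: cnj.sel)
  also have "cnj (\<Sum>l\<in>F - {0}. of_real (grad_inv i l) * (\<i> * cnj (wave l p)) * cnj (high_freq_coeff m \<omega> l)) = (\<Sum>l\<in>F - {0}. high_freq_coeff m \<omega> l * (- \<i> * of_real (grad_inv i l)) * wave l p)"
    unfolding cnj_sum by (intro sum.cong refl) (simp only: complex_cnj_mult complex_cnj_cnj complex_cnj_complex_of_real complex_cnj_i mult_ac)
  finally show ?thesis unfolding block_field_def vec_lambda_beta trig_poly_def[of _ _ p] by (rule sym)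
qed

lemma card_block_le: "real (card (dyadic_block j :: (int ^ 'd) set)) \<le> 36 * 4 ^ j"
proof -
  have "(6::real) ^ CARD('d) \<le> 6 ^ 2" "(2::real) ^ CARD('d) \<le> 2 ^ 2"
    using d_le by (intro power_increasing; simp)+
  then have "6 ^ CARD('d) * (2 ^ CARD('d)) ^ j \<le> 36 * (4::real) ^ j"
    by (intro mult_mono power_mono) auto
  then show ?thesis using card_dyadic_block[of j, where 'd = 'd] by linarith
qed

text \<open>
  Each value of the field on block \<open>j\<close> has variance at most a constant times \<open>(2 powr b) ^ (2 * j)\<close>: the block has
  at most \<open>36 * 4 ^ j\<close> frequencies as \<open>d \<le> 2\<close>, and the multiplier contributes \<open>4 ^ (- j)\<close> to the square.
  A grid of width \<open>4 ^ (- j)\<close> makes the Lipschitz error comparable, and it has at most \<open>16 ^ j\<close> points. The moment of order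
  \<open>2 * r\<close> sees this number only through \<open>16 powr (j / r)\<close>, which is compensated by giving up half of the decay
  in \<open>j\<close>.
\<close>

lemma block_field_bound:
  assumes m: "0 < m" and bt: "0 \<le> b + t" "b < 0"
    and fin: "\<And>u. u \<in> L2 \<Longrightarrow> H_finite (b + t) (KH u)"
    and C: "\<And>u. u \<in> L2 \<Longrightarrow> H_norm (b + t) (KH u) \<le> C * H_norm b (fcoeff u)" and C0: "0 < C"
    and r: "r \<ge> 1" "16 * (2 powr b) ^ r \<le> 1"
  obtains V where "V \<in> borel_measurable M" "\<And>\<omega>. 0 \<le> V \<omega>"
    "(\<integral>\<^sup>+\<omega>. ennreal (V \<omega>) \<partial>M) \<le> ennreal ((144 * (1 + gauss_moment r) + 4 * (4 * pi)\<^sup>2 * 36\<^sup>2 * 2 * gauss_moment 1) * (C * m powr - (b + t))\<^sup>2 * (2 powr b) ^ j)"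
    "\<And>\<omega> y. \<omega> \<in> space M \<Longrightarrow> (norm (block_field (dyadic_block j) (high_freq_coeff m \<omega>) y))\<^sup>2 \<le> V \<omega>"
proof -
  define \<sigma> where "\<sigma> = C * m powr - (b + t)"
  define \<rho> where "\<rho> = 2 powr b"
  have \<rho>: "0 < \<rho>" "\<rho> < 1" using bt by (auto simp: \<rho>_def powr_less_one)
  have \<sigma>: "0 < \<sigma>" using C0 m by (simp add: \<sigma>_def)
  let ?B = "dyadic_block j :: (int ^ 'd) set"
  define n where "n = (4::nat) ^ j"
  have n: "n > 0" by (simp add: n_def)
  \<comment> \<open>the variances are of order \<open>\<sigma>\<^sup>2 * \<rho> ^ (2 * j)\<close>; the missing factor \<open>\<rho> ^ j\<close> pays for the number of grid points\<close>
  define \<kappa> where "\<kappa> = 36 * \<sigma>\<^sup>2 * \<rho> ^ j"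
  have \<kappa>: "0 < \<kappa>" using \<sigma> \<rho> by (simp add: \<kappa>_def)
  define g where "g = (\<lambda>\<omega> p i. high_freq m \<omega> (trig_poly (?B - {0}) (\<lambda>l. of_real (grad_inv i l) * (\<i> * cnj (wave l p)))))"
  have g_meas: "(\<lambda>\<omega>. g \<omega> p i) \<in> borel_measurable M" for p i
    unfolding g_def by (rule high_freq_measurable[OF trig_poly_L2 m])
  have g_mom: "(\<integral>\<^sup>+\<omega>. ennreal (g \<omega> p i ^ (2 * r)) \<partial>M) \<le> ennreal (gauss_moment r * (\<sigma>\<^sup>2 * (36 * \<rho> ^ (2 * j))) ^ r)" for p i
    unfolding g_def \<sigma>_def
  proof (rule high_freq_trig_moment[OF _ m bt(1) fin C])
    let ?a = "\<lambda>l. of_real (grad_inv i l) * (\<i> * cnj (wave l p))"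
    have "(\<Sum>l\<in>?B - {0}. japanese_bracket l powr (2 * b) * (cmod (?a l))\<^sup>2) \<le> (\<Sum>l\<in>?B - {0}. \<rho> ^ (2 * j) * (1 / 4 ^ j))"
    proof (rule sum_mono)
      fix l assume l: "l \<in> ?B - {0}"
      have "japanese_bracket l powr (2 * b) \<le> (2 ^ j) powr (2 * b)"
        using l bt bracket_pos[of l] by (intro powr_mono2') (auto simp: dyadic_block_def)
      also have "\<dots> = \<rho> ^ (2 * j)" by (simp add: \<rho>_def powr_realpow[symmetric] powr_powr mult_ac)
      finally have 1: "japanese_bracket l powr (2 * b) \<le> \<rho> ^ (2 * j)" .
      have "\<bar>grad_inv i l\<bar> \<le> 1 / japanese_bracket l" using l by (intro grad_inv_le) auto
      also have "\<dots> \<le> 1 / 2 ^ j" using l by (intro divide_left_mono) (auto simp: dyadic_block_def bracket_pos)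
      finally have "\<bar>grad_inv i l\<bar>\<^sup>2 \<le> (1 / 2 ^ j)\<^sup>2" by (intro power_mono) auto
      then have 2: "(grad_inv i l)\<^sup>2 \<le> 1 / 4 ^ j"
        by (simp add: power_divide power_mult[symmetric] mult.commute[of j]) (simp add: power_mult)
      have "(cmod (?a l))\<^sup>2 = (grad_inv i l)\<^sup>2" by (simp add: norm_mult)
      then show "japanese_bracket l powr (2 * b) * (cmod (?a l))\<^sup>2 \<le> \<rho> ^ (2 * j) * (1 / 4 ^ j)"
        using \<rho> by (simp only:) (intro mult_mono 1 2; simp)
    qed
    also have "\<dots> \<le> real (card ?B) * (\<rho> ^ (2 * j) * (1 / 4 ^ j))"
      using \<rho> by (simp add: card_mono divide_right_mono mult_right_mono)
    also have "\<dots> \<le> 36 * 4 ^ j * (\<rho> ^ (2 * j) * (1 / 4 ^ j))"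
      using \<rho> by (intro mult_right_mono card_block_le) auto
    also have "\<dots> = 36 * \<rho> ^ (2 * j)" by simp
    finally show "(\<Sum>l\<in>?B - {0}. japanese_bracket l powr (2 * b) * (cmod (?a l))\<^sup>2) \<le> 36 * \<rho> ^ (2 * j)" .
  qed (use C0 in auto)
  define W where "W = (\<lambda>\<omega> i. \<kappa> * (1 + (\<Sum>p\<in>grid n. g \<omega> p i ^ (2 * r)) / \<kappa> ^ r))"
  have W_meas: "(\<lambda>\<omega>. W \<omega> i) \<in> borel_measurable M" for i
    unfolding W_def using g_meas by measurable
  have W_mom: "(\<integral>\<^sup>+\<omega>. ennreal (W \<omega> i) \<partial>M) \<le> ennreal (\<kappa> * (1 + gauss_moment r))" for i
  proof -
    have "(\<integral>\<^sup>+\<omega>. ennreal (W \<omega> i) \<partial>M) = (\<integral>\<^sup>+\<omega>. ennreal \<kappa> + ennreal (\<kappa> / \<kappa> ^ r) * (\<Sum>p\<in>grid n. ennreal (g \<omega> p i ^ (2 * r))) \<partial>M)"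
    proof (intro nn_integral_cong)
      fix \<omega>
      have "W \<omega> i = \<kappa> + \<kappa> / \<kappa> ^ r * (\<Sum>p\<in>grid n. g \<omega> p i ^ (2 * r))"
        by (simp add: W_def distrib_left)
      then show "ennreal (W \<omega> i) = ennreal \<kappa> + ennreal (\<kappa> / \<kappa> ^ r) * (\<Sum>p\<in>grid n. ennreal (g \<omega> p i ^ (2 * r)))"
      proof -
        let ?S = "\<Sum>p\<in>grid n. g \<omega> p i ^ (2 * r)"
        have S0: "0 \<le> ?S" by (intro sum_nonneg) (simp add: zero_le_even_power)
        have q: "0 \<le> \<kappa> / \<kappa> ^ r" using \<kappa> by simp
        have "(\<Sum>p\<in>grid n. ennreal (g \<omega> p i ^ (2 * r))) = ennreal ?S"
          by (simp add: sum_ennreal zero_le_even_power)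
        moreover assume "W \<omega> i = \<kappa> + \<kappa> / \<kappa> ^ r * ?S"
        ultimately show ?thesis
          by (simp only: ennreal_plus[OF less_imp_le[OF \<kappa>] mult_nonneg_nonneg[OF q S0]] ennreal_mult[OF q S0])
      qed
    qed
    also have "\<dots> = ennreal \<kappa> + ennreal (\<kappa> / \<kappa> ^ r) * (\<Sum>p\<in>grid n. \<integral>\<^sup>+\<omega>. ennreal (g \<omega> p i ^ (2 * r)) \<partial>M)"
      using g_meas by (subst nn_integral_add) (auto simp: nn_integral_cmult nn_integral_sum emeasure_space_1 simp del: sum_ennreal)
    also have "\<dots> \<le> ennreal \<kappa> + ennreal (\<kappa> / \<kappa> ^ r) * (\<Sum>p\<in>(grid n :: (real ^ 'd) set). ennreal (gauss_moment r * (\<sigma>\<^sup>2 * (36 * \<rho> ^ (2 * j))) ^ r))"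
      by (intro add_left_mono mult_left_mono sum_mono g_mom) auto
    also have "\<dots> = ennreal (\<kappa> + \<kappa> / \<kappa> ^ r * (real (card (grid n :: (real ^ 'd) set)) * (gauss_moment r * (\<sigma>\<^sup>2 * (36 * \<rho> ^ (2 * j))) ^ r)))"
      using \<kappa> gauss_moment_pos[of r] \<rho> by (intro ennreal_affine_const_sum) auto
    also have "\<dots> \<le> ennreal (\<kappa> * (1 + gauss_moment r))"
    proof (rule ennreal_leI)
      have "real (card (grid n :: (real ^ 'd) set)) \<le> real (n ^ CARD('d))" using card_grid of_nat_le_iff by blast
      also have "\<dots> \<le> real (n ^ 2)" using n d_le by (intro of_nat_mono power_increasing) auto
      also have "real (n ^ 2) = 16 ^ j" by (simp add: n_def power_mult[symmetric] mult.commute[of j]) (simp add: power_mult)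
      finally have cg: "real (card (grid n :: (real ^ 'd) set)) \<le> 16 ^ j" .
      have "(\<sigma>\<^sup>2 * (36 * \<rho> ^ (2 * j))) ^ r = \<kappa> ^ r * (\<rho> ^ r) ^ j"
      proof -
        have "\<sigma>\<^sup>2 * (36 * \<rho> ^ (2 * j)) = \<kappa> * \<rho> ^ j"
          by (simp add: \<kappa>_def mult_2 power_add)
        then show ?thesis by (simp only: power_mult_distrib power_mult[symmetric] mult.commute[of j])
      qed
      then have "\<kappa> / \<kappa> ^ r * (real (card (grid n :: (real ^ 'd) set)) * (gauss_moment r * (\<sigma>\<^sup>2 * (36 * \<rho> ^ (2 * j))) ^ r))
        = \<kappa> * gauss_moment r * (real (card (grid n :: (real ^ 'd) set)) * (\<rho> ^ r) ^ j)"
        using \<kappa> by simp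
      also have "\<dots> \<le> \<kappa> * gauss_moment r * (16 ^ j * (\<rho> ^ r) ^ j)"
        using \<kappa> gauss_moment_pos[of r] \<rho> by (intro mult_left_mono mult_right_mono cg) auto
      also have "16 ^ j * (\<rho> ^ r) ^ j = (16 * \<rho> ^ r) ^ j" by (simp add: power_mult_distrib)
      also have "\<kappa> * gauss_moment r * (16 * \<rho> ^ r) ^ j \<le> \<kappa> * gauss_moment r * 1"
        using \<kappa> gauss_moment_pos[of r] \<rho> r(2) by (intro mult_left_mono power_le_one) (auto simp: \<rho>_def)
      finally show "\<kappa> + \<kappa> / \<kappa> ^ r * (real (card (grid n :: (real ^ 'd) set)) * (gauss_moment r * (\<sigma>\<^sup>2 * (36 * \<rho> ^ (2 * j))) ^ r)) \<le> \<kappa> * (1 + gauss_moment r)"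
        by (simp add: distrib_left)
    qed
    finally show ?thesis .
  qed
  define Q where "Q = (\<lambda>\<omega>. (4 * pi / 4 ^ j)\<^sup>2 * real (card ?B) * (\<Sum>l\<in>?B. (cmod (high_freq_coeff m \<omega> l))\<^sup>2))"
  have Q_meas: "Q \<in> borel_measurable M"
    unfolding Q_def using high_freq_coeff_measurable[OF m] by measurable
  have Q0: "0 \<le> Q \<omega>" for \<omega> unfolding Q_def by (intro mult_nonneg_nonneg sum_nonneg) auto
  have Q_mom: "(\<integral>\<^sup>+\<omega>. ennreal (Q \<omega>) \<partial>M) \<le> ennreal ((4 * pi)\<^sup>2 * 36\<^sup>2 * 2 * gauss_moment 1 * \<sigma>\<^sup>2 * \<rho> ^ j)"
  proof -
    let ?c = "(4 * pi / 4 ^ j)\<^sup>2 * real (card ?B)"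
    let ?e = "2 * gauss_moment 1 * \<sigma>\<^sup>2 * \<rho> ^ (2 * j)"
    have "(\<integral>\<^sup>+\<omega>. ennreal (Q \<omega>) \<partial>M) = (\<integral>\<^sup>+\<omega>. ennreal ?c * (\<Sum>l\<in>?B. ennreal ((cmod (high_freq_coeff m \<omega> l))\<^sup>2)) \<partial>M)"
      by (intro nn_integral_cong) (simp add: Q_def ennreal_mult sum_ennreal sum_nonneg)
    also have "\<dots> = ennreal ?c * (\<Sum>l\<in>?B. \<integral>\<^sup>+\<omega>. ennreal ((cmod (high_freq_coeff m \<omega> l))\<^sup>2) \<partial>M)"
      using high_freq_coeff_measurable[OF m] by (subst nn_integral_cmult) (auto simp: nn_integral_sum simp del: sum_ennreal)
    also have "\<dots> \<le> ennreal ?c * (\<Sum>l\<in>?B. ennreal ?e)"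
    proof (intro mult_left_mono sum_mono)
      fix l assume "l \<in> ?B"
      then show "(\<integral>\<^sup>+\<omega>. ennreal ((cmod (high_freq_coeff m \<omega> l))\<^sup>2) \<partial>M) \<le> ennreal ?e"
        unfolding \<sigma>_def \<rho>_def using bt C0 by (intro high_freq_coeff_moment m fin C) auto
    qed auto
    also have "\<dots> = ennreal (?c * (real (card ?B) * ?e))"
      using ennreal_affine_const_sum[of 0 ?c ?e ?B] gauss_moment_pos[of 1] \<rho> by simp
    also have "\<dots> \<le> ennreal ((4 * pi)\<^sup>2 * 36\<^sup>2 * 2 * gauss_moment 1 * \<sigma>\<^sup>2 * \<rho> ^ j)"
    proof (rule ennreal_leI)
      have e0: "0 \<le> ?e" using gauss_moment_pos[of 1] \<rho> by simp
      have "?c * (real (card ?B) * ?e) = (4 * pi / 4 ^ j)\<^sup>2 * (real (card ?B))\<^sup>2 * ?e"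
        by (simp add: power2_eq_square)
      also have "\<dots> \<le> (4 * pi / 4 ^ j)\<^sup>2 * (36 * 4 ^ j)\<^sup>2 * ?e"
        using card_block_le[of j] by (intro mult_right_mono[OF _ e0] mult_left_mono power_mono) auto
      also have "(4 * pi / 4 ^ j)\<^sup>2 * (36 * 4 ^ j)\<^sup>2 = (4 * pi)\<^sup>2 * (36::real)\<^sup>2"
        by (simp add: power_divide power_mult_distrib)
      also have "(4 * pi)\<^sup>2 * 36\<^sup>2 * ?e \<le> (4 * pi)\<^sup>2 * 36\<^sup>2 * (2 * gauss_moment 1 * \<sigma>\<^sup>2 * \<rho> ^ j)"
        using gauss_moment_pos[of 1] \<rho> by (intro mult_left_mono power_decreasing) auto
      finally show "?c * (real (card ?B) * ?e) \<le> (4 * pi)\<^sup>2 * 36\<^sup>2 * 2 * gauss_moment 1 * \<sigma>\<^sup>2 * \<rho> ^ j"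
        by (simp add: mult_ac)
    qed
    finally show ?thesis .
  qed
  define V where "V = (\<lambda>\<omega>. \<Sum>i\<in>(UNIV :: 'd set). 2 * W \<omega> i + 2 * Q \<omega>)"
  have W0: "0 \<le> W \<omega> i" for \<omega> i
    unfolding W_def using \<kappa> by (intro mult_nonneg_nonneg add_nonneg_nonneg divide_nonneg_nonneg sum_nonneg) (auto simp: zero_le_even_power)
  show ?thesis
  proof (rule that[of V])
    show "V \<in> borel_measurable M" unfolding V_def using W_meas Q_meas by measurable
    show "0 \<le> V \<omega>" for \<omega> unfolding V_def by (intro sum_nonneg add_nonneg_nonneg mult_nonneg_nonneg W0 Q0) auto
    show "(norm (block_field ?B (high_freq_coeff m \<omega>) y))\<^sup>2 \<le> V \<omega>" if \<omega>: "\<omega> \<in> space M" for \<omega> y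
    proof -
      obtain p where p: "p \<in> grid n" and near: "\<And>i. \<bar>block_field ?B (high_freq_coeff m \<omega>) y $ i\<bar> \<le> \<bar>block_field ?B (high_freq_coeff m \<omega>) p $ i\<bar> + 2 * pi * real CARD('d) / real n * (\<Sum>l\<in>?B. cmod (high_freq_coeff m \<omega> l))"
        using block_field_grid[OF finite_dyadic_block n] by metis
      have gp: "block_field ?B (high_freq_coeff m \<omega>) p $ i = g \<omega> p i" for i
        unfolding g_def by (rule block_field_high_freq[OF m \<omega>]) simp
      let ?L = "2 * pi * real CARD('d) / real n * (\<Sum>l\<in>?B. cmod (high_freq_coeff m \<omega> l))"
      have LQ: "?L\<^sup>2 \<le> Q \<omega>"
      proof -
        have "2 * pi * real CARD('d) / real n \<le> 4 * pi / 4 ^ j"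
          using d_le by (intro frac_le) (auto simp: n_def)
        then have "(2 * pi * real CARD('d) / real n)\<^sup>2 \<le> (4 * pi / 4 ^ j)\<^sup>2" by (intro power_mono) auto
        moreover have "(\<Sum>l\<in>?B. cmod (high_freq_coeff m \<omega> l))\<^sup>2 \<le> real (card ?B) * (\<Sum>l\<in>?B. (cmod (high_freq_coeff m \<omega> l))\<^sup>2)"
          using Cauchy_Schwarz_ineq_sum[of "\<lambda>_. 1" "\<lambda>l. cmod (high_freq_coeff m \<omega> l)" ?B] by simp
        ultimately show ?thesis unfolding Q_def power_mult_distrib mult.assoc
          by (intro mult_mono) (auto intro: sum_nonneg)
      qed
      have "(block_field ?B (high_freq_coeff m \<omega>) y $ i)\<^sup>2 \<le> 2 * W \<omega> i + 2 * Q \<omega>" for i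
      proof -
        have "(block_field ?B (high_freq_coeff m \<omega>) y $ i)\<^sup>2 \<le> 2 * \<bar>g \<omega> p i\<bar>\<^sup>2 + 2 * ?L\<^sup>2"
          using near[of i] unfolding gp by (rule square_le_two_squares)
        moreover have "\<bar>g \<omega> p i\<bar>\<^sup>2 \<le> W \<omega> i"
        proof -
          have "\<bar>g \<omega> p i\<bar>\<^sup>2 \<le> \<kappa> * (1 + (\<bar>g \<omega> p i\<bar>\<^sup>2) ^ r / \<kappa> ^ r)"
            by (rule le_scaled_power[OF _ \<kappa> r(1)]) simp
          also have "(\<bar>g \<omega> p i\<bar>\<^sup>2) ^ r = g \<omega> p i ^ (2 * r)" by (simp add: power_mult)
          also have "\<dots> \<le> (\<Sum>p\<in>grid n. g \<omega> p i ^ (2 * r))"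
            using p finite_grid by (intro member_le_sum[of p "grid n"]) (auto simp: zero_le_even_power)
          finally show ?thesis using \<kappa> by (simp add: W_def divide_right_mono)
        qed
        ultimately show ?thesis using LQ by linarith
      qed
      moreover have "(norm (block_field ?B (high_freq_coeff m \<omega>) y))\<^sup>2 = (\<Sum>i\<in>UNIV. (block_field ?B (high_freq_coeff m \<omega>) y $ i)\<^sup>2)"
        by (simp add: norm_vec_def L2_set_def sum_nonneg)
      ultimately show ?thesis unfolding V_def by (simp add: sum_mono)
    qed
    have "(\<integral>\<^sup>+\<omega>. ennreal (V \<omega>) \<partial>M) = (\<integral>\<^sup>+\<omega>. (\<Sum>i\<in>(UNIV :: 'd set). ennreal 2 * ennreal (W \<omega> i) + ennreal 2 * ennreal (Q \<omega>)) \<partial>M)"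
      by (intro nn_integral_cong) (simp add: V_def sum_ennreal[symmetric] W0 Q0 ennreal_plus ennreal_mult)
    also have "\<dots> = (\<Sum>i\<in>(UNIV :: 'd set). ennreal 2 * (\<integral>\<^sup>+\<omega>. ennreal (W \<omega> i) \<partial>M) + ennreal 2 * (\<integral>\<^sup>+\<omega>. ennreal (Q \<omega>) \<partial>M))"
      using W_meas Q_meas by (simp add: nn_integral_sum nn_integral_add nn_integral_cmult)
    also have "\<dots> \<le> (\<Sum>i\<in>(UNIV :: 'd set). ennreal 2 * ennreal (\<kappa> * (1 + gauss_moment r)) + ennreal 2 * ennreal ((4 * pi)\<^sup>2 * 36\<^sup>2 * 2 * gauss_moment 1 * \<sigma>\<^sup>2 * \<rho> ^ j))"
      by (intro sum_mono add_mono mult_left_mono W_mom Q_mom) auto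
    also have "\<dots> = ennreal (real CARD('d) * (2 * (\<kappa> * (1 + gauss_moment r)) + 2 * ((4 * pi)\<^sup>2 * 36\<^sup>2 * 2 * gauss_moment 1 * \<sigma>\<^sup>2 * \<rho> ^ j)))"
    proof -
      have a: "0 \<le> \<kappa> * (1 + gauss_moment r)" using \<kappa> gauss_moment_pos[of r] by simp
      have b: "0 \<le> (4 * pi)\<^sup>2 * 36\<^sup>2 * 2 * gauss_moment 1 * \<sigma>\<^sup>2 * \<rho> ^ j"
        using \<rho> gauss_moment_pos[of 1] by simp
      show ?thesis using a b
        by (simp only: sum_constant ennreal_mult[symmetric] ennreal_plus[symmetric] ennreal_of_nat_eq_real_of_nat zero_le_numeral mult_nonneg_nonneg add_nonneg_nonneg of_nat_0_le_iff)
    qed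
    also have "\<dots> \<le> ennreal ((144 * (1 + gauss_moment r) + 4 * (4 * pi)\<^sup>2 * 36\<^sup>2 * 2 * gauss_moment 1) * \<sigma>\<^sup>2 * \<rho> ^ j)"
    proof (rule ennreal_leI)
      have "real CARD('d) * (2 * (\<kappa> * (1 + gauss_moment r)) + 2 * ((4 * pi)\<^sup>2 * 36\<^sup>2 * 2 * gauss_moment 1 * \<sigma>\<^sup>2 * \<rho> ^ j))
        \<le> 2 * (2 * (\<kappa> * (1 + gauss_moment r)) + 2 * ((4 * pi)\<^sup>2 * 36\<^sup>2 * 2 * gauss_moment 1 * \<sigma>\<^sup>2 * \<rho> ^ j))"
        using d_le \<kappa> \<rho> gauss_moment_pos[of r] gauss_moment_pos[of 1] by (intro mult_right_mono) auto
      also have "\<dots> = (144 * (1 + gauss_moment r) + 4 * (4 * pi)\<^sup>2 * 36\<^sup>2 * 2 * gauss_moment 1) * \<sigma>\<^sup>2 * \<rho> ^ j"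
        by (simp add: \<kappa>_def algebra_simps)
      finally show "real CARD('d) * (2 * (\<kappa> * (1 + gauss_moment r)) + 2 * ((4 * pi)\<^sup>2 * 36\<^sup>2 * 2 * gauss_moment 1 * \<sigma>\<^sup>2 * \<rho> ^ j))
        \<le> (144 * (1 + gauss_moment r) + 4 * (4 * pi)\<^sup>2 * 36\<^sup>2 * 2 * gauss_moment 1) * \<sigma>\<^sup>2 * \<rho> ^ j" .
    qed
    finally show "(\<integral>\<^sup>+\<omega>. ennreal (V \<omega>) \<partial>M) \<le> ennreal ((144 * (1 + gauss_moment r) + 4 * (4 * pi)\<^sup>2 * 36\<^sup>2 * 2 * gauss_moment 1) * (C * m powr - (b + t))\<^sup>2 * (2 powr b) ^ j)"
      by (simp only: \<sigma>_def \<rho>_def)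
  qed
qed

end

lemma ennreal_enn2real_le: "ennreal (enn2real y) \<le> y"
  by (cases y) auto

context noisy_operator
begin

text \<open>
  The blocks of \<open>e\<close> converge to \<open>e\<close> in the norm of \<open>H\<^sup>0\<close>, by Bessel's inequality, and \<open>K\<close> turns this into convergence in
  \<open>H\<^sup>s\<close>, the dual of the space that contains the noise. Truncations of \<open>e\<close> need not have bounded total variation;
  this is why the limit is taken in the pairing and not in the final estimate.
\<close>

lemma high_freq_block_tendsto:
  assumes e: "e \<in> L2" and m: "0 < m" and \<omega>: "\<omega> \<in> space M"
  shows "(\<lambda>n. \<Sum>j<n. high_freq m \<omega> (trig_poly (dyadic_block j) (fcoeff e))) \<longlonglongrightarrow> high_freq m \<omega> e"
proof -
  define F where "F = (\<lambda>n. \<Union>j<n. dyadic_block j :: (int ^ 'd) set)"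
  have F_fin: "finite (F n)" for n by (simp add: F_def)
  have F_sym: "- k \<in> F n \<longleftrightarrow> k \<in> F n" for k n by (auto simp: F_def dyadic_block_def)
  let ?p = "\<lambda>n. trig_poly (F n) (fcoeff e)"
  have blocks: "(\<Sum>j<n. high_freq m \<omega> (trig_poly (dyadic_block j) (fcoeff e))) = high_freq m \<omega> (?p n)" for n
  proof -
    have lin: "test_linear (high_freq m \<omega>)" by (rule high_freq_test_linear[OF m \<omega>])
    have "high_freq m \<omega> (?p n) = Re (\<Sum>k\<in>F n. fcoeff e k * cnj (high_freq_coeff m \<omega> k))"
      by (rule test_linear_trig_poly[OF lin F_fin])
    also have "\<dots> = Re (\<Sum>j<n. \<Sum>k\<in>dyadic_block j. fcoeff e k * cnj (high_freq_coeff m \<omega> k))"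
      unfolding F_def by (subst sum.UNION_disjoint) (auto dest: dyadic_block_disjoint)
    also have "\<dots> = (\<Sum>j<n. Re (\<Sum>k\<in>dyadic_block j. fcoeff e k * cnj (high_freq_coeff m \<omega> k)))"
      by (rule Re_sum)
    also have "\<dots> = (\<Sum>j<n. high_freq m \<omega> (trig_poly (dyadic_block j) (fcoeff e)))"
      by (simp only: test_linear_trig_poly[OF lin finite_dyadic_block])
    finally show ?thesis ..
  qed
  obtain C where C: "C > 0" "\<And>u. u \<in> L2 \<Longrightarrow> H_norm (0 + t) (KH u) \<le> C * H_norm 0 (fcoeff u)"
    by (rule KH_bound[OF order_refl]) (rule that)
  have ne: "japanese_bracket k \<noteq> 0" for k :: "int ^ 'd" using bracket_pos[of k] by simp
  define R where "R = (\<Sum>\<^sub>\<infinity>k. (cmod (fcoeff e k))\<^sup>2)"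
  have summ: "(\<lambda>k. (cmod (fcoeff e k))\<^sup>2) summable_on UNIV"
    using H_fcoeff(1)[OF e] by (simp add: H_finite_def ne)
  have tail: "(H_norm 0 (fcoeff (\<lambda>x. e x - ?p n x)))\<^sup>2 = R - (\<Sum>k\<in>F n. (cmod (fcoeff e k))\<^sup>2)" for n
  proof -
    have "fcoeff (\<lambda>x. e x - ?p n x) k = (if k \<in> F n then 0 else fcoeff e k)" for k
      using fcoeff_diff[OF L2_integrable[OF e] L2_integrable[OF trig_poly_L2], of "F n" "fcoeff e" k]
      by (simp add: fcoeff_trig_poly[OF F_fin] F_sym fcoeff_minus)
    then have "(H_norm 0 (fcoeff (\<lambda>x. e x - ?p n x)))\<^sup>2 = (\<Sum>\<^sub>\<infinity>k. (cmod (if k \<in> F n then 0 else fcoeff e k))\<^sup>2)"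
      by (simp add: H_norm_sq ne)
    also have "\<dots> = (\<Sum>\<^sub>\<infinity>k\<in>- F n. (cmod (fcoeff e k))\<^sup>2)"
      by (rule infsum_cong_neutral) auto
    also have "\<dots> = R - (\<Sum>k\<in>F n. (cmod (fcoeff e k))\<^sup>2)"
    proof -
      have "R = (\<Sum>\<^sub>\<infinity>k\<in>F n \<union> - F n. (cmod (fcoeff e k))\<^sup>2)" by (simp add: R_def)
      also have "\<dots> = (\<Sum>\<^sub>\<infinity>k\<in>F n. (cmod (fcoeff e k))\<^sup>2) + (\<Sum>\<^sub>\<infinity>k\<in>- F n. (cmod (fcoeff e k))\<^sup>2)"
        by (intro infsum_Un_disjoint summable_on_subset_banach[OF summ]) auto
      finally show ?thesis using F_fin by simp
    qed
    finally show ?thesis .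
  qed
  have "(\<lambda>n. R - (\<Sum>k\<in>F n. (cmod (fcoeff e k))\<^sup>2)) \<longlonglongrightarrow> R - R"
    unfolding F_def R_def by (intro tendsto_diff tendsto_const sum_dyadic_tendsto has_sum_infsum summ)
  then have "(\<lambda>n. sqrt ((H_norm 0 (fcoeff (\<lambda>x. e x - ?p n x)))\<^sup>2)) \<longlonglongrightarrow> sqrt 0"
    unfolding tail by (intro tendsto_real_sqrt) simp
  then have small: "(\<lambda>n. H_norm 0 (fcoeff (\<lambda>x. e x - ?p n x))) \<longlonglongrightarrow> 0"
    by (simp add: H_norm_nonneg)
  have close: "\<bar>high_freq m \<omega> e - high_freq m \<omega> (?p n)\<bar> \<le> C * noise_norm \<omega> * H_norm 0 (fcoeff (\<lambda>x. e x - ?p n x))" for n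
  proof -
    let ?d = "\<lambda>x. e x - ?p n x"
    have d: "?d \<in> L2" by (intro L2_diff e trig_poly_L2)
    have "e = (\<lambda>x. ?d x + ?p n x)" by (rule ext) (simp only: diff_add_cancel)
    then have "high_freq m \<omega> e = high_freq m \<omega> (\<lambda>x. ?d x + ?p n x)" by (rule arg_cong)
    also have "\<dots> = high_freq m \<omega> ?d + high_freq m \<omega> (?p n)" by (rule high_freq_add[OF d trig_poly_L2 m \<omega>])
    finally have "\<bar>high_freq m \<omega> e - high_freq m \<omega> (?p n)\<bar> = \<bar>high_freq m \<omega> ?d\<bar>" by simp
    also have "\<dots> \<le> H_norm s (cut_above m (KH ?d)) * noise_norm \<omega>"
      unfolding high_freq_def noise_norm_def by (rule pairing_abs_le[OF KH_cut_s[OF d m] \<xi>_finite[OF \<omega>]])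
    also have "H_norm s (cut_above m (KH ?d)) \<le> m powr (s - s) * H_norm s (KH ?d)"
      by (rule cut_above_gain(2)[OF KH_s[OF d] order_refl m])
    also have "\<dots> = H_norm s (KH ?d)" using m by simp
    also have "\<dots> \<le> H_norm t (KH ?d)" using H_mono(2)[OF KH_finite[OF d]] st by simp
    also have "\<dots> \<le> C * H_norm 0 (fcoeff ?d)" using C(2)[OF d] by simp
    finally show ?thesis using H_norm_nonneg[of "-s" "\<xi> \<omega>"]
      by (simp add: noise_norm_def mult_right_mono mult_ac)
  qed
  have "(\<lambda>n. C * noise_norm \<omega> * H_norm 0 (fcoeff (\<lambda>x. e x - ?p n x))) \<longlonglongrightarrow> 0"
    by (rule tendsto_mult_right_zero[OF small])
  then have "(\<lambda>n. high_freq m \<omega> e - high_freq m \<omega> (?p n)) \<longlonglongrightarrow> 0"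
    by (rule Lim_null_comparison[rotated]) (rule always_eventually, rule allI, simp only: real_norm_def close)
  then have "(\<lambda>n. high_freq m \<omega> e - (high_freq m \<omega> e - high_freq m \<omega> (?p n))) \<longlonglongrightarrow> high_freq m \<omega> e - 0"
    by (intro tendsto_diff tendsto_const)
  then have "(\<lambda>n. high_freq m \<omega> (?p n)) \<longlonglongrightarrow> high_freq m \<omega> e" by (simp only: diff_diff_eq2 add_diff_cancel_left' diff_0_right)
  then show ?thesis by (simp only: blocks)
qed

text \<open>
  Sum the suprema of the fields over all blocks; the factor \<open>(2 powr b) ^ j\<close> makes the sum
  converge, which is why \<open>b\<close> has to be negative. The mean of \<open>e\<close> is controlled by \<open>TV e\<close> on \<open>X\<close>, where constants are excluded.
\<close>

theorem high_frequency_bound: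
  assumes X: "X \<subseteq> BV \<inter> L2" and c: "0 < c" "\<And>u. u \<in> X \<Longrightarrow> c * L2_norm u \<le> TV u"
    and bt: "b < 0" "0 \<le> b + t"
  obtains A where "0 \<le> A" "\<And>m. 0 < m \<Longrightarrow> \<exists>G. G \<in> borel_measurable M \<and> (\<forall>\<omega>. 0 \<le> G \<omega>) \<and>
     (\<integral>\<^sup>+\<omega>. ennreal ((G \<omega>)\<^sup>2) \<partial>M) \<le> ennreal (A * (m powr - (b + t))\<^sup>2) \<and>
     (AE \<omega> in M. \<forall>e\<in>X. high_freq m \<omega> e \<le> G \<omega> * TV e)"
proof -
  obtain C where C0: "C > 0" and fin: "\<And>u. u \<in> L2 \<Longrightarrow> H_finite (b + t) (KH u)"
    and C: "\<And>u. u \<in> L2 \<Longrightarrow> H_norm (b + t) (KH u) \<le> C * H_norm b (fcoeff u)"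
    by (rule KH_bound[OF less_imp_le[OF bt(1)]]) (rule that)
  \<comment> \<open>so large that \<open>(2 powr b) ^ r\<close> compensates the factor \<open>16\<close> by which the grid grows from block to block\<close>
  define r where "r = nat \<lceil>4 / (- b)\<rceil>"
  have "0 < 4 / (- b)" using bt by (simp add: divide_pos_neg)
  then have r1: "r \<ge> 1" unfolding r_def by linarith
  have "4 / (- b) \<le> real r" unfolding r_def by linarith
  then have "4 \<le> real r * (- b)"
    by (subst (asm) pos_divide_le_eq) (use bt in simp_all)
  then have br: "b * real r \<le> - 4" by (simp add: mult.commute)
  have "(2 powr b) ^ r = 2 powr (b * real r)" by (simp add: powr_realpow[symmetric] powr_powr)
  also have "\<dots> \<le> 2 powr (- 4)" using br by (intro powr_mono) auto
  also have "2 powr (- 4) = (1 / 16 :: real)" using powr_realpow[of 2 4] by (simp add: powr_minus divide_simps)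
  finally have r2: "16 * (2 powr b) ^ r \<le> 1" by simp
  define D where "D = 144 * (1 + gauss_moment r) + 4 * (4 * pi)\<^sup>2 * 36\<^sup>2 * 2 * gauss_moment 1"
  have D: "0 \<le> D" using gauss_moment_pos[of r] gauss_moment_pos[of 1] by (simp add: D_def)
  define \<rho> where "\<rho> = 2 powr b"
  \<comment> \<open>weights for the Cauchy-Schwarz inequality over the blocks, halfway between \<open>1\<close> and the decay \<open>\<rho>\<close> of the squares\<close>
  define \<theta> where "\<theta> = sqrt \<rho>"
  have \<rho>: "0 < \<rho>" "\<rho> < 1" using bt by (auto simp: \<rho>_def powr_less_one)
  have \<theta>: "0 < \<theta>" "\<theta> < 1" "\<theta> * \<theta> = \<rho>" using \<rho> by (auto simp: \<theta>_def)
  define A where "A = 2 / c\<^sup>2 * (2 * gauss_moment 1 * C\<^sup>2) + 2 / (1 - \<theta>) * (D * C\<^sup>2 / (1 - \<theta>))"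
  show ?thesis
  proof (rule that[of A])
    show "0 \<le> A" unfolding A_def using D \<theta> gauss_moment_pos[of 1] by (intro add_nonneg_nonneg mult_nonneg_nonneg divide_nonneg_nonneg) auto
    fix m :: real assume m: "0 < m"
    define \<sigma> where "\<sigma> = C * m powr - (b + t)"
    have \<sigma>: "0 < \<sigma>" using C0 m by (simp add: \<sigma>_def)
    have "\<exists>V. V \<in> borel_measurable M \<and> (\<forall>\<omega>. 0 \<le> V \<omega>) \<and> (\<integral>\<^sup>+\<omega>. ennreal (V \<omega>) \<partial>M) \<le> ennreal (D * \<sigma>\<^sup>2 * \<rho> ^ j) \<and>
      (\<forall>\<omega>\<in>space M. \<forall>y. (norm (block_field (dyadic_block j) (high_freq_coeff m \<omega>) y))\<^sup>2 \<le> V \<omega>)" for j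
      unfolding D_def \<sigma>_def \<rho>_def
      by (rule block_field_bound[OF m bt(2,1) fin C C0 r1 r2, of j]) blast+
    then obtain V where V_meas: "\<And>j. V j \<in> borel_measurable M" and V0: "\<And>j \<omega>. 0 \<le> V j \<omega>"
      and V_mom: "\<And>j. (\<integral>\<^sup>+\<omega>. ennreal (V j \<omega>) \<partial>M) \<le> ennreal (D * \<sigma>\<^sup>2 * \<rho> ^ j)"
      and V_bd: "\<And>j \<omega> y. \<omega> \<in> space M \<Longrightarrow> (norm (block_field (dyadic_block j) (high_freq_coeff m \<omega>) y))\<^sup>2 \<le> V j \<omega>"
      by metis
    define Y where "Y = (\<lambda>\<omega>. \<Sum>j. ennreal (V j \<omega> / \<theta> ^ j))"
    have V_div [measurable]: "(\<lambda>\<omega>. V j \<omega> / \<theta> ^ j) \<in> borel_measurable M" for j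
      by (intro borel_measurable_divide V_meas borel_measurable_const)
    have Y_meas: "Y \<in> borel_measurable M" unfolding Y_def by measurable
    have Y_mom: "(\<integral>\<^sup>+\<omega>. Y \<omega> \<partial>M) \<le> ennreal (D * \<sigma>\<^sup>2 / (1 - \<theta>))"
    proof -
      have "(\<integral>\<^sup>+\<omega>. Y \<omega> \<partial>M) = (\<Sum>j. \<integral>\<^sup>+\<omega>. ennreal (V j \<omega> / \<theta> ^ j) \<partial>M)"
        unfolding Y_def by (intro nn_integral_suminf) measurable
      also have "\<dots> \<le> (\<Sum>j. ennreal (D * \<sigma>\<^sup>2 * \<theta> ^ j))"
      proof (intro suminf_le)
        fix j
        have "(\<integral>\<^sup>+\<omega>. ennreal (V j \<omega> / \<theta> ^ j) \<partial>M) = (\<integral>\<^sup>+\<omega>. ennreal (1 / \<theta> ^ j) * ennreal (V j \<omega>) \<partial>M)"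
          using \<theta> V0 by (intro nn_integral_cong) (simp add: ennreal_mult[symmetric])
        also have "\<dots> = ennreal (1 / \<theta> ^ j) * (\<integral>\<^sup>+\<omega>. ennreal (V j \<omega>) \<partial>M)"
          using V_meas by (intro nn_integral_cmult) measurable
        also have "\<dots> \<le> ennreal (1 / \<theta> ^ j) * ennreal (D * \<sigma>\<^sup>2 * \<rho> ^ j)"
          by (intro mult_left_mono V_mom) simp
        also have "\<dots> = ennreal (1 / \<theta> ^ j * (D * \<sigma>\<^sup>2 * \<rho> ^ j))"
          using D \<rho> \<theta> by (intro ennreal_mult[symmetric]) auto
        also have "1 / \<theta> ^ j * (D * \<sigma>\<^sup>2 * \<rho> ^ j) = D * \<sigma>\<^sup>2 * \<theta> ^ j"
          using \<theta>(1) by (simp add: \<theta>(3)[symmetric] power_mult_distrib)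
        finally show "(\<integral>\<^sup>+\<omega>. ennreal (V j \<omega> / \<theta> ^ j) \<partial>M) \<le> ennreal (D * \<sigma>\<^sup>2 * \<theta> ^ j)" .
      qed auto
      also have "\<dots> = ennreal (\<Sum>j. D * \<sigma>\<^sup>2 * \<theta> ^ j)"
        using D \<theta> by (intro suminf_ennreal2 summable_mult summable_geometric) auto
      also have "(\<Sum>j. D * \<sigma>\<^sup>2 * \<theta> ^ j) = D * \<sigma>\<^sup>2 / (1 - \<theta>)"
        using \<theta> by (subst suminf_mult) (auto simp: suminf_geometric intro!: summable_geometric)
      finally show ?thesis .
    qed
    have "(\<integral>\<^sup>+\<omega>. Y \<omega> \<partial>M) \<noteq> \<infinity>" using Y_mom by (auto simp: top_unique)
    then have Y_fin: "AE \<omega> in M. Y \<omega> \<noteq> \<infinity>" by (rule nn_integral_PInf_AE[OF Y_meas])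
    define G where "G = (\<lambda>\<omega>. cmod (high_freq_coeff m \<omega> 0) / c + sqrt (1 / (1 - \<theta>)) * sqrt (enn2real (Y \<omega>)))"
    have G_meas: "G \<in> borel_measurable M"
      unfolding G_def using Y_meas high_freq_coeff_measurable[OF m, of 0] by measurable
    have zero_block: "(0 :: int ^ 'd) \<in> dyadic_block j \<longleftrightarrow> j = 0" for j
    proof -
      have "(0 :: int ^ 'd) \<in> dyadic_block 0" by (simp add: dyadic_block_def japanese_bracket_def)
      then show ?thesis using dyadic_block_disjoint[of "0 :: int ^ 'd" j 0] by auto
    qed
    show "\<exists>G. G \<in> borel_measurable M \<and> (\<forall>\<omega>. 0 \<le> G \<omega>) \<and>
     (\<integral>\<^sup>+\<omega>. ennreal ((G \<omega>)\<^sup>2) \<partial>M) \<le> ennreal (A * (m powr - (b + t))\<^sup>2) \<and>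
     (AE \<omega> in M. \<forall>e\<in>X. high_freq m \<omega> e \<le> G \<omega> * TV e)"
    proof (intro exI[of _ G] conjI)
      show "G \<in> borel_measurable M" by (rule G_meas)
      show "\<forall>\<omega>. 0 \<le> G \<omega>" unfolding G_def using c \<theta> by (intro allI add_nonneg_nonneg mult_nonneg_nonneg) auto
      have "(\<integral>\<^sup>+\<omega>. ennreal ((G \<omega>)\<^sup>2) \<partial>M) \<le> (\<integral>\<^sup>+\<omega>. ennreal (2 / c\<^sup>2) * ennreal ((cmod (high_freq_coeff m \<omega> 0))\<^sup>2) + ennreal (2 / (1 - \<theta>)) * Y \<omega> \<partial>M)"
      proof (rule nn_integral_mono)
        fix \<omega>
        have "(G \<omega>)\<^sup>2 \<le> 2 * (cmod (high_freq_coeff m \<omega> 0) / c)\<^sup>2 + 2 * (sqrt (1 / (1 - \<theta>)) * sqrt (enn2real (Y \<omega>)))\<^sup>2"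
          using square_le_two_squares[of "G \<omega>" "cmod (high_freq_coeff m \<omega> 0) / c" "sqrt (1 / (1 - \<theta>)) * sqrt (enn2real (Y \<omega>))"] c \<theta>
          by (simp add: G_def)
        also have "\<dots> = 2 / c\<^sup>2 * (cmod (high_freq_coeff m \<omega> 0))\<^sup>2 + 2 / (1 - \<theta>) * enn2real (Y \<omega>)"
          using \<theta> by (simp add: power_divide power_mult_distrib)
        finally have "ennreal ((G \<omega>)\<^sup>2) \<le> ennreal (2 / c\<^sup>2 * (cmod (high_freq_coeff m \<omega> 0))\<^sup>2 + 2 / (1 - \<theta>) * enn2real (Y \<omega>))"
          by (rule ennreal_leI)
        also have "\<dots> = ennreal (2 / c\<^sup>2) * ennreal ((cmod (high_freq_coeff m \<omega> 0))\<^sup>2) + ennreal (2 / (1 - \<theta>)) * ennreal (enn2real (Y \<omega>))"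
          using \<theta> c by (simp add: ennreal_plus ennreal_mult[symmetric])
        also have "\<dots> \<le> ennreal (2 / c\<^sup>2) * ennreal ((cmod (high_freq_coeff m \<omega> 0))\<^sup>2) + ennreal (2 / (1 - \<theta>)) * Y \<omega>"
          by (intro add_left_mono mult_left_mono ennreal_enn2real_le) auto
        finally show "ennreal ((G \<omega>)\<^sup>2) \<le> ennreal (2 / c\<^sup>2) * ennreal ((cmod (high_freq_coeff m \<omega> 0))\<^sup>2) + ennreal (2 / (1 - \<theta>)) * Y \<omega>" .
      qed
      also have "\<dots> = ennreal (2 / c\<^sup>2) * (\<integral>\<^sup>+\<omega>. ennreal ((cmod (high_freq_coeff m \<omega> 0))\<^sup>2) \<partial>M) + ennreal (2 / (1 - \<theta>)) * (\<integral>\<^sup>+\<omega>. Y \<omega> \<partial>M)"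
        using Y_meas high_freq_coeff_measurable[OF m, of 0] by (simp add: nn_integral_add nn_integral_cmult)
      also have "\<dots> \<le> ennreal (2 / c\<^sup>2) * ennreal (2 * gauss_moment 1 * \<sigma>\<^sup>2 * \<rho> ^ (2 * 0)) + ennreal (2 / (1 - \<theta>)) * ennreal (D * \<sigma>\<^sup>2 / (1 - \<theta>))"
        unfolding \<sigma>_def \<rho>_def
        by (intro add_mono mult_left_mono high_freq_coeff_moment[OF m bt(2) _ fin C] Y_mom[unfolded \<sigma>_def \<rho>_def])
           (use bt C0 zero_block[of 0] in auto)
      also have "\<dots> = ennreal (A * (m powr - (b + t))\<^sup>2)"
      proof -
        have "2 / c\<^sup>2 * (2 * gauss_moment 1 * \<sigma>\<^sup>2 * \<rho> ^ (2 * 0)) + 2 / (1 - \<theta>) * (D * \<sigma>\<^sup>2 / (1 - \<theta>)) = A * (m powr - (b + t))\<^sup>2"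
          by (simp add: A_def \<sigma>_def power_mult_distrib distrib_right distrib_left mult_ac)
        moreover have "ennreal (2 / c\<^sup>2) * ennreal (2 * gauss_moment 1 * \<sigma>\<^sup>2 * \<rho> ^ (2 * 0)) + ennreal (2 / (1 - \<theta>)) * ennreal (D * \<sigma>\<^sup>2 / (1 - \<theta>))
          = ennreal (2 / c\<^sup>2 * (2 * gauss_moment 1 * \<sigma>\<^sup>2 * \<rho> ^ (2 * 0)) + 2 / (1 - \<theta>) * (D * \<sigma>\<^sup>2 / (1 - \<theta>)))"
          using \<theta> D gauss_moment_pos[of 1]
          by (subst ennreal_mult[symmetric], simp, simp, subst ennreal_mult[symmetric], simp, simp, subst ennreal_plus[symmetric], simp_all)
        ultimately show ?thesis by simp
      qed
      finally show "(\<integral>\<^sup>+\<omega>. ennreal ((G \<omega>)\<^sup>2) \<partial>M) \<le> ennreal (A * (m powr - (b + t))\<^sup>2)" .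
      show "AE \<omega> in M. \<forall>e\<in>X. high_freq m \<omega> e \<le> G \<omega> * TV e"
        using Y_fin AE_space
      proof eventually_elim
        case (elim \<omega>)
        show ?case
        proof
          fix e assume "e \<in> X"
          then have eBV: "e \<in> BV" and e: "e \<in> L2" and ec: "c * L2_norm e \<le> TV e" using X c by auto
          have TV0: "0 \<le> TV e" by (rule TV_nonneg[OF eBV])
          have e0: "cmod (fcoeff e 0) \<le> TV e / c"
          proof -
            have "(cmod (fcoeff e 0))\<^sup>2 \<le> (L2_norm e)\<^sup>2" using Bessel[OF e, of "{0}"] by simp
            then have "cmod (fcoeff e 0) \<le> L2_norm e" by (rule power2_le_imp_le) (rule L2_norm_nonneg)
            also have "\<dots> \<le> TV e / c" using ec c(1) by (simp add: pos_le_divide_eq mult.commute)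
            finally show ?thesis .
          qed
          have "(\<Sum>j<n. high_freq m \<omega> (trig_poly (dyadic_block j) (fcoeff e))) \<le> G \<omega> * TV e" for n
          proof -
            have "(\<Sum>j<n. high_freq m \<omega> (trig_poly (dyadic_block j) (fcoeff e))) \<le>
              (\<Sum>j<n. (if j = 0 then cmod (high_freq_coeff m \<omega> 0) * cmod (fcoeff e 0) else 0) + sqrt (V j \<omega>) * TV e)"
            proof (rule sum_mono)
              fix j
              have "norm (block_field (dyadic_block j) (high_freq_coeff m \<omega>) y) \<le> sqrt (V j \<omega>)" for y
                using V_bd[OF elim(2), of j y] by (rule real_le_rsqrt)
              from test_linear_block_le[OF high_freq_test_linear[OF m elim(2)] finite_dyadic_block eBV this]
              show "high_freq m \<omega> (trig_poly (dyadic_block j) (fcoeff e)) \<le> (if j = 0 then cmod (high_freq_coeff m \<omega> 0) * cmod (fcoeff e 0) else 0) + sqrt (V j \<omega>) * TV e"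
                by (simp add: zero_block)
            qed
            also have "\<dots> = (\<Sum>j<n. if j = 0 then cmod (high_freq_coeff m \<omega> 0) * cmod (fcoeff e 0) else 0) + (\<Sum>j<n. sqrt (V j \<omega>)) * TV e"
              by (simp add: sum.distrib sum_distrib_right)
            also have "(\<Sum>j<n. if j = 0 then cmod (high_freq_coeff m \<omega> 0) * cmod (fcoeff e 0) else 0) \<le> cmod (high_freq_coeff m \<omega> 0) * cmod (fcoeff e 0)"
              by (simp add: sum.delta)
            also have "cmod (high_freq_coeff m \<omega> 0) * cmod (fcoeff e 0) \<le> cmod (high_freq_coeff m \<omega> 0) * (TV e / c)"
              by (intro mult_left_mono e0) simp
            also have "(\<Sum>j<n. sqrt (V j \<omega>)) \<le> sqrt (1 / (1 - \<theta>)) * sqrt (enn2real (Y \<omega>))"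
            proof -
              have "(\<Sum>j<n. sqrt (\<theta> ^ j) * sqrt (V j \<omega> / \<theta> ^ j))\<^sup>2 \<le> (\<Sum>j<n. (sqrt (\<theta> ^ j))\<^sup>2) * (\<Sum>j<n. (sqrt (V j \<omega> / \<theta> ^ j))\<^sup>2)"
                by (rule Cauchy_Schwarz_ineq_sum)
              also have "(\<Sum>j<n. (sqrt (\<theta> ^ j))\<^sup>2) = (\<Sum>j<n. \<theta> ^ j)" using \<theta> by simp
              also have "(\<Sum>j<n. (sqrt (V j \<omega> / \<theta> ^ j))\<^sup>2) = (\<Sum>j<n. V j \<omega> / \<theta> ^ j)" using \<theta> V0 by simp
              also have "(\<Sum>j<n. \<theta> ^ j) * (\<Sum>j<n. V j \<omega> / \<theta> ^ j) \<le> 1 / (1 - \<theta>) * enn2real (Y \<omega>)"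
              proof (rule mult_mono)
                have "(\<Sum>j<n. \<theta> ^ j) \<le> (\<Sum>j. \<theta> ^ j)" using \<theta> by (intro sum_le_suminf summable_geometric) auto
                then show "(\<Sum>j<n. \<theta> ^ j) \<le> 1 / (1 - \<theta>)" using \<theta> by (simp add: suminf_geometric)
                have "ennreal (\<Sum>j<n. V j \<omega> / \<theta> ^ j) = (\<Sum>j<n. ennreal (V j \<omega> / \<theta> ^ j))"
                  using \<theta> V0 by (simp add: sum_ennreal)
                also have "\<dots> \<le> Y \<omega>" unfolding Y_def by (rule sum_le_suminf) auto
                finally have "ennreal (\<Sum>j<n. V j \<omega> / \<theta> ^ j) \<le> ennreal (enn2real (Y \<omega>))" using elim(1) by (simp add: less_top)
                then show "(\<Sum>j<n. V j \<omega> / \<theta> ^ j) \<le> enn2real (Y \<omega>)" by (simp add: ennreal_le_iff)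
                show "0 \<le> (\<Sum>j<n. V j \<omega> / \<theta> ^ j)" using \<theta> V0 by (intro sum_nonneg divide_nonneg_nonneg) auto
              qed (use \<theta> in auto)
              finally have "(\<Sum>j<n. sqrt (\<theta> ^ j) * sqrt (V j \<omega> / \<theta> ^ j)) \<le> sqrt (1 / (1 - \<theta>) * enn2real (Y \<omega>))"
                by (rule real_le_rsqrt)
              moreover have "sqrt (\<theta> ^ j) * sqrt (V j \<omega> / \<theta> ^ j) = sqrt (V j \<omega>)" for j
                using \<theta> by (simp add: real_sqrt_mult[symmetric])
              ultimately show ?thesis by (simp only: real_sqrt_mult)
            qed
            then have "(\<Sum>j<n. sqrt (V j \<omega>)) * TV e \<le> sqrt (1 / (1 - \<theta>)) * sqrt (enn2real (Y \<omega>)) * TV e"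
              using TV0 by (rule mult_right_mono)
            finally show ?thesis by (simp add: G_def distrib_right)
          qed
          then show "high_freq m \<omega> e \<le> G \<omega> * TV e"
            by (intro LIMSEQ_le_const2[OF high_freq_block_tendsto[OF e m elim(2)]]) auto
        qed
      qed
    qed
  qed
qed

end

section \<open>Measurability of functions that depend continuously on the noise\<close>

text \<open>
  A function that depends continuously on a measurable map \<open>Z\<close> into a separable metric space factors through
  a continuous function on the range of \<open>Z\<close>.
\<close>

lemma measurable_by_sequences:
  fixes Z :: "'w \<Rightarrow> 'z::{metric_space, second_countable_topology}" and D :: "'w \<Rightarrow> real"
  assumes Z: "Z \<in> borel_measurable M"
    and seq: "\<And>w \<omega>. (\<And>i. w i \<in> space M) \<Longrightarrow> \<omega> \<in> space M \<Longrightarrow> (\<lambda>i. Z (w i)) \<longlonglongrightarrow> Z \<omega> \<Longrightarrow> (\<lambda>i::nat. D (w i)) \<longlonglongrightarrow> D \<omega>"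
  shows "D \<in> borel_measurable M"
proof -
  \<comment> \<open>constant sequences show that the choice does not matter\<close>
  define \<psi> where "\<psi> = (\<lambda>z. D (SOME \<omega>. \<omega> \<in> space M \<and> Z \<omega> = z))"
  have \<psi>: "\<psi> (Z \<omega>) = D \<omega>" if \<omega>: "\<omega> \<in> space M" for \<omega>
  proof -
    define w where "w = (SOME \<omega>'. \<omega>' \<in> space M \<and> Z \<omega>' = Z \<omega>)"
    have w: "w \<in> space M \<and> Z w = Z \<omega>" unfolding w_def by (rule someI[of _ \<omega>]) (simp add: \<omega>)
    have "(\<lambda>i::nat. D w) \<longlonglongrightarrow> D \<omega>" by (rule seq) (use w \<omega> in auto)
    then have "D w = D \<omega>" by (simp add: LIMSEQ_const_iff)
    then show ?thesis by (simp add: \<psi>_def w_def)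
  qed
  have cont: "continuous_on (Z ` space M) \<psi>"
    unfolding continuous_on_sequentially
  proof (intro allI ballI impI)
    fix x a assume a: "a \<in> Z ` space M" and x: "(\<forall>n. x n \<in> Z ` space M) \<and> x \<longlonglongrightarrow> a"
    obtain \<omega> where \<omega>: "\<omega> \<in> space M" "a = Z \<omega>" using a by blast
    have "\<forall>n. \<exists>v. v \<in> space M \<and> x n = Z v" using x by blast
    then obtain w where w: "\<And>n. w n \<in> space M" "\<And>n. x n = Z (w n)" by metis
    have "(\<lambda>i. Z (w i)) \<longlonglongrightarrow> Z \<omega>" using x \<omega>(2) unfolding w(2) by simp
    then have "(\<lambda>i. D (w i)) \<longlonglongrightarrow> D \<omega>" by (intro seq w(1) \<omega>(1))
    moreover have "(\<psi> \<circ> x) = (\<lambda>i. D (w i))" using w by (auto simp: fun_eq_iff \<psi>)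
    ultimately show "(\<psi> \<circ> x) \<longlonglongrightarrow> \<psi> a" using \<omega> by (simp add: \<psi>)
  qed
  have "\<psi> \<in> borel_measurable (restrict_space borel (Z ` space M))"
    by (rule borel_measurable_continuous_on_restrict[OF cont])
  moreover have "Z \<in> measurable M (restrict_space borel (Z ` space M))"
    by (rule measurable_restrict_space2) (use Z in auto)
  ultimately have "(\<lambda>\<omega>. \<psi> (Z \<omega>)) \<in> borel_measurable M" by (rule measurable_compose[rotated])
  then show ?thesis using \<psi> by (subst measurable_cong[of _ D "\<lambda>\<omega>. \<psi> (Z \<omega>)"]) auto
qed

text \<open>
  Convergence of norms and of all coordinates implies convergence in norm, as in any Hilbert space, by
  the parallelogram identity. The infinite-dimensional norm topology thus becomes accessible from countably many real
  measurable functions.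
\<close>

lemma H_norm_convergence:
  assumes f: "\<And>i::nat. H_finite r (f i)" and g: "H_finite r g"
    and nrm: "(\<lambda>i. H_norm r (f i)) \<longlonglongrightarrow> H_norm r g" and pt: "\<And>k. (\<lambda>i. f i k) \<longlonglongrightarrow> g k"
  shows "\<And>i. H_finite r (\<lambda>k. f i k - g k)" "(\<lambda>i. H_norm r (\<lambda>k. f i k - g k)) \<longlonglongrightarrow> 0"
proof -
  let ?w = "\<lambda>k. japanese_bracket k powr (2 * r)"
  let ?R = "\<lambda>F i. 2 * (H_norm r (f i))\<^sup>2 + 2 * (H_norm r g)\<^sup>2 - (\<Sum>k\<in>F. ?w k * (cmod (f i k + g k))\<^sup>2)"
  have par: "(cmod (x - y))\<^sup>2 = 2 * (cmod x)\<^sup>2 + 2 * (cmod y)\<^sup>2 - (cmod (x + y))\<^sup>2" for x y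
    by (simp only: cmod_power2) (simp add: power2_eq_square algebra_simps)
  have le: "(\<Sum>k\<in>G. ?w k * (cmod (f i k - g k))\<^sup>2) \<le> ?R F i" if G: "finite G" and F: "finite F" for F G i
  proof -
    have "(\<Sum>k\<in>G. ?w k * (cmod (f i k - g k))\<^sup>2) \<le> (\<Sum>k\<in>G \<union> F. ?w k * (cmod (f i k - g k))\<^sup>2)"
      using F G by (intro sum_mono2) auto
    also have "\<dots> = 2 * (\<Sum>k\<in>G \<union> F. ?w k * (cmod (f i k))\<^sup>2) + 2 * (\<Sum>k\<in>G \<union> F. ?w k * (cmod (g k))\<^sup>2) - (\<Sum>k\<in>G \<union> F. ?w k * (cmod (f i k + g k))\<^sup>2)"
      unfolding par by (simp add: sum_distrib_left sum.distrib[symmetric] sum_subtractf[symmetric] algebra_simps)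
    also have "\<dots> \<le> 2 * (H_norm r (f i))\<^sup>2 + 2 * (H_norm r g)\<^sup>2 - (\<Sum>k\<in>F. ?w k * (cmod (f i k + g k))\<^sup>2)"
    proof -
      have "(\<Sum>k\<in>F. ?w k * (cmod (f i k + g k))\<^sup>2) \<le> (\<Sum>k\<in>G \<union> F. ?w k * (cmod (f i k + g k))\<^sup>2)"
        using F G by (intro sum_mono2) auto
      then show ?thesis using H_sum_le[OF f[of i], of "G \<union> F"] H_sum_le[OF g, of "G \<union> F"] F G by simp
    qed
    finally show ?thesis .
  qed
  have R0: "0 \<le> ?R F i" if "finite F" for F i using le[of "{}" F i] that by simp
  have bd: "H_finite r (\<lambda>k. f i k - g k)" "H_norm r (\<lambda>k. f i k - g k) \<le> sqrt (?R F i)" if "finite F" for F i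
    using H_norm_leI[of r "\<lambda>k. f i k - g k" "sqrt (?R F i)"] le[OF _ that, of _ i] R0[OF that, of i] by auto
  show "H_finite r (\<lambda>k. f i k - g k)" for i using bd(1)[of "{}"] by simp
  show "(\<lambda>i. H_norm r (\<lambda>k. f i k - g k)) \<longlonglongrightarrow> 0"
  proof (rule LIMSEQ_I)
    fix e :: real assume e: "0 < e"
    have "((\<lambda>F. \<Sum>k\<in>F. ?w k * (cmod (g k))\<^sup>2) \<longlongrightarrow> (H_norm r g)\<^sup>2) (finite_subsets_at_top UNIV)"
      unfolding H_norm_sq by (rule infsum_tendsto) (use g in \<open>simp add: H_finite_def\<close>)
    then have "\<forall>\<^sub>F F in finite_subsets_at_top UNIV. (H_norm r g)\<^sup>2 - e\<^sup>2 / 4 < (\<Sum>k\<in>F. ?w k * (cmod (g k))\<^sup>2)"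
      by (rule order_tendstoD) (use e in simp)
    then obtain F where F: "finite F" "(H_norm r g)\<^sup>2 - e\<^sup>2 / 4 < (\<Sum>k\<in>F. ?w k * (cmod (g k))\<^sup>2)"
      by (auto simp: eventually_finite_subsets_at_top)
    have "(\<lambda>i. ?R F i) \<longlonglongrightarrow> 2 * (H_norm r g)\<^sup>2 + 2 * (H_norm r g)\<^sup>2 - (\<Sum>k\<in>F. ?w k * (cmod (g k + g k))\<^sup>2)"
      by (intro tendsto_intros nrm pt)
    moreover have "(\<Sum>k\<in>F. ?w k * (cmod (g k + g k))\<^sup>2) = 4 * (\<Sum>k\<in>F. ?w k * (cmod (g k))\<^sup>2)"
      by (simp add: mult_2[symmetric] norm_mult power_mult_distrib sum_distrib_left mult_ac)
    ultimately have "\<forall>\<^sub>F i in sequentially. ?R F i < e\<^sup>2"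
      by (intro order_tendstoD(2)) (use F in auto)
    then obtain n where n: "\<And>i. i \<ge> n \<Longrightarrow> ?R F i < e\<^sup>2" by (auto simp: eventually_sequentially)
    show "\<exists>n. \<forall>i\<ge>n. norm (H_norm r (\<lambda>k. f i k - g k) - 0) < e"
    proof (intro exI allI impI)
      fix i assume "n \<le> i"
      then have "sqrt (?R F i) < sqrt (e\<^sup>2)" using n by (intro real_sqrt_less_mono) simp
      then have "H_norm r (\<lambda>k. f i k - g k) < e" using bd(2)[OF F(1), of i] e by simp
      then show "norm (H_norm r (\<lambda>k. f i k - g k) - 0) < e" using H_norm_nonneg[of r "\<lambda>k. f i k - g k"] by simp
    qed
  qed
qed

context white_noise_space
begin

lemma measurable_by_noise_convergence:
  fixes D :: "'w \<Rightarrow> real"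
  assumes "\<And>w \<omega>. (\<And>i. w i \<in> space M) \<Longrightarrow> \<omega> \<in> space M \<Longrightarrow> (\<lambda>i. noise_norm (w i)) \<longlonglongrightarrow> noise_norm \<omega> \<Longrightarrow>
      (\<lambda>i. H_norm (- s) (\<lambda>k. \<xi> (w i) k - \<xi> \<omega> k)) \<longlonglongrightarrow> 0 \<Longrightarrow> (\<lambda>i::nat. D (w i)) \<longlonglongrightarrow> D \<omega>"
  shows "D \<in> borel_measurable M"
proof (rule measurable_by_sequences[where Z = "\<lambda>\<omega>. (noise_norm \<omega>, \<xi> \<omega>)"])
  have "\<xi> \<in> borel_measurable M"
    by (rule measurable_coordinatewise_then_product) measurable
  then show "(\<lambda>\<omega>. (noise_norm \<omega>, \<xi> \<omega>)) \<in> borel_measurable M" by measurable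
next
  fix w :: "nat \<Rightarrow> 'w" and \<omega>
  assume w: "\<And>i. w i \<in> space M" and \<omega>: "\<omega> \<in> space M" and lim: "(\<lambda>i. (noise_norm (w i), \<xi> (w i))) \<longlonglongrightarrow> (noise_norm \<omega>, \<xi> \<omega>)"
  have n: "(\<lambda>i. noise_norm (w i)) \<longlonglongrightarrow> noise_norm \<omega>" using tendsto_fst[OF lim] by simp
  have "(\<lambda>i. \<xi> (w i)) \<longlonglongrightarrow> \<xi> \<omega>" using tendsto_snd[OF lim] by simp
  then have pt: "(\<lambda>i. \<xi> (w i) k) \<longlonglongrightarrow> \<xi> \<omega> k" for k
    using continuous_on_tendsto_compose[OF continuous_on_product_coordinates[of k], of "\<lambda>i. \<xi> (w i)"] by simp
  show "(\<lambda>i. D (w i)) \<longlonglongrightarrow> D \<omega>"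
    by (rule assms[OF w \<omega> n])
       (rule H_norm_convergence(2)[OF \<xi>_finite[OF w] \<xi>_finite[OF \<omega>] n[unfolded noise_norm_def] pt])
qed

end

section \<open>Energy identity and a priori bounds\<close>

text \<open>
  The infimum in the source condition is finite, so nearly optimal \<open>w\<close> exist; the dual norm bound extends from the unit ball
  of \<open>TV\<close> to \<open>X\<close> by homogeneity.
\<close>

lemma approx_source_bound:
  assumes X: "function_subspace X" "X \<subseteq> BV \<inter> L2" and \<mu>: "\<mu> \<in> dual_space X"
    and K: "\<And>u. u \<in> L2 \<Longrightarrow> K u \<in> L2" and adj: "L2_adjoint K Kstar"
    and source: "approx_source_condition X K \<mu> r"
  obtains C \<beta>0 where "0 \<le> C" "0 < \<beta>0"
    "\<And>\<beta>. 0 < \<beta> \<Longrightarrow> \<beta> < \<beta>0 \<Longrightarrow> \<exists>W\<ge>0. W\<^sup>2 \<le> C * \<beta> powr (- r) \<and> (\<forall>u\<in>X. \<bar>\<mu> u\<bar> \<le> W * L2_norm (K u) + \<beta> * TV u)"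
proof -
  obtain C \<beta>0 where \<beta>0: "0 < \<beta>0" and inf: "\<And>\<beta>. 0 < \<beta> \<Longrightarrow> \<beta> < \<beta>0 \<Longrightarrow>
        (INF w\<in>{w\<in>L2. dual_norm X (\<lambda>u. \<mu> u - L2_inner w (K u)) \<le> ereal \<beta>}. ereal ((L2_norm w)\<^sup>2)) = ereal (C * \<beta> powr (- r))"
    using source unfolding approx_source_condition_def eventually_at_right_field by auto
  show ?thesis
  proof (rule that[of "\<bar>C\<bar> + 1" \<beta>0])
    fix \<beta> :: real assume \<beta>: "0 < \<beta>" "\<beta> < \<beta>0"
    have "ereal (C * \<beta> powr (- r)) < ereal ((\<bar>C\<bar> + 1) * \<beta> powr (- r))"
    proof -
      have "C * \<beta> powr (- r) < (\<bar>C\<bar> + 1) * \<beta> powr (- r)" using \<beta> by (intro mult_strict_right_mono) auto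
      then show ?thesis by simp
    qed
    then obtain w where w: "w \<in> L2" "dual_norm X (\<lambda>u. \<mu> u - L2_inner w (K u)) \<le> ereal \<beta>"
      "ereal ((L2_norm w)\<^sup>2) < ereal ((\<bar>C\<bar> + 1) * \<beta> powr (- r))"
      unfolding inf[OF \<beta>, symmetric] INF_less_iff by auto
    let ?l = "\<lambda>u. \<mu> u - L2_inner w (K u)"
    have XL: "u \<in> L2" "u \<in> BV" if "u \<in> X" for u using that X(2) by auto
    have Xs: "(\<lambda>x. k * u x) \<in> X" if "u \<in> X" for u k using X(1) that by (auto simp: function_subspace_def)
    have l_scale: "?l (\<lambda>x. k * u x) = k * ?l u" if u: "u \<in> X" for u k
    proof -
      have "L2_inner (K (\<lambda>x. k * u x)) w = k * L2_inner (K u) w"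
        using adj w(1) XL(1)[OF u] L2_scale[OF XL(1)[OF u], of k] by (simp add: L2_adjoint_def L2_inner_scale)
      moreover have "\<mu> (\<lambda>x. k * u x) = k * \<mu> u" using \<mu> u by (auto simp: dual_space_def)
      ultimately show ?thesis by (simp add: L2_inner_commute[of w] right_diff_distrib)
    qed
    have l_le: "?l u \<le> \<beta>" if "u \<in> X" "TV u \<le> 1" for u
    proof -
      have "ereal (?l u) \<le> dual_norm X ?l" unfolding dual_norm_def by (rule SUP_upper) (use that in auto)
      then have "ereal (?l u) \<le> ereal \<beta>" using w(2) by (rule order_trans)
      then show ?thesis by simp
    qed
    have l_hom: "k * ?l u \<le> \<beta> * TV u" if u: "u \<in> X" and k: "\<bar>k\<bar> = 1" for u k
    proof (rule field_le_epsilon)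
      fix e :: real assume e: "e > 0"
      \<comment> \<open>the shift by \<open>e / \<beta>\<close> avoids a division by zero when \<open>TV u = 0\<close>\<close>
      let ?\<tau> = "TV u + e / \<beta>"
      have TV0: "0 \<le> TV u" by (rule TV_nonneg[OF XL(2)[OF u]])
      have \<tau>: "?\<tau> > 0" using e \<beta> TV0 by (intro add_nonneg_pos) auto
      have "TV (\<lambda>x. k / ?\<tau> * u x) \<le> \<bar>k / ?\<tau>\<bar> * TV u" by (rule TV_scale[OF XL(2)[OF u]])
      also have "\<dots> \<le> 1" using \<tau> k e \<beta> by (simp add: abs_divide)
      finally have "?l (\<lambda>x. k / ?\<tau> * u x) \<le> \<beta>" by (intro l_le Xs u)
      then have "k / ?\<tau> * ?l u \<le> \<beta>" by (simp only: l_scale[OF u])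
      then have "k * ?l u \<le> \<beta> * ?\<tau>" using \<tau> by (simp add: pos_divide_le_eq)
      also have "\<beta> * ?\<tau> = \<beta> * TV u + e" using \<beta> by (simp add: distrib_left)
      finally show "k * ?l u \<le> \<beta> * TV u + e" .
    qed
    have "\<bar>\<mu> u\<bar> \<le> L2_norm w * L2_norm (K u) + \<beta> * TV u" if u: "u \<in> X" for u
    proof -
      have "\<bar>?l u\<bar> \<le> \<beta> * TV u" using l_hom[OF u, of 1] l_hom[OF u, of "-1"] by (simp add: abs_le_iff)
      moreover have "\<bar>L2_inner w (K u)\<bar> \<le> L2_norm w * L2_norm (K u)"
        by (rule L2_Cauchy_Schwarz[OF w(1) K[OF XL(1)[OF u]]])
      ultimately show ?thesis by linarith
    qed
    then show "\<exists>W\<ge>0. W\<^sup>2 \<le> (\<bar>C\<bar> + 1) * \<beta> powr (- r) \<and> (\<forall>u\<in>X. \<bar>\<mu> u\<bar> \<le> W * L2_norm (K u) + \<beta> * TV u)"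
      using w(3) L2_norm_nonneg by (intro exI[of _ "L2_norm w"]) auto
  qed (use \<beta>0 in auto)
qed

lemma H_norm_uminus: "H_norm r (\<lambda>k. - a k) = H_norm r a" and H_finite_uminus: "H_finite r (\<lambda>k. - a k) = H_finite r a"
  by (simp_all add: H_norm_def H_finite_def)

locale tv_problem = noisy_operator M s N K Kext t
  for M :: "'w measure" and s :: real and N :: "'w \<Rightarrow> 'd::finite distribution"
    and K :: "(real ^ 'd \<Rightarrow> real) \<Rightarrow> real ^ 'd \<Rightarrow> real" and Kext t +
  fixes Kstar and X :: "(real ^ 'd \<Rightarrow> real) set" and c :: real and u_dag \<mu>_dag
  assumes K_adj: "L2_adjoint K Kstar" and X_space: "function_subspace X" and X_BV: "X \<subseteq> BV \<inter> L2"
    and c_pos: "0 < c" and X_embed: "\<And>u. u \<in> X \<Longrightarrow> c * L2_norm u \<le> TV u"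
    and u_dag: "u_dag \<in> X" and mu_dag: "\<mu>_dag \<in> TV_subdifferential X u_dag"
begin

lemma XL: "u \<in> X \<Longrightarrow> u \<in> L2" and XB: "u \<in> X \<Longrightarrow> u \<in> BV"
  using X_BV by auto

lemma X_scale: "u \<in> X \<Longrightarrow> (\<lambda>x. k * u x) \<in> X"
  using X_space by (auto simp: function_subspace_def)

lemma X_add: "u \<in> X \<Longrightarrow> v \<in> X \<Longrightarrow> (\<lambda>x. u x + v x) \<in> X"
  using X_space by (auto simp: function_subspace_def)

lemma X_diff: "u \<in> X \<Longrightarrow> v \<in> X \<Longrightarrow> (\<lambda>x. u x - v x) \<in> X"
  using X_add[of u "\<lambda>x. - 1 * v x"] X_scale[of v "- 1"] by simp

lemma dual_diff:
  assumes q: "q \<in> dual_space X" and u: "u \<in> X" and v: "v \<in> X"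
  shows "q (\<lambda>x. u x - v x) = q u - q v"
proof -
  have add: "q (\<lambda>x. u x + z x) = q u + q z" if "z \<in> X" for z using q u that by (simp add: dual_space_def)
  have scale: "q (\<lambda>x. k * v x) = k * q v" for k using q v by (simp add: dual_space_def)
  show ?thesis using add[OF X_scale[OF v, of "- 1"]] scale[of "- 1"] by simp
qed

lemma TV_0: "u \<in> X \<Longrightarrow> 0 \<le> TV u"
  using TV_nonneg XB by blast

lemma TV_diff:
  assumes "u \<in> X" "v \<in> X" shows "TV (\<lambda>x. u x - v x) \<le> TV u + TV v"
  using TV_add[OF XB[OF assms(1)] XB[OF X_scale[OF assms(2), of "- 1"]]] TV_scale[OF XB[OF assms(2)], of "- 1"] by simp

lemma K_diff:
  assumes "u \<in> L2" "v \<in> L2" "w \<in> L2"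
  shows "L2_inner (K (\<lambda>x. u x - v x)) w = L2_inner (K u) w - L2_inner (K v) w"
proof -
  have "L2_inner (K z) w = L2_inner z (Kstar w)" if "z \<in> L2" for z
    using K_adj that assms(3) by (simp add: L2_adjoint_def)
  moreover have "Kstar w \<in> L2" using K_adj assms(3) by (simp add: L2_adjoint_def)
  ultimately show ?thesis using assms by (simp add: L2_diff L2_inner_diff)
qed

lemma t2: "2 * t > real CARD('d)" using s_gt st by linarith

definition B :: real where "B = (SOME B. 0 < B \<and> (\<forall>v\<in>X. H_norm t (KH v) \<le> B * TV v))"

text \<open>
  \<open>K\<close> smooths by \<open>t\<close> orders from \<open>L\<^sup>2\<close>, whose norm is dominated by \<open>TV\<close> on \<open>X\<close>.
\<close>

lemma B_pos: "0 < B" and KH_TV: "v \<in> X \<Longrightarrow> H_norm t (KH v) \<le> B * TV v"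
proof -
  obtain C where C: "0 < C" "\<And>u. u \<in> L2 \<Longrightarrow> H_norm (0 + t) (KH u) \<le> C * H_norm 0 (fcoeff u)"
    by (rule KH_bound[OF order_refl]) (rule that)
  have "H_norm t (KH v) \<le> C / c * TV v" if v: "v \<in> X" for v
  proof -
    have "H_norm t (KH v) \<le> C * H_norm 0 (fcoeff v)" using C(2)[OF XL[OF v]] by simp
    also have "\<dots> \<le> C * (TV v / c)"
    proof (intro mult_left_mono)
      have "H_norm 0 (fcoeff v) \<le> L2_norm v" by (rule H_fcoeff(2)[OF XL[OF v]])
      also have "\<dots> \<le> TV v / c" using X_embed[OF v] c_pos by (simp add: pos_le_divide_eq mult.commute)
      finally show "H_norm 0 (fcoeff v) \<le> TV v / c" .
    qed (use C in simp)
    finally show ?thesis by simp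
  qed
  then have "\<exists>B. 0 < B \<and> (\<forall>v\<in>X. H_norm t (KH v) \<le> B * TV v)"
    using C(1) c_pos by (intro exI[of _ "C / c"]) auto
  from someI_ex[OF this] show "0 < B" "v \<in> X \<Longrightarrow> H_norm t (KH v) \<le> B * TV v"
    unfolding B_def by auto
qed

lemma L2K: "v \<in> X \<Longrightarrow> L2_norm (K v) = H_norm 0 (KH v)"
  by (rule L2_norm_K[OF t2 XL])

lemma L2K_TV: assumes "v \<in> X" shows "L2_norm (K v) \<le> B * TV v"
  using H_mono(2)[OF KH_finite[OF XL[OF assms]], of 0] KH_TV[OF assms] st s_pos unfolding L2K[OF assms] by linarith

lemma pairing_KH_le:
  assumes v: "v \<in> X" and \<eta>: "H_finite (- s) \<eta>" and m: "0 < m"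
  shows "\<bar>pairing (KH v) \<eta>\<bar> \<le> (m powr s * L2_norm (K v) + B * m powr (s - t) * TV v) * H_norm (- s) \<eta>"
proof -
  have fin: "H_finite t (KH v)" by (rule KH_finite[OF XL[OF v]])
  have s0: "0 \<le> s" "s \<le> t" using s_pos st by auto
  have 1: "pairing (KH v) \<eta> \<le> (m powr s * H_norm 0 (KH v) + m powr (s - t) * H_norm t (KH v)) * H_norm (- s) \<eta>"
    by (rule pairing_crude[OF fin \<eta> s0 m])
  have "pairing (\<lambda>k. - KH v k) \<eta> \<le> (m powr s * H_norm 0 (KH v) + m powr (s - t) * H_norm t (KH v)) * H_norm (- s) \<eta>"
    using pairing_crude[OF _ \<eta> s0 m, of "\<lambda>k. - KH v k"] fin by (simp add: H_norm_uminus H_finite_uminus)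
  moreover have "pairing (\<lambda>k. - KH v k) \<eta> = - pairing (KH v) \<eta>"
    using pairing_scale[of "- 1" "KH v" \<eta>] by simp
  ultimately have "\<bar>pairing (KH v) \<eta>\<bar> \<le> (m powr s * H_norm 0 (KH v) + m powr (s - t) * H_norm t (KH v)) * H_norm (- s) \<eta>"
    using 1 by linarith
  also have "\<dots> \<le> (m powr s * H_norm 0 (KH v) + m powr (s - t) * (B * TV v)) * H_norm (- s) \<eta>"
    by (intro mult_right_mono add_left_mono mult_left_mono KH_TV v H_norm_nonneg) auto
  finally show ?thesis by (simp add: L2K[OF v] mult_ac)
qed

definition solution :: "real \<Rightarrow> real \<Rightarrow> 'w \<Rightarrow> (real ^ 'd \<Rightarrow> real) \<Rightarrow> ((real ^ 'd \<Rightarrow> real) \<Rightarrow> real) \<Rightarrow> bool" where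
  "solution \<delta> a \<omega> u q \<longleftrightarrow> u \<in> X \<and> q \<in> TV_subdifferential X u \<and>
     optimality_condition X K a (noisy_data K u_dag \<delta> (N \<omega>)) u q"

text \<open>
  The pairing with the exact data \<open>K u_dag\<close> is an \<open>L\<^sup>2\<close> inner product by Parseval's identity.
\<close>

lemma optimality:
  assumes sol: "solution \<delta> a \<omega> u q" and \<omega>: "\<omega> \<in> space M" and v: "v \<in> X"
  shows "a * q v = L2_inner (K u_dag) (K v) - L2_inner (K u) (K v) + \<delta> * pairing (KH v) (\<xi> \<omega>)"
proof -
  let ?F = "noisy_data K u_dag \<delta> (N \<omega>)"
  have KL: "K v \<in> L2" "K u_dag \<in> L2" using K_L2 XL v u_dag by auto
  have "fourier ?F = (\<lambda>k. KH u_dag k + of_real \<delta> * \<xi> \<omega> k)"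
    using fourier_regular_fun[OF KL(2)]
    by (simp add: fun_eq_iff fourier_def noisy_data_def KH_def \<xi>_def complex_eq_iff)
  then have "sobolev_pairing (regular (K v)) ?F = pairing (KH v) (\<lambda>k. KH u_dag k + of_real \<delta> * \<xi> \<omega> k)"
    using fourier_regular_fun[OF KL(1)] by (simp add: sobolev_pairing_eq KH_def)
  also have "\<dots> = pairing (KH v) (KH u_dag) + \<delta> * pairing (KH v) (\<xi> \<omega>)"
  proof -
    have fv: "H_finite s (KH v)" by (rule KH_s[OF XL[OF v]])
    have fu: "H_finite (- s) (KH u_dag)" using H_mono(1)[OF KH_finite[OF XL[OF u_dag]], of "- s"] s_pos st by simp
    have s1: "(\<lambda>k. KH v k * cnj (KH u_dag k)) summable_on UNIV" by (rule H_pairing(2)[OF fv fu])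
    have s2: "(\<lambda>k. KH v k * cnj (\<xi> \<omega> k)) summable_on UNIV" by (rule H_pairing(2)[OF fv \<xi>_finite[OF \<omega>]])
    have "(\<Sum>\<^sub>\<infinity>k. KH v k * cnj (KH u_dag k + of_real \<delta> * \<xi> \<omega> k)) = (\<Sum>\<^sub>\<infinity>k. KH v k * cnj (KH u_dag k) + of_real \<delta> * (KH v k * cnj (\<xi> \<omega> k)))"
      by (intro infsum_cong) (simp add: algebra_simps)
    also have "\<dots> = (\<Sum>\<^sub>\<infinity>k. KH v k * cnj (KH u_dag k)) + of_real \<delta> * (\<Sum>\<^sub>\<infinity>k. KH v k * cnj (\<xi> \<omega> k))"
      using s1 s2 by (simp add: infsum_add summable_on_cmult_right infsum_cmult_right')
    finally show ?thesis by (simp add: pairing_def)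
  qed
  also have "pairing (KH v) (KH u_dag) = L2_inner (K v) (K u_dag)"
    using Parseval_K[OF t2 XL[OF v] KL(2)] by (simp add: KH_def)
  finally have "sobolev_pairing (regular (K v)) ?F = L2_inner (K u_dag) (K v) + \<delta> * pairing (KH v) (\<xi> \<omega>)"
    by (simp add: L2_inner_commute)
  moreover have "L2_inner (K u) (K v) - sobolev_pairing (regular (K v)) ?F + a * q v = 0"
    using sol v by (auto simp: solution_def optimality_condition_def)
  ultimately show ?thesis by linarith
qed

abbreviation err :: "(real ^ 'd \<Rightarrow> real) \<Rightarrow> real ^ 'd \<Rightarrow> real" where "err u \<equiv> \<lambda>x. u x - u_dag x"

lemma energy_identity:
  assumes sol: "solution \<delta> a \<omega> u q" and \<omega>: "\<omega> \<in> space M"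
  shows "a * q (err u) = \<delta> * pairing (KH (err u)) (\<xi> \<omega>) - (L2_norm (K (err u)))\<^sup>2"
proof -
  have u: "u \<in> X" using sol by (simp add: solution_def)
  have e: "err u \<in> X" by (rule X_diff[OF u u_dag])
  show ?thesis
    using optimality[OF sol \<omega> e] K_diff[OF XL[OF u] XL[OF u_dag] K_L2[OF XL[OF e]]]
    by (simp add: L2_norm_sq)
qed

lemma subdiffD: "q \<in> TV_subdifferential X u \<Longrightarrow> v \<in> X \<Longrightarrow> TV u + q (\<lambda>x. v x - u x) \<le> TV v"
  and subdiff_dual: "q \<in> TV_subdifferential X u \<Longrightarrow> q \<in> dual_space X"
  by (auto simp: TV_subdifferential_def)

lemma subdiff_monotone:
  assumes "q \<in> TV_subdifferential X u" "p \<in> TV_subdifferential X v" "u \<in> X" "v \<in> X"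
  shows "0 \<le> q (\<lambda>x. u x - v x) - p (\<lambda>x. u x - v x)"
  using subdiffD[OF assms(1,4)] subdiffD[OF assms(2,3)]
    dual_diff[OF subdiff_dual[OF assms(1)] assms(3,4)] dual_diff[OF subdiff_dual[OF assms(1)] assms(4,3)]
  by linarith

lemma bregman_nonneg:
  assumes "solution \<delta> a \<omega> u q" shows "0 \<le> sym_bregman q \<mu>_dag u u_dag"
  unfolding sym_bregman_def using assms by (intro subdiff_monotone mu_dag u_dag) (auto simp: solution_def)

text \<open>
  The exponent with which the noise level enters when the high-frequency term in the bound for the pairing is absorbed,
  by the choice of \<open>m\<close> in lemma \<open>TV_err_raw\<close>.
\<close>

definition \<gamma> :: real where "\<gamma> = 2 * s / (t - s)"

lemma \<gamma>_nonneg: "0 \<le> \<gamma>" using s_pos st by (simp add: \<gamma>_def)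

text \<open>
  The subgradient inequality bounds \<open>TV u\<close> by \<open>TV u_dag\<close> plus the energy terms. The cut \<open>m\<close> may depend on the
  noise here, and is taken such that half of \<open>T\<close> is absorbed on the left.
\<close>

lemma TV_err_raw:
  assumes sol: "solution \<delta> a \<omega> u q" and \<omega>: "\<omega> \<in> space M" and \<delta>: "0 < \<delta>" and a: "0 < a"
  shows "TV (err u) \<le> 4 * TV u_dag + (2 * B) powr \<gamma> * ((\<delta>\<^sup>2 / a) * (\<delta> / a) powr \<gamma>) * noise_norm \<omega> powr (2 + \<gamma>)"
proof -
  have u: "u \<in> X" and q: "q \<in> TV_subdifferential X u" using sol by (auto simp: solution_def)
  have e: "err u \<in> X" by (rule X_diff[OF u u_dag])
  let ?T = "TV (err u)" and ?x = "L2_norm (K (err u))" and ?n = "noise_norm \<omega>"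
  have T0: "0 \<le> ?T" "0 \<le> TV u_dag" using TV_0 e u_dag by auto
  have n0: "0 \<le> ?n" by (simp add: noise_norm_def H_norm_nonneg)
  have "TV u \<le> TV u_dag + q (err u)"
    using subdiffD[OF q u_dag] dual_diff[OF subdiff_dual[OF q] u u_dag] dual_diff[OF subdiff_dual[OF q] u_dag u] by linarith
  moreover have "q (err u) = (\<delta> * pairing (KH (err u)) (\<xi> \<omega>) - ?x\<^sup>2) / a"
    using energy_identity[OF sol \<omega>] a by (simp add: field_simps)
  ultimately have T: "?T \<le> 2 * TV u_dag + (\<delta> * pairing (KH (err u)) (\<xi> \<omega>) - ?x\<^sup>2) / a"
    using TV_diff[OF u u_dag] by linarith
  have p: "pairing (KH (err u)) (\<xi> \<omega>) \<le> (m powr s * ?x + B * m powr (s - t) * ?T) * ?n" if "0 < m" for m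
    using pairing_KH_le[OF e \<xi>_finite[OF \<omega>] that] unfolding noise_norm_def by linarith
  show ?thesis
  proof (cases "?n = 0")
    case True
    then have "pairing (KH (err u)) (\<xi> \<omega>) \<le> 0" using p[of 1] by simp
    then have "\<delta> * pairing (KH (err u)) (\<xi> \<omega>) \<le> 0" using \<delta> by (simp add: mult_le_0_iff)
    then have "(\<delta> * pairing (KH (err u)) (\<xi> \<omega>) - ?x\<^sup>2) / a \<le> 0"
      using a zero_le_power2[of ?x] by (intro divide_nonpos_pos) linarith+
    then have "?T \<le> 4 * TV u_dag" using T T0 by linarith
    then show ?thesis using True by simp
  next
    case False
    then have n: "0 < ?n" using n0 by simp
    define h where "h = 2 * B * ?n * (\<delta> / a)"
    have h: "0 < h" using B_pos n \<delta> a by (simp add: h_def)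
    \<comment> \<open>the high-frequency term then equals \<open>a / 2 * TV (err u)\<close>\<close>
    define m where "m = h powr (1 / (t - s))"
    have m: "0 < m" using h by (simp add: m_def)
    have ts: "t - s > 0" using st by simp
    have "1 / (t - s) * (s - t) = - 1" using ts by (simp add: field_simps)
    then have "m powr (s - t) = h powr (- 1)" by (simp only: m_def powr_powr)
    then have m1: "m powr (s - t) = 1 / h" using h by (simp add: powr_minus_divide)
    have "1 / (t - s) * s + 1 / (t - s) * s = \<gamma>" by (simp add: \<gamma>_def)
    then have m2: "(m powr s)\<^sup>2 = h powr \<gamma>"
      by (simp only: m_def powr_powr power2_eq_square powr_add[symmetric])
    have "\<delta> * pairing (KH (err u)) (\<xi> \<omega>) \<le> \<delta> * ((m powr s * ?x + B * (1 / h) * ?T) * ?n)"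
      using p[OF m] \<delta> unfolding m1 by (intro mult_left_mono) auto
    also have "\<dots> = \<delta> * m powr s * ?n * ?x + a / 2 * ?T"
      using B_pos n \<delta> a by (simp add: h_def field_simps)
    also have "\<delta> * m powr s * ?n * ?x \<le> ?x\<^sup>2 + (\<delta> * m powr s * ?n)\<^sup>2 / 4"
      using sum_squares_bound[of ?x "\<delta> * m powr s * ?n / 2"] by (simp add: power_divide mult_ac)
    finally have "\<delta> * pairing (KH (err u)) (\<xi> \<omega>) - ?x\<^sup>2 \<le> a / 2 * ?T + \<delta>\<^sup>2 * ?n\<^sup>2 * h powr \<gamma> / 4"
      by (simp add: power_mult_distrib m2 mult_ac)
    then have "(\<delta> * pairing (KH (err u)) (\<xi> \<omega>) - ?x\<^sup>2) / a \<le> (a / 2 * ?T + \<delta>\<^sup>2 * ?n\<^sup>2 * h powr \<gamma> / 4) / a"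
      using a by (intro divide_right_mono) auto
    also have "\<dots> = ?T / 2 + \<delta>\<^sup>2 * ?n\<^sup>2 * h powr \<gamma> / (4 * a)" using a by (simp add: field_simps)
    moreover have "\<delta>\<^sup>2 * ?n\<^sup>2 * h powr \<gamma> / (2 * a) = 2 * (\<delta>\<^sup>2 * ?n\<^sup>2 * h powr \<gamma> / (4 * a))" by simp
    ultimately have "?T \<le> 4 * TV u_dag + \<delta>\<^sup>2 * ?n\<^sup>2 * h powr \<gamma> / (2 * a)" using T by linarith
    also have "\<delta>\<^sup>2 * ?n\<^sup>2 * h powr \<gamma> / (2 * a) \<le> \<delta>\<^sup>2 * ?n\<^sup>2 * h powr \<gamma> / a"
      using a by (intro divide_left_mono) auto
    also have "\<dots> = (2 * B) powr \<gamma> * ((\<delta>\<^sup>2 / a) * (\<delta> / a) powr \<gamma>) * ?n powr (2 + \<gamma>)"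
    proof -
      have "h powr \<gamma> = (2 * B) powr \<gamma> * ?n powr \<gamma> * (\<delta> / a) powr \<gamma>"
        unfolding h_def using B_pos n \<delta> a by (subst powr_mult; (subst powr_mult)?) auto
      moreover have "?n powr (2 + \<gamma>) = ?n\<^sup>2 * ?n powr \<gamma>" using n by (simp add: powr_add powr_numeral)
      ultimately show ?thesis by (simp add: mult_ac)
    qed
    finally show ?thesis by simp
  qed
qed

definition moment_order :: nat where "moment_order = nat \<lceil>2 + \<gamma>\<rceil>"

lemma moment_order: "1 \<le> moment_order" "2 + \<gamma> \<le> real (2 * moment_order)"
  using \<gamma>_nonneg unfolding moment_order_def by linarith+

definition TV_majorant :: "real \<Rightarrow> 'w \<Rightarrow> real" where
  "TV_majorant \<Theta> \<omega> = 4 * TV u_dag + (2 * B) powr \<gamma> * \<Theta> * (1 + noise_norm \<omega> ^ (2 * moment_order))"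

lemma TV_majorant_nonneg: "0 \<le> \<Theta> \<Longrightarrow> 0 \<le> TV_majorant \<Theta> \<omega>"
  using TV_0[OF u_dag] by (simp add: TV_majorant_def zero_le_even_power)

lemma TV_majorant_measurable [measurable]: "TV_majorant \<Theta> \<in> borel_measurable M"
  unfolding TV_majorant_def by measurable

lemma TV_err_le:
  assumes sol: "solution \<delta> a \<omega> u q" and \<omega>: "\<omega> \<in> space M" and \<delta>: "0 < \<delta>" and a: "0 < a"
    and \<Theta>: "(\<delta>\<^sup>2 / a) * (\<delta> / a) powr \<gamma> \<le> \<Theta>"
  shows "TV (err u) \<le> TV_majorant \<Theta> \<omega>"
proof -
  let ?n = "noise_norm \<omega>"
  have n0: "0 \<le> ?n" by (simp add: noise_norm_def H_norm_nonneg)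
  have n: "?n powr (2 + \<gamma>) \<le> 1 + ?n ^ (2 * moment_order)"
  proof (cases "?n \<le> 1")
    case True
    then have "?n powr (2 + \<gamma>) \<le> 1 powr (2 + \<gamma>)" using n0 \<gamma>_nonneg by (intro powr_mono2) auto
    then show ?thesis by (simp add: zero_le_even_power add_increasing2)
  next
    case False
    then have "?n powr (2 + \<gamma>) \<le> ?n powr real (2 * moment_order)" using moment_order by (intro powr_mono) auto
    also have "\<dots> = ?n ^ (2 * moment_order)" using False by (intro powr_realpow) auto
    finally show ?thesis by simp
  qed
  have "0 \<le> (\<delta>\<^sup>2 / a) * (\<delta> / a) powr \<gamma>" using a by simp
  then have "(2 * B) powr \<gamma> * ((\<delta>\<^sup>2 / a) * (\<delta> / a) powr \<gamma>) * ?n powr (2 + \<gamma>) \<le> (2 * B) powr \<gamma> * \<Theta> * (1 + ?n ^ (2 * moment_order))"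
    using \<Theta> n by (intro mult_mono mult_left_mono) auto
  then show ?thesis using TV_err_raw[OF sol \<omega> \<delta> a] unfolding TV_majorant_def by linarith
qed

lemma TV_majorant_moment:
  assumes \<Theta>: "0 \<le> \<Theta>"
  obtains C where "0 \<le> C" "(\<integral>\<^sup>+\<omega>. ennreal ((TV_majorant \<Theta> \<omega>)\<^sup>2) \<partial>M) \<le> ennreal C"
proof -
  let ?k = "(2 * B) powr \<gamma> * \<Theta>"
  obtain C where C: "0 \<le> C" "(\<integral>\<^sup>+\<omega>. ennreal (noise_norm \<omega> ^ (2 * (2 * moment_order))) \<partial>M) \<le> ennreal C"
    by (rule noise_norm_moment[of "2 * moment_order"]) (use moment_order(1) in auto)
  let ?p = "2 * (4 * TV u_dag + ?k)\<^sup>2" and ?q = "2 * ?k\<^sup>2"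
  have "(\<integral>\<^sup>+\<omega>. ennreal ((TV_majorant \<Theta> \<omega>)\<^sup>2) \<partial>M) \<le> (\<integral>\<^sup>+\<omega>. ennreal ?p + ennreal ?q * ennreal (noise_norm \<omega> ^ (2 * (2 * moment_order))) \<partial>M)"
  proof (rule nn_integral_mono)
    fix \<omega>
    have "\<bar>TV_majorant \<Theta> \<omega>\<bar> \<le> (4 * TV u_dag + ?k) + ?k * noise_norm \<omega> ^ (2 * moment_order)"
      using TV_majorant_nonneg[OF \<Theta>, of \<omega>] by (simp add: TV_majorant_def algebra_simps)
    then have "(TV_majorant \<Theta> \<omega>)\<^sup>2 \<le> ?p + 2 * (?k * noise_norm \<omega> ^ (2 * moment_order))\<^sup>2" by (rule square_le_two_squares)
    also have "2 * (?k * noise_norm \<omega> ^ (2 * moment_order))\<^sup>2 = ?q * noise_norm \<omega> ^ (2 * (2 * moment_order))"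
      by (simp add: power_mult_distrib power_mult[symmetric] mult.commute[of _ 2])
    finally have "ennreal ((TV_majorant \<Theta> \<omega>)\<^sup>2) \<le> ennreal (?p + ?q * noise_norm \<omega> ^ (2 * (2 * moment_order)))" by (rule ennreal_leI)
    also have "\<dots> = ennreal ?p + ennreal ?q * ennreal (noise_norm \<omega> ^ (2 * (2 * moment_order)))"
      by (subst ennreal_plus) (auto simp: ennreal_mult zero_le_even_power)
    finally show "ennreal ((TV_majorant \<Theta> \<omega>)\<^sup>2) \<le> ennreal ?p + ennreal ?q * ennreal (noise_norm \<omega> ^ (2 * (2 * moment_order)))" .
  qed
  also have "\<dots> = ennreal ?p + ennreal ?q * (\<integral>\<^sup>+\<omega>. ennreal (noise_norm \<omega> ^ (2 * (2 * moment_order))) \<partial>M)"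
    by (subst nn_integral_add, simp, measurable, subst nn_integral_cmult, measurable) (simp add: emeasure_space_1)
  also have "\<dots> \<le> ennreal ?p + ennreal ?q * ennreal C" by (intro add_left_mono mult_left_mono C) simp
  also have "\<dots> = ennreal (?p + ?q * C)" using C(1) by (simp only: ennreal_mult[symmetric] ennreal_plus[symmetric] zero_le_power2 mult_nonneg_nonneg zero_le_numeral)
  finally show ?thesis using that[of "?p + ?q * C"] C(1) by simp
qed

end

section \<open>Stability, measurability and the pathwise error estimate\<close>

lemma quadratic_bound: "x\<^sup>2 \<le> p * x + (r::real) \<Longrightarrow> x\<^sup>2 \<le> p\<^sup>2 + 2 * r"
  using sum_squares_bound[of p x] by simp

text \<open>
  Both \<open>\<mu>_dag\<close> and the pairing with a fixed noise are bounded by a large multiple of \<open>\<parallel>K v\<parallel>\<close> plus a small multiple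
  of \<open>TV v\<close>. Hence they converge along bounded sequences in \<open>X\<close> although they need not be continuous in \<open>K v\<close>.
\<close>

lemma tendsto_0_two_parameter:
  fixes f :: "nat \<Rightarrow> real"
  assumes bd: "\<And>e. 0 < e \<Longrightarrow> \<exists>A\<ge>0. \<forall>i. \<bar>f i\<bar> \<le> A * g i + e * T" and g: "g \<longlonglongrightarrow> 0" and T: "0 \<le> T"
  shows "f \<longlonglongrightarrow> 0"
proof (rule LIMSEQ_I)
  fix r :: real assume r: "0 < r"
  define e where "e = r / (2 * (T + 1))"
  have e: "0 < e" using r T by (simp add: e_def)
  have eT: "e * T \<le> r / 2"
  proof -
    have "e * T \<le> e * (T + 1)" using e by simp
    also have "\<dots> = r / 2" using T by (simp add: e_def field_simps)
    finally show ?thesis .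
  qed
  obtain A where A: "0 \<le> A" "\<And>i. \<bar>f i\<bar> \<le> A * g i + e * T" using bd[OF e] by blast
  have "(\<lambda>i. A * g i) \<longlonglongrightarrow> 0" by (rule tendsto_mult_right_zero[OF g])
  then have "\<forall>\<^sub>F i in sequentially. A * g i < r / 2" using r by (intro order_tendstoD(2)) auto
  then obtain n where n: "\<And>i. i \<ge> n \<Longrightarrow> A * g i < r / 2" by (auto simp: eventually_sequentially)
  show "\<exists>n. \<forall>i\<ge>n. norm (f i - 0) < r"
  proof (intro exI allI impI)
    fix i assume "n \<le> i"
    then show "norm (f i - 0) < r" using n[of i] A(2)[of i] eT by simp
  qed
qed

context tv_problem
begin

text \<open>
  Subtract the optimality conditions of two realisations; the subgradients drop out by monotonicity.
\<close>

lemma stability: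
  assumes sol1: "solution \<delta> a \<omega>1 u1 q1" and sol2: "solution \<delta> a \<omega>2 u2 q2"
    and \<omega>: "\<omega>1 \<in> space M" "\<omega>2 \<in> space M" and \<delta>: "0 < \<delta>" and a: "0 < a"
    and fin: "H_finite (- s) (\<lambda>k. \<xi> \<omega>1 k - \<xi> \<omega>2 k)"
  defines "v \<equiv> \<lambda>x. u1 x - u2 x" and "\<eta> \<equiv> H_norm (- s) (\<lambda>k. \<xi> \<omega>1 k - \<xi> \<omega>2 k)"
  shows "(L2_norm (K v))\<^sup>2 \<le> (\<delta> * \<eta>) * L2_norm (K v) + \<delta> * B * TV v * \<eta>"
proof -
  have u: "u1 \<in> X" "u2 \<in> X" and q: "q1 \<in> TV_subdifferential X u1" "q2 \<in> TV_subdifferential X u2"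
    using sol1 sol2 by (auto simp: solution_def)
  have v: "v \<in> X" unfolding v_def by (rule X_diff[OF u])
  have "0 \<le> a * (q1 v - q2 v)"
    using subdiff_monotone[OF q u] a unfolding v_def by (intro mult_nonneg_nonneg) auto
  also have "\<dots> = a * q1 v - a * q2 v" by (simp add: right_diff_distrib)
  also have "\<dots> = - (L2_inner (K u1) (K v) - L2_inner (K u2) (K v)) + \<delta> * (pairing (KH v) (\<xi> \<omega>1) - pairing (KH v) (\<xi> \<omega>2))"
    using optimality[OF sol1 \<omega>(1) v] optimality[OF sol2 \<omega>(2) v] by (simp add: algebra_simps)
  also have "L2_inner (K u1) (K v) - L2_inner (K u2) (K v) = (L2_norm (K v))\<^sup>2"
    using K_diff[OF XL[OF u(1)] XL[OF u(2)] K_L2[OF XL[OF v]]] by (simp add: L2_norm_sq v_def)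
  also have "pairing (KH v) (\<xi> \<omega>1) - pairing (KH v) (\<xi> \<omega>2) = pairing (KH v) (\<lambda>k. \<xi> \<omega>1 k - \<xi> \<omega>2 k)"
  proof -
    note s1 = H_pairing(2)[OF KH_s[OF XL[OF v]] \<xi>_finite[OF \<omega>(1)], of UNIV]
    note s2 = H_pairing(2)[OF KH_s[OF XL[OF v]] \<xi>_finite[OF \<omega>(2)], of UNIV]
    note s3 = H_pairing(2)[OF KH_s[OF XL[OF v]] fin, of UNIV]
    have "(\<Sum>\<^sub>\<infinity>k. KH v k * cnj (\<xi> \<omega>1 k)) = (\<Sum>\<^sub>\<infinity>k. KH v k * cnj (\<xi> \<omega>1 k - \<xi> \<omega>2 k) + KH v k * cnj (\<xi> \<omega>2 k))"
      by (intro infsum_cong) (simp add: algebra_simps)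
    also have "\<dots> = (\<Sum>\<^sub>\<infinity>k. KH v k * cnj (\<xi> \<omega>1 k - \<xi> \<omega>2 k)) + (\<Sum>\<^sub>\<infinity>k. KH v k * cnj (\<xi> \<omega>2 k))"
      by (rule infsum_add[OF s3 s2])
    finally show ?thesis by (simp add: pairing_def)
  qed
  finally have "(L2_norm (K v))\<^sup>2 \<le> \<delta> * pairing (KH v) (\<lambda>k. \<xi> \<omega>1 k - \<xi> \<omega>2 k)" by simp
  also have "\<dots> \<le> \<delta> * ((1 powr s * L2_norm (K v) + B * 1 powr (s - t) * TV v) * \<eta>)"
    using pairing_KH_le[OF v fin, of 1] \<delta> unfolding \<eta>_def by (intro mult_left_mono) auto
  finally show ?thesis by (simp add: algebra_simps)
qed

text \<open>
  Along realisations whose noise converges in \<open>H\<^sup>-\<^sup>s\<close>, stability gives convergence of \<open>K U\<close>, while \<open>TV U\<close>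
  stays bounded. By the energy identity these two facts suffice for convergence of the Bregman distance; convergence
  of \<open>U\<close> in total variation, which may fail, is avoided.
\<close>

lemma bregman_measurable:
  assumes sol: "\<And>\<omega>. \<omega> \<in> space M \<Longrightarrow> solution \<delta> a \<omega> (U \<omega>) (q \<omega>)" and \<delta>: "0 < \<delta>" and a: "0 < a"
    and src: "\<And>e. 0 < e \<Longrightarrow> \<exists>A\<ge>0. \<forall>v\<in>X. \<bar>\<mu>_dag v\<bar> \<le> A * L2_norm (K v) + e * TV v"
  shows "(\<lambda>\<omega>. sym_bregman (q \<omega>) \<mu>_dag (U \<omega>) u_dag) \<in> borel_measurable M"
proof (rule measurable_by_noise_convergence)
  fix w :: "nat \<Rightarrow> 'w" and \<omega>
  assume w: "\<And>i. w i \<in> space M" and \<omega>: "\<omega> \<in> space M"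
    and n: "(\<lambda>i. noise_norm (w i)) \<longlonglongrightarrow> noise_norm \<omega>"
    and \<eta>: "(\<lambda>i. H_norm (- s) (\<lambda>k. \<xi> (w i) k - \<xi> \<omega> k)) \<longlonglongrightarrow> 0"
  let ?\<eta> = "\<lambda>i. H_norm (- s) (\<lambda>k. \<xi> (w i) k - \<xi> \<omega> k)"
  let ?e = "\<lambda>\<omega>. err (U \<omega>)"
  let ?v = "\<lambda>i x. U (w i) x - U \<omega> x"
  have U: "U \<omega> \<in> X" if "\<omega> \<in> space M" for \<omega> using sol[OF that] by (simp add: solution_def)
  have eX: "?e \<omega> \<in> X" if "\<omega> \<in> space M" for \<omega> by (rule X_diff[OF U[OF that] u_dag])
  have vX: "?v i \<in> X" for i by (rule X_diff[OF U[OF w] U[OF \<omega>]])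
  have finw: "H_finite (- s) (\<lambda>k. \<xi> (w i) k - \<xi> \<omega> k)" for i
  proof (rule H_norm_leI(1))
    fix F :: "(int ^ 'd) set" assume F: "finite F"
    have "(\<Sum>k\<in>F. japanese_bracket k powr (2 * - s) * (cmod (\<xi> (w i) k - \<xi> \<omega> k))\<^sup>2) \<le>
      (\<Sum>k\<in>F. 2 * (japanese_bracket k powr (2 * - s) * (cmod (\<xi> (w i) k))\<^sup>2) + 2 * (japanese_bracket k powr (2 * - s) * (cmod (\<xi> \<omega> k))\<^sup>2))"
    proof (rule sum_mono)
      fix k
      have "\<bar>cmod (\<xi> (w i) k - \<xi> \<omega> k)\<bar> \<le> cmod (\<xi> (w i) k) + cmod (\<xi> \<omega> k)" using norm_triangle_ineq4[of "\<xi> (w i) k" "\<xi> \<omega> k"] by simp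
      from mult_left_mono[OF square_le_two_squares[OF this], of "japanese_bracket k powr (2 * - s)"]
      show "japanese_bracket k powr (2 * - s) * (cmod (\<xi> (w i) k - \<xi> \<omega> k))\<^sup>2 \<le> 2 * (japanese_bracket k powr (2 * - s) * (cmod (\<xi> (w i) k))\<^sup>2) + 2 * (japanese_bracket k powr (2 * - s) * (cmod (\<xi> \<omega> k))\<^sup>2)"
        by (simp add: distrib_left mult_ac)
    qed
    also have "\<dots> \<le> 2 * (H_norm (- s) (\<xi> (w i)))\<^sup>2 + 2 * (H_norm (- s) (\<xi> \<omega>))\<^sup>2"
      using H_sum_le[OF \<xi>_finite[OF w] F, of i] H_sum_le[OF \<xi>_finite[OF \<omega>] F]
      by (simp add: sum.distrib sum_distrib_left[symmetric])
    finally show "(\<Sum>k\<in>F. japanese_bracket k powr (2 * - s) * (cmod (\<xi> (w i) k - \<xi> \<omega> k))\<^sup>2) \<le>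
      (sqrt (2 * (H_norm (- s) (\<xi> (w i)))\<^sup>2 + 2 * (H_norm (- s) (\<xi> \<omega>))\<^sup>2))\<^sup>2" by simp
  qed simp
  define \<Theta> where "\<Theta> = (\<delta>\<^sup>2 / a) * (\<delta> / a) powr \<gamma>"
  have \<Theta>: "0 \<le> \<Theta>" using a by (simp add: \<Theta>_def)
  have Te: "TV (?e \<omega>) \<le> TV_majorant \<Theta> \<omega>" if "\<omega> \<in> space M" for \<omega>
    by (rule TV_err_le[OF sol[OF that] that \<delta> a]) (simp add: \<Theta>_def)
  have "(\<lambda>i. TV_majorant \<Theta> (w i)) \<longlonglongrightarrow> TV_majorant \<Theta> \<omega>"
    unfolding TV_majorant_def by (intro tendsto_intros n)
  then have "Bseq (\<lambda>i. TV_majorant \<Theta> (w i))" by (intro convergent_imp_Bseq convergentI)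
  then obtain T0 where T0: "\<And>i. \<bar>TV_majorant \<Theta> (w i)\<bar> \<le> T0" by (auto simp: Bseq_def)
  have T00: "0 \<le> T0" using T0[of 0] by linarith
  define T where "T = T0 + TV_majorant \<Theta> \<omega>"
  have T: "0 \<le> T" unfolding T_def using T00 TV_majorant_nonneg[OF \<Theta>] by simp
  have Tew: "TV (?e (w i)) \<le> T" for i
    using Te[OF w, of i] T0[of i] TV_majorant_nonneg[OF \<Theta>, of \<omega>] unfolding T_def by linarith
  have Tv: "TV (?v i) \<le> T" for i
  proof -
    have "?v i = (\<lambda>x. ?e (w i) x - ?e \<omega> x)" by (rule ext) simp
    then have "TV (?v i) \<le> TV (?e (w i)) + TV (?e \<omega>)" using TV_diff[OF eX[OF w] eX[OF \<omega>], of i] by simp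
    then show ?thesis using Te[OF w, of i] Te[OF \<omega>] T0[of i] unfolding T_def by linarith
  qed
  have \<eta>0: "0 \<le> ?\<eta> i" for i by (rule H_norm_nonneg)
  have Kv: "(\<lambda>i. L2_norm (K (?v i))) \<longlonglongrightarrow> 0"
  proof -
    have bd: "(L2_norm (K (?v i)))\<^sup>2 \<le> (\<delta> * ?\<eta> i)\<^sup>2 + 2 * (\<delta> * B * T * ?\<eta> i)" for i
    proof (rule quadratic_bound)
      have "(L2_norm (K (?v i)))\<^sup>2 \<le> (\<delta> * ?\<eta> i) * L2_norm (K (?v i)) + \<delta> * B * TV (?v i) * ?\<eta> i"
        by (rule stability[OF sol[OF w] sol[OF \<omega>] w \<omega> \<delta> a finw])
      also have "\<delta> * B * TV (?v i) * ?\<eta> i \<le> \<delta> * B * T * ?\<eta> i"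
        using \<delta> B_pos by (intro mult_right_mono mult_left_mono Tv \<eta>0) auto
      finally show "(L2_norm (K (?v i)))\<^sup>2 \<le> (\<delta> * ?\<eta> i) * L2_norm (K (?v i)) + \<delta> * B * T * ?\<eta> i" by simp
    qed
    have "(\<lambda>i. (\<delta> * ?\<eta> i)\<^sup>2 + 2 * (\<delta> * B * T * ?\<eta> i)) \<longlonglongrightarrow> (\<delta> * 0)\<^sup>2 + 2 * (\<delta> * B * T * 0)"
      by (intro tendsto_intros \<eta>)
    then have lim: "(\<lambda>i. (\<delta> * ?\<eta> i)\<^sup>2 + 2 * (\<delta> * B * T * ?\<eta> i)) \<longlonglongrightarrow> 0" by simp
    have "(\<lambda>i. (L2_norm (K (?v i)))\<^sup>2) \<longlonglongrightarrow> 0"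
      by (rule tendsto_sandwich[OF _ _ tendsto_const lim]) (intro always_eventually allI zero_le_power2, intro always_eventually allI bd)
    then have "(\<lambda>i. sqrt ((L2_norm (K (?v i)))\<^sup>2)) \<longlonglongrightarrow> sqrt 0" by (rule tendsto_real_sqrt)
    then show ?thesis by (simp add: L2_norm_nonneg)
  qed
  have small: "(\<lambda>i. F (?v i)) \<longlonglongrightarrow> 0"
    if F: "\<And>e. 0 < e \<Longrightarrow> \<exists>A\<ge>0. \<forall>v\<in>X. \<bar>F v\<bar> \<le> A * L2_norm (K v) + e * TV v" for F
  proof (rule tendsto_0_two_parameter[OF _ Kv T])
    fix e :: real assume e: "0 < e"
    obtain A where A: "0 \<le> A" "\<And>v. v \<in> X \<Longrightarrow> \<bar>F v\<bar> \<le> A * L2_norm (K v) + e * TV v" using F[OF e] by blast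
    have "\<bar>F (?v i)\<bar> \<le> A * L2_norm (K (?v i)) + e * T" for i
      using A(2)[OF vX, of i] mult_left_mono[OF Tv[of i], of e] e by linarith
    then show "\<exists>A\<ge>0. \<forall>i. \<bar>F (?v i)\<bar> \<le> A * L2_norm (K (?v i)) + e * T" using A(1) by blast
  qed
  have mu: "(\<lambda>i. \<mu>_dag (?v i)) \<longlonglongrightarrow> 0" by (rule small[OF src])
  have p: "(\<lambda>i. pairing (KH (?v i)) (\<xi> \<omega>)) \<longlonglongrightarrow> 0"
  proof (rule small)
    fix e :: real assume e: "0 < e"
    \<comment> \<open>so large that the high-frequency part is at most \<open>e * TV v\<close>\<close>
    define m where "m = ((B * noise_norm \<omega> + 1) / e) powr (1 / (t - s))"
    have nn: "0 \<le> noise_norm \<omega>" by (simp add: noise_norm_def H_norm_nonneg)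
    have h: "0 < (B * noise_norm \<omega> + 1) / e" using B_pos nn e by (intro divide_pos_pos add_nonneg_pos) auto
    then have m: "0 < m" unfolding m_def powr_gt_zero by linarith
    have "1 / (t - s) * (s - t) = - 1" using st by (simp add: field_simps)
    then have "m powr (s - t) = ((B * noise_norm \<omega> + 1) / e) powr (- 1)" by (simp only: m_def powr_powr)
    moreover have "0 < B * noise_norm \<omega> + 1" using B_pos nn by (intro add_nonneg_pos) auto
    ultimately have ms: "m powr (s - t) = e / (B * noise_norm \<omega> + 1)"
      using h e by (simp add: powr_minus_divide)
    have "B * m powr (s - t) * noise_norm \<omega> = e / (B * noise_norm \<omega> + 1) * (B * noise_norm \<omega>)"
      unfolding ms by (simp add: mult_ac)
    also have "\<dots> \<le> e" using scaled_fraction_less[of "B * noise_norm \<omega>" e] B_pos nn e by simp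
    finally have le: "B * m powr (s - t) * noise_norm \<omega> \<le> e" .
    have "\<bar>pairing (KH v) (\<xi> \<omega>)\<bar> \<le> m powr s * noise_norm \<omega> * L2_norm (K v) + e * TV v" if v: "v \<in> X" for v
    proof -
      have "\<bar>pairing (KH v) (\<xi> \<omega>)\<bar> \<le> (m powr s * L2_norm (K v) + B * m powr (s - t) * TV v) * noise_norm \<omega>"
        unfolding noise_norm_def by (rule pairing_KH_le[OF v \<xi>_finite[OF \<omega>] m])
      also have "\<dots> = m powr s * noise_norm \<omega> * L2_norm (K v) + B * m powr (s - t) * noise_norm \<omega> * TV v"
        by (simp add: algebra_simps)
      also have "B * m powr (s - t) * noise_norm \<omega> * TV v \<le> e * TV v" by (intro mult_right_mono le TV_0 v)
      finally show ?thesis by simp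
    qed
    then show "\<exists>A\<ge>0. \<forall>v\<in>X. \<bar>pairing (KH v) (\<xi> \<omega>)\<bar> \<le> A * L2_norm (K v) + e * TV v"
      using nn by (intro exI[of _ "m powr s * noise_norm \<omega>"]) auto
  qed
  have D: "sym_bregman (q \<omega>) \<mu>_dag (U \<omega>) u_dag = (\<delta> * pairing (KH (?e \<omega>)) (\<xi> \<omega>) - (L2_norm (K (?e \<omega>)))\<^sup>2) / a - \<mu>_dag (?e \<omega>)"
    if "\<omega> \<in> space M" for \<omega>
    using energy_identity[OF sol[OF that] that] a by (simp add: sym_bregman_def field_simps)
  have mu_dual: "\<mu>_dag \<in> dual_space X" by (rule subdiff_dual[OF mu_dag])
  have "\<mu>_dag (?e (w i)) = \<mu>_dag (?e \<omega>) + \<mu>_dag (?v i)" for i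
    using dual_diff[OF mu_dual U[OF w] u_dag, of i] dual_diff[OF mu_dual U[OF \<omega>] u_dag] dual_diff[OF mu_dual U[OF w] U[OF \<omega>], of i] by simp
  then have lim_mu: "(\<lambda>i. \<mu>_dag (?e (w i))) \<longlonglongrightarrow> \<mu>_dag (?e \<omega>)"
    using tendsto_add[OF tendsto_const[of "\<mu>_dag (?e \<omega>)"] mu] by simp
  have lim_p: "(\<lambda>i. pairing (KH (?e (w i))) (\<xi> (w i))) \<longlonglongrightarrow> pairing (KH (?e \<omega>)) (\<xi> \<omega>)"
  proof -
    have eq: "pairing (KH (?e (w i))) (\<xi> (w i)) = pairing (KH (?e (w i))) (\<lambda>k. \<xi> (w i) k - \<xi> \<omega> k) + (pairing (KH (?v i)) (\<xi> \<omega>) + pairing (KH (?e \<omega>)) (\<xi> \<omega>))" for i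
    proof -
      note fe = KH_s[OF XL[OF eX[OF w]], of i]
      have "(\<Sum>\<^sub>\<infinity>k. KH (?e (w i)) k * cnj (\<xi> (w i) k)) = (\<Sum>\<^sub>\<infinity>k. KH (?e (w i)) k * cnj (\<xi> (w i) k - \<xi> \<omega> k) + KH (?e (w i)) k * cnj (\<xi> \<omega> k))"
        by (intro infsum_cong) (simp add: algebra_simps)
      also have "\<dots> = (\<Sum>\<^sub>\<infinity>k. KH (?e (w i)) k * cnj (\<xi> (w i) k - \<xi> \<omega> k)) + (\<Sum>\<^sub>\<infinity>k. KH (?e (w i)) k * cnj (\<xi> \<omega> k))"
        by (rule infsum_add[OF H_pairing(2)[OF fe finw] H_pairing(2)[OF fe \<xi>_finite[OF \<omega>]]])
      finally have "pairing (KH (?e (w i))) (\<xi> (w i)) = pairing (KH (?e (w i))) (\<lambda>k. \<xi> (w i) k - \<xi> \<omega> k) + pairing (KH (?e (w i))) (\<xi> \<omega>)"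
        by (simp add: pairing_def)
      moreover have "KH (?e (w i)) = (\<lambda>k. KH (?v i) k + KH (?e \<omega>) k)"
      proof -
        have "?e (w i) = (\<lambda>x. ?v i x + ?e \<omega> x)" by (rule ext) simp
        then have "KH (?e (w i)) = KH (\<lambda>x. ?v i x + ?e \<omega> x)" by (rule arg_cong)
        also have "\<dots> = (\<lambda>k. KH (?v i) k + KH (?e \<omega>) k)" by (rule KH_add[OF XL[OF vX] XL[OF eX[OF \<omega>]]])
        finally show ?thesis .
      qed
      then have "pairing (KH (?e (w i))) (\<xi> \<omega>) = pairing (KH (?v i)) (\<xi> \<omega>) + pairing (KH (?e \<omega>)) (\<xi> \<omega>)"
        using pairing_add[OF KH_s[OF XL[OF vX]] KH_s[OF XL[OF eX[OF \<omega>]]] \<omega>, of i] by simp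
      ultimately show ?thesis by simp
    qed
    have "(\<lambda>i. pairing (KH (?e (w i))) (\<lambda>k. \<xi> (w i) k - \<xi> \<omega> k)) \<longlonglongrightarrow> 0"
    proof (rule Lim_null_comparison[OF always_eventually[OF allI]])
      fix i
      have "\<bar>pairing (KH (?e (w i))) (\<lambda>k. \<xi> (w i) k - \<xi> \<omega> k)\<bar> \<le> H_norm s (KH (?e (w i))) * ?\<eta> i"
        by (rule pairing_abs_le[OF KH_s[OF XL[OF eX[OF w]]] finw])
      also have "H_norm s (KH (?e (w i))) \<le> B * T"
      proof -
        have "H_norm s (KH (?e (w i))) \<le> H_norm t (KH (?e (w i)))"
          using H_mono(2)[OF KH_finite[OF XL[OF eX[OF w]]], of s i] st by simp
        also have "\<dots> \<le> B * TV (?e (w i))" by (rule KH_TV[OF eX[OF w]])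
        also have "\<dots> \<le> B * T" using B_pos by (intro mult_left_mono Tew) auto
        finally show ?thesis .
      qed
      then have "H_norm s (KH (?e (w i))) * ?\<eta> i \<le> B * T * ?\<eta> i" by (rule mult_right_mono[OF _ \<eta>0])
      finally show "norm (pairing (KH (?e (w i))) (\<lambda>k. \<xi> (w i) k - \<xi> \<omega> k)) \<le> B * T * ?\<eta> i" by simp
    qed (rule tendsto_mult_right_zero[OF \<eta>])
    from tendsto_add[OF this tendsto_add[OF p tendsto_const[of "pairing (KH (?e \<omega>)) (\<xi> \<omega>)"]]]
    show ?thesis unfolding eq by simp
  qed
  have lim_x: "(\<lambda>i. (L2_norm (K (?e (w i))))\<^sup>2) \<longlonglongrightarrow> (L2_norm (K (?e \<omega>)))\<^sup>2"
  proof -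
    have "\<bar>(L2_norm (K (?e (w i))))\<^sup>2 - (L2_norm (K (?e \<omega>)))\<^sup>2\<bar> \<le> (2 * (B * T)) * L2_norm (K (?v i))" for i
    proof -
      have KL: "K (?e (w i)) \<in> L2" "K (?e \<omega>) \<in> L2" "K (?v i) \<in> L2"
        using K_L2 XL eX w \<omega> vX by blast+
      have "?v i = (\<lambda>x. ?e (w i) x - ?e \<omega> x)" by (rule ext) simp
      then have "K (?v i) = K (\<lambda>x. ?e (w i) x - ?e \<omega> x)" by (rule arg_cong)
      then have d: "L2_inner (K (?v i)) z = L2_inner (K (?e (w i))) z - L2_inner (K (?e \<omega>)) z" if "z \<in> L2" for z
        using K_diff[OF XL[OF eX[OF w]] XL[OF eX[OF \<omega>]] that, of i] by simp
      have "(L2_norm (K (?e (w i))))\<^sup>2 - (L2_norm (K (?e \<omega>)))\<^sup>2 = L2_inner (K (?v i)) (K (?e (w i))) + L2_inner (K (?v i)) (K (?e \<omega>))"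
        unfolding d[OF KL(1)] d[OF KL(2)] L2_norm_sq by (simp add: L2_inner_commute[of "K (?e \<omega>)" "K (?e (w i))"])
      then have "\<bar>(L2_norm (K (?e (w i))))\<^sup>2 - (L2_norm (K (?e \<omega>)))\<^sup>2\<bar> \<le> L2_norm (K (?v i)) * L2_norm (K (?e (w i))) + L2_norm (K (?v i)) * L2_norm (K (?e \<omega>))"
        using L2_Cauchy_Schwarz[OF KL(3,1)] L2_Cauchy_Schwarz[OF KL(3,2)] by linarith
      also have "\<dots> \<le> L2_norm (K (?v i)) * (B * T) + L2_norm (K (?v i)) * (B * T)"
      proof (intro add_mono mult_left_mono L2_norm_nonneg)
        show "L2_norm (K (?e (w i))) \<le> B * T"
          using L2K_TV[OF eX[OF w], of i] mult_left_mono[OF Tew[of i], of B] B_pos by linarith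
        have "TV (?e \<omega>) \<le> T" using Te[OF \<omega>] T00 by (simp add: T_def)
        then show "L2_norm (K (?e \<omega>)) \<le> B * T"
          using L2K_TV[OF eX[OF \<omega>]] mult_left_mono[of "TV (?e \<omega>)" T B] B_pos by linarith
      qed
      finally show ?thesis by (simp add: mult_ac)
    qed
    then have "(\<lambda>i. (L2_norm (K (?e (w i))))\<^sup>2 - (L2_norm (K (?e \<omega>)))\<^sup>2) \<longlonglongrightarrow> 0"
      by (intro Lim_null_comparison[OF always_eventually[OF allI] tendsto_mult_right_zero[OF Kv]]) (simp only: real_norm_def)
    then show ?thesis by (simp add: LIM_zero_iff)
  qed
  show "(\<lambda>i. sym_bregman (q (w i)) \<mu>_dag (U (w i)) u_dag) \<longlonglongrightarrow> sym_bregman (q \<omega>) \<mu>_dag (U \<omega>) u_dag"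
    unfolding D[OF w] D[OF \<omega>] using a by (intro tendsto_intros lim_p lim_mu lim_x) auto
qed

text \<open>
  Young's inequality splits \<open>x\<^sup>2\<close> evenly between the low-frequency noise and the source element. The parameter \<open>\<tau>\<close>
  balances \<open>G\<close> against \<open>T\<close>, which are dependent random variables.
\<close>

lemma bregman_le:
  assumes sol: "solution \<delta> a \<omega> u q" and \<omega>: "\<omega> \<in> space M" and \<delta>: "0 < \<delta>" and a: "0 < a"
    and \<Theta>: "(\<delta>\<^sup>2 / a) * (\<delta> / a) powr \<gamma> \<le> \<Theta>"
    and src: "\<And>v. v \<in> X \<Longrightarrow> \<bar>\<mu>_dag v\<bar> \<le> W * L2_norm (K v) + \<beta> * TV v" and \<beta>: "0 \<le> \<beta>"
    and m: "0 < m" and G: "\<And>e. e \<in> X \<Longrightarrow> high_freq m \<omega> e \<le> g * TV e" "0 \<le> g" and \<tau>: "0 < \<tau>"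
  shows "sym_bregman q \<mu>_dag u u_dag \<le> \<delta>\<^sup>2 / (2 * a) * (low_norm m (\<xi> \<omega>))\<^sup>2
    + \<delta> / (2 * a) * (g\<^sup>2 / \<tau> + \<tau> * (TV_majorant \<Theta> \<omega>)\<^sup>2) + a * W\<^sup>2 / 2 + \<beta> * (1 + (TV_majorant \<Theta> \<omega>)\<^sup>2)"
proof -
  have u: "u \<in> X" using sol by (simp add: solution_def)
  have e: "err u \<in> X" by (rule X_diff[OF u u_dag])
  let ?T = "TV_majorant \<Theta> \<omega>" and ?x = "L2_norm (K (err u))" and ?l = "low_norm m (\<xi> \<omega>)"
  have T: "TV (err u) \<le> ?T" by (rule TV_err_le[OF sol \<omega> \<delta> a \<Theta>])
  have p: "pairing (KH (err u)) (\<xi> \<omega>) \<le> ?x * ?l + g * ?T"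
  proof -
    have "pairing (KH (err u)) (\<xi> \<omega>) \<le> H_norm 0 (KH (err u)) * ?l + pairing (cut_above m (KH (err u))) (\<xi> \<omega>)"
      using H_mono(1)[OF KH_finite[OF XL[OF e]], of 0] st s_pos
      by (intro pairing_split[OF KH_s[OF XL[OF e]] \<xi>_finite[OF \<omega>]]) auto
    also have "pairing (cut_above m (KH (err u))) (\<xi> \<omega>) \<le> g * TV (err u)"
      using G(1)[OF e] by (simp add: high_freq_def)
    also have "g * TV (err u) \<le> g * ?T" by (intro mult_left_mono T G(2))
    finally show ?thesis by (simp add: L2K[OF e])
  qed
  have young: "y * z \<le> y\<^sup>2 / 2 + z\<^sup>2 / 2" for y z :: real
    using sum_squares_bound[of y z] by simp
  have "a * sym_bregman q \<mu>_dag u u_dag = \<delta> * pairing (KH (err u)) (\<xi> \<omega>) - ?x\<^sup>2 - a * \<mu>_dag (err u)"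
    using energy_identity[OF sol \<omega>] by (simp add: sym_bregman_def right_diff_distrib)
  also have "\<dots> \<le> \<delta> * (?x * ?l + g * ?T) - ?x\<^sup>2 + a * (W * ?x + \<beta> * ?T)"
  proof -
    have "- \<mu>_dag (err u) \<le> W * ?x + \<beta> * TV (err u)" using src[OF e] by linarith
    also have "\<beta> * TV (err u) \<le> \<beta> * ?T" by (intro mult_left_mono T \<beta>)
    finally have "a * (- \<mu>_dag (err u)) \<le> a * (W * ?x + \<beta> * ?T)" using a by (intro mult_left_mono) auto
    moreover have "\<delta> * pairing (KH (err u)) (\<xi> \<omega>) \<le> \<delta> * (?x * ?l + g * ?T)" using p \<delta> by (intro mult_left_mono) auto
    ultimately show ?thesis by linarith
  qed
  also have "\<dots> = ?x * (\<delta> * ?l) + ?x * (a * W) - ?x\<^sup>2 + \<delta> * (g * ?T) + a * (\<beta> * ?T)"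
    by (simp add: algebra_simps)
  also have "\<dots> \<le> (\<delta> * ?l)\<^sup>2 / 2 + (a * W)\<^sup>2 / 2 + \<delta> * (g * ?T) + a * (\<beta> * ?T)"
    using young[of ?x "\<delta> * ?l"] young[of ?x "a * W"] by linarith
  also have "\<dots> \<le> (\<delta> * ?l)\<^sup>2 / 2 + (a * W)\<^sup>2 / 2 + \<delta> * ((g\<^sup>2 / \<tau> + \<tau> * ?T\<^sup>2) / 2) + a * (\<beta> * (1 + ?T\<^sup>2))"
  proof -
    have "g * ?T = (g / sqrt \<tau>) * (sqrt \<tau> * ?T)" using \<tau> by simp
    also have "\<dots> \<le> (g / sqrt \<tau>)\<^sup>2 / 2 + (sqrt \<tau> * ?T)\<^sup>2 / 2" by (rule young)
    also have "\<dots> = (g\<^sup>2 / \<tau> + \<tau> * ?T\<^sup>2) / 2" using \<tau> by (simp add: power_divide power_mult_distrib add_divide_distrib)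
    finally have 1: "\<delta> * (g * ?T) \<le> \<delta> * ((g\<^sup>2 / \<tau> + \<tau> * ?T\<^sup>2) / 2)" using \<delta> by (intro mult_left_mono) auto
    have "?T \<le> 1 / 2 + ?T\<^sup>2 / 2" using young[of 1 ?T] by simp
    then have "?T \<le> 1 + ?T\<^sup>2" using zero_le_power2[of ?T] by linarith
    then have "a * (\<beta> * ?T) \<le> a * (\<beta> * (1 + ?T\<^sup>2))" using a \<beta> by (intro mult_left_mono) auto
    with 1 show ?thesis by linarith
  qed
  finally have "sym_bregman q \<mu>_dag u u_dag \<le> ((\<delta> * ?l)\<^sup>2 / 2 + (a * W)\<^sup>2 / 2 + \<delta> * ((g\<^sup>2 / \<tau> + \<tau> * ?T\<^sup>2) / 2) + a * (\<beta> * (1 + ?T\<^sup>2))) / a"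
    using a by (simp add: pos_le_divide_eq mult.commute)
  also have "\<dots> = \<delta>\<^sup>2 / (2 * a) * ?l\<^sup>2 + \<delta> / (2 * a) * (g\<^sup>2 / \<tau> + \<tau> * ?T\<^sup>2) + a * W\<^sup>2 / 2 + \<beta> * (1 + ?T\<^sup>2)"
  proof -
    have "((\<delta> * l)\<^sup>2 / 2 + (a * w)\<^sup>2 / 2 + \<delta> * (Z / 2) + a * y) / a = \<delta>\<^sup>2 / (2 * a) * l\<^sup>2 + \<delta> / (2 * a) * Z + a * w\<^sup>2 / 2 + y" for l w Z y
      using a by (simp add: field_simps power2_eq_square)
    then show ?thesis .
  qed
  finally show ?thesis .
qed

end

section \<open>The convergence rate\<close>

lemma powr_le_of_exponent_ge: "0 < \<delta> \<Longrightarrow> \<delta> < 1 \<Longrightarrow> x \<le> y \<Longrightarrow> \<delta> powr y \<le> \<delta> powr (x::real)"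
  by (intro powr_mono') auto

lemma eventually_powr_less:
  assumes "0 < (\<rho>::real)" "0 < b" shows "\<forall>\<^sub>F \<delta> in at_right 0. \<delta> powr \<rho> < b"
proof -
  have "((\<lambda>\<delta>. \<delta> powr \<rho>) \<longlongrightarrow> 0) (at_right 0)" using assms(1) by real_asymp
  then show ?thesis by (rule order_tendstoD(2)) (rule assms(2))
qed

context tv_problem
begin

text \<open>
  The condition on \<open>\<kappa>\<close> says that \<open>\<alpha>\<close> does not decay faster than the noise permits: then the factor in the bound for
  \<open>TV\<close> stays bounded as \<open>\<delta>\<close> tends to zero.
\<close>

lemma majorant_scale:
  assumes \<delta>: "0 < \<delta>" "\<delta> < 1" and c1: "0 < c1" and a: "c1 * \<delta> powr \<kappa> \<le> a" and \<kappa>: "\<kappa> \<le> 2 * t / (t + s)"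
  shows "(\<delta>\<^sup>2 / a) * (\<delta> / a) powr \<gamma> \<le> c1 powr (- (1 + \<gamma>))"
proof -
  have a0: "0 < c1 * \<delta> powr \<kappa>" using \<delta> c1 by simp
  then have apos: "0 < a" using a by linarith
  have g: "0 \<le> \<gamma>" by (rule \<gamma>_nonneg)
  have "(\<delta>\<^sup>2 / a) * (\<delta> / a) powr \<gamma> = \<delta> powr (2 + \<gamma>) * a powr (- (1 + \<gamma>))"
  proof -
    have 1: "a powr (- (1 + \<gamma>)) = 1 / (a * a powr \<gamma>)"
      unfolding powr_minus_divide powr_add using apos by simp
    have 2: "\<delta> powr (2 + \<gamma>) = \<delta>\<^sup>2 * \<delta> powr \<gamma>"
      unfolding powr_add using \<delta> by simp
    show ?thesis unfolding 1 2 using \<delta> apos by (simp add: powr_divide)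
  qed
  also have "\<dots> \<le> \<delta> powr (2 + \<gamma>) * (c1 * \<delta> powr \<kappa>) powr (- (1 + \<gamma>))"
    using a a0 g by (intro mult_left_mono powr_mono2') auto
  also have "(c1 * \<delta> powr \<kappa>) powr (- (1 + \<gamma>)) = c1 powr (- (1 + \<gamma>)) * \<delta> powr (- \<kappa> * (1 + \<gamma>))"
  proof -
    have "(c1 * \<delta> powr \<kappa>) powr (- (1 + \<gamma>)) = c1 powr (- (1 + \<gamma>)) * (\<delta> powr \<kappa>) powr (- (1 + \<gamma>))"
      by (rule powr_mult)
    then show ?thesis by (simp only: powr_powr mult_minus_left mult_minus_right)
  qed
  also have "\<delta> powr (2 + \<gamma>) * (c1 powr (- (1 + \<gamma>)) * \<delta> powr (- \<kappa> * (1 + \<gamma>))) = c1 powr (- (1 + \<gamma>)) * \<delta> powr (2 + \<gamma> - \<kappa> * (1 + \<gamma>))"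
    by (simp add: powr_diff powr_minus divide_simps mult_ac)
  also have "\<dots> \<le> c1 powr (- (1 + \<gamma>)) * \<delta> powr 0"
  proof (intro mult_left_mono powr_le_of_exponent_ge \<delta>)
    have "\<kappa> * (1 + \<gamma>) \<le> 2 * t / (t + s) * (1 + \<gamma>)" using \<kappa> g by (intro mult_right_mono) auto
    also have "\<dots> = 2 + \<gamma>"
    proof -
      have 1: "1 + \<gamma> = (t + s) / (t - s)" and 2: "2 + \<gamma> = 2 * t / (t - s)"
        using st by (auto simp: \<gamma>_def field_simps)
      show ?thesis unfolding 1 2 using st s_pos by simp
    qed
    finally show "0 \<le> 2 + \<gamma> - \<kappa> * (1 + \<gamma>)" by simp
  qed simp
  finally show ?thesis using \<delta> by simp
qed

text \<open>
  With \<open>\<kappa> = (1 + r1) * \<rho>\<close> and \<open>\<beta> = \<delta> powr \<rho>\<close> both source terms have order \<open>\<delta> powr \<rho>\<close>. The noise terms have order at most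
  \<open>\<delta> powr ((2 * t + d + b) / (t + d) - \<kappa>)\<close> with an arbitrarily small loss \<open>b < 0\<close>, and the assumption \<open>gap\<close> leaves room for such a loss.
\<close>

theorem expected_rate:
  fixes \<alpha> :: "real \<Rightarrow> real" and d :: real
  assumes d: "d = real CARD('d)"
    and r1: "0 \<le> r1" and \<rho>: "0 < \<rho>" and \<kappa>: "\<kappa> = (1 + r1) * \<rho>" "\<kappa> \<le> 2 * t / (t + s)"
    and gap: "(2 + r1) * \<rho> * (t + d) < 2 * t + d"
    and \<alpha>: "0 < c1" "\<forall>\<^sub>F \<delta> in at_right 0. c1 * \<delta> powr \<kappa> \<le> \<alpha> \<delta> \<and> \<alpha> \<delta> \<le> c2 * \<delta> powr \<kappa>"
    and sol: "\<And>\<delta> \<omega>. 0 < \<delta> \<Longrightarrow> \<omega> \<in> space M \<Longrightarrow> solution \<delta> (\<alpha> \<delta>) \<omega> (U \<delta> \<omega>) (q \<delta> \<omega>)"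
    and src: "0 \<le> Cs" "0 < \<beta>0" "\<And>\<beta>. 0 < \<beta> \<Longrightarrow> \<beta> < \<beta>0 \<Longrightarrow> \<exists>W\<ge>0. W\<^sup>2 \<le> Cs * \<beta> powr (- r1) \<and> (\<forall>u\<in>X. \<bar>\<mu>_dag u\<bar> \<le> W * L2_norm (K u) + \<beta> * TV u)"
  shows "\<exists>C. \<forall>\<^sub>F \<delta> in at_right 0. integrable M (\<lambda>\<omega>. sym_bregman (q \<delta> \<omega>) \<mu>_dag (U \<delta> \<omega>) u_dag) \<and>
      0 \<le> (\<integral>\<omega>. sym_bregman (q \<delta> \<omega>) \<mu>_dag (U \<delta> \<omega>) u_dag \<partial>M) \<and>
      (\<integral>\<omega>. sym_bregman (q \<delta> \<omega>) \<mu>_dag (U \<delta> \<omega>) u_dag \<partial>M) \<le> C * \<delta> powr \<rho>"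
proof -
  have t0: "0 < t" using st s_pos by linarith
  have d0: "0 < d" using d by simp
  have td: "0 < t + d" using t0 d0 by simp
  \<comment> \<open>the largest admissible loss; the minimum with \<open>t\<close> keeps \<open>b + t\<close> nonnegative\<close>
  define b where "b = - min t (2 * t + d - (2 + r1) * \<rho> * (t + d))"
  have b: "b < 0" "0 \<le> b + t" "(2 + r1) * \<rho> * (t + d) \<le> 2 * t + d + b"
    using t0 gap by (auto simp: b_def min_def)
  have k\<rho>: "\<kappa> + \<rho> = (2 + r1) * \<rho>" using \<kappa>(1) by (simp add: algebra_simps)
  obtain A where A: "0 \<le> A" and HF: "\<And>m. 0 < m \<Longrightarrow> \<exists>G. G \<in> borel_measurable M \<and> (\<forall>\<omega>. 0 \<le> G \<omega>) \<and>
     (\<integral>\<^sup>+\<omega>. ennreal ((G \<omega>)\<^sup>2) \<partial>M) \<le> ennreal (A * (m powr - (b + t))\<^sup>2) \<and>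
     (AE \<omega> in M. \<forall>e\<in>X. high_freq m \<omega> e \<le> G \<omega> * TV e)"
    by (rule high_frequency_bound[OF X_BV c_pos X_embed b(1,2)]) (assumption, rule that)
  define \<Theta> where "\<Theta> = c1 powr (- (1 + \<gamma>))"
  have \<Theta>: "0 \<le> \<Theta>" by (simp add: \<Theta>_def)
  obtain C2 where C2: "0 \<le> C2" "(\<integral>\<^sup>+\<omega>. ennreal ((TV_majorant \<Theta> \<omega>)\<^sup>2) \<partial>M) \<le> ennreal C2"
    by (rule TV_majorant_moment[OF \<Theta>])
  define C1 where "C1 = 4 * gauss_moment 1 * 3 ^ CARD('d)"
  have C1: "0 \<le> C1" using gauss_moment_pos[of 1] by (simp add: C1_def)
  define C where "C = C1 / (2 * c1) + (A + C2) / (2 * c1) + c2 * Cs / 2 + (1 + C2)"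
  let ?D = "\<lambda>\<delta> \<omega>. sym_bregman (q \<delta> \<omega>) \<mu>_dag (U \<delta> \<omega>) u_dag"
  have src_small: "\<exists>A\<ge>0. \<forall>v\<in>X. \<bar>\<mu>_dag v\<bar> \<le> A * L2_norm (K v) + e * TV v" if e: "0 < e" for e
  proof -
    obtain W where W: "0 \<le> W" "\<And>u. u \<in> X \<Longrightarrow> \<bar>\<mu>_dag u\<bar> \<le> W * L2_norm (K u) + min e (\<beta>0 / 2) * TV u"
    proof -
      have "0 < min e (\<beta>0 / 2)" "min e (\<beta>0 / 2) < \<beta>0" using e src(2) by linarith+
      then show thesis using src(3)[of "min e (\<beta>0 / 2)"] that by blast
    qed
    have "\<bar>\<mu>_dag v\<bar> \<le> W * L2_norm (K v) + e * TV v" if v: "v \<in> X" for v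
      using W(2)[OF v] mult_right_mono[OF _ TV_0[OF v], of "min e (\<beta>0 / 2)" e] by simp
    then show ?thesis using W(1) by blast
  qed
  have "\<forall>\<^sub>F \<delta> in at_right (0::real). 0 < \<delta> \<and> \<delta> < 1"
    by (simp add: eventually_at_right_field) (rule exI[of _ 1], simp)
  moreover have "\<forall>\<^sub>F \<delta> in at_right 0. \<delta> powr \<rho> < \<beta>0" by (rule eventually_powr_less[OF \<rho> src(2)])
  ultimately have "\<forall>\<^sub>F \<delta> in at_right 0. integrable M (?D \<delta>) \<and> 0 \<le> (\<integral>\<omega>. ?D \<delta> \<omega> \<partial>M) \<and> (\<integral>\<omega>. ?D \<delta> \<omega> \<partial>M) \<le> C * \<delta> powr \<rho>"
    using \<alpha>(2)
  proof eventually_elim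
    case (elim \<delta>)
    then have \<delta>: "0 < \<delta>" "\<delta> < 1" and \<beta>: "\<delta> powr \<rho> < \<beta>0" and a: "c1 * \<delta> powr \<kappa> \<le> \<alpha> \<delta>" "\<alpha> \<delta> \<le> c2 * \<delta> powr \<kappa>"
      by auto
    let ?a = "\<alpha> \<delta>" and ?\<beta> = "\<delta> powr \<rho>"
    have ca: "0 < c1 * \<delta> powr \<kappa>" using \<delta> \<alpha>(1) by simp
    have a0: "0 < ?a" using ca a(1) by linarith
    \<comment> \<open>balances the low frequencies, \<open>\<delta>\<^sup>2 * m powr d\<close>, with the high ones, \<open>\<delta> * m powr - t\<close>\<close>
    define m where "m = \<delta> powr (- 1 / (t + d))"
    have m: "1 \<le> m"
    proof -
      have "\<delta> powr 0 \<le> \<delta> powr (- 1 / (t + d))" using td by (intro powr_le_of_exponent_ge \<delta>) simp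
      then show ?thesis using \<delta> by (simp add: m_def)
    qed
    then have m0: "0 < m" by linarith
    \<comment> \<open>the size of \<open>G\<close> in quadratic mean\<close>
    define \<tau> where "\<tau> = m powr - (b + t)"
    have \<tau>: "0 < \<tau>" using m0 by (simp add: \<tau>_def)
    obtain W where W: "0 \<le> W" "W\<^sup>2 \<le> Cs * ?\<beta> powr (- r1)" "\<And>u. u \<in> X \<Longrightarrow> \<bar>\<mu>_dag u\<bar> \<le> W * L2_norm (K u) + ?\<beta> * TV u"
      using src(3)[OF _ \<beta>] \<delta> by auto
    obtain G where G: "G \<in> borel_measurable M" "\<And>\<omega>. 0 \<le> G \<omega>" "(\<integral>\<^sup>+\<omega>. ennreal ((G \<omega>)\<^sup>2) \<partial>M) \<le> ennreal (A * \<tau>\<^sup>2)"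
      "AE \<omega> in M. \<forall>e\<in>X. high_freq m \<omega> e \<le> G \<omega> * TV e"
      using HF[OF m0] unfolding \<tau>_def by blast
    note G(1)[measurable]
    have \<Theta>a: "(\<delta>\<^sup>2 / ?a) * (\<delta> / ?a) powr \<gamma> \<le> \<Theta>" unfolding \<Theta>_def by (rule majorant_scale[OF \<delta> \<alpha>(1) a(1) \<kappa>(2)])
    let ?l = "\<lambda>\<omega>. low_norm m (\<xi> \<omega>)" and ?T = "TV_majorant \<Theta>"
    have path: "AE \<omega> in M. ?D \<delta> \<omega> \<le> \<delta>\<^sup>2 / (2 * ?a) * (?l \<omega>)\<^sup>2 + \<delta> / (2 * ?a) * ((G \<omega>)\<^sup>2 / \<tau> + \<tau> * (?T \<omega>)\<^sup>2) + ?a * W\<^sup>2 / 2 + ?\<beta> * (1 + (?T \<omega>)\<^sup>2)"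
      using G(4) AE_space
    proof eventually_elim
      case (elim \<omega>)
      show ?case
        by (rule bregman_le[OF sol[OF \<delta>(1) elim(2)] elim(2) \<delta>(1) a0 \<Theta>a W(3) _ m0 _ G(2) \<tau>]) (use elim(1) in auto)
    qed
    define p1 where "p1 = \<delta>\<^sup>2 / (2 * ?a)"
    define p2 where "p2 = \<delta> / (2 * ?a) / \<tau>"
    define p3 where "p3 = \<delta> / (2 * ?a) * \<tau> + ?\<beta>"
    define p4 where "p4 = ?a * W\<^sup>2 / 2 + ?\<beta>"
    have p: "0 \<le> p1" "0 \<le> p2" "0 \<le> p3" "0 \<le> p4" using \<delta> a0 \<tau> by (auto simp: p1_def p2_def p3_def p4_def)
    have "(\<integral>\<^sup>+\<omega>. ennreal (?D \<delta> \<omega>) \<partial>M) \<le> (\<integral>\<^sup>+\<omega>. ennreal p1 * ennreal ((?l \<omega>)\<^sup>2) + (ennreal p2 * ennreal ((G \<omega>)\<^sup>2) + (ennreal p3 * ennreal ((?T \<omega>)\<^sup>2) + ennreal p4)) \<partial>M)"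
    proof (rule nn_integral_mono_AE, use path in eventually_elim)
      case (elim \<omega>)
      also have "\<delta>\<^sup>2 / (2 * ?a) * (?l \<omega>)\<^sup>2 + \<delta> / (2 * ?a) * ((G \<omega>)\<^sup>2 / \<tau> + \<tau> * (?T \<omega>)\<^sup>2) + ?a * W\<^sup>2 / 2 + ?\<beta> * (1 + (?T \<omega>)\<^sup>2)
        = p1 * (?l \<omega>)\<^sup>2 + (p2 * (G \<omega>)\<^sup>2 + (p3 * (?T \<omega>)\<^sup>2 + p4))"
        by (simp add: p1_def p2_def p3_def p4_def distrib_left distrib_right mult_ac)
      finally have "ennreal (?D \<delta> \<omega>) \<le> ennreal (p1 * (?l \<omega>)\<^sup>2 + (p2 * (G \<omega>)\<^sup>2 + (p3 * (?T \<omega>)\<^sup>2 + p4)))" by (rule ennreal_leI)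
      then show ?case using p by (simp add: ennreal_plus ennreal_mult)
    qed
    also have "\<dots> = ennreal p1 * (\<integral>\<^sup>+\<omega>. ennreal ((?l \<omega>)\<^sup>2) \<partial>M) + (ennreal p2 * (\<integral>\<^sup>+\<omega>. ennreal ((G \<omega>)\<^sup>2) \<partial>M) + (ennreal p3 * (\<integral>\<^sup>+\<omega>. ennreal ((?T \<omega>)\<^sup>2) \<partial>M) + ennreal p4))"
      by (simp add: nn_integral_add nn_integral_cmult emeasure_space_1)
    also have "\<dots> \<le> ennreal p1 * ennreal (C1 * m ^ CARD('d)) + (ennreal p2 * ennreal (A * \<tau>\<^sup>2) + (ennreal p3 * ennreal C2 + ennreal p4))"
    proof (intro add_mono mult_left_mono G(3) C2(2) order_refl)
      show "(\<integral>\<^sup>+\<omega>. ennreal ((?l \<omega>)\<^sup>2) \<partial>M) \<le> ennreal (C1 * m ^ CARD('d))"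
        using low_norm_moment[OF m] by (simp add: C1_def power_mult_distrib mult.assoc)
    qed auto
    also have "\<dots> = ennreal (p1 * (C1 * m ^ CARD('d)) + (p2 * (A * \<tau>\<^sup>2) + (p3 * C2 + p4)))"
      using p A C1 C2(1) m0 by (simp add: ennreal_plus ennreal_mult)
    finally have nn: "(\<integral>\<^sup>+\<omega>. ennreal (?D \<delta> \<omega>) \<partial>M) \<le> ennreal (p1 * (C1 * m ^ CARD('d)) + (p2 * (A * \<tau>\<^sup>2) + (p3 * C2 + p4)))" .
    have inv_a: "1 / ?a \<le> \<delta> powr (- \<kappa>) / c1"
    proof -
      have "1 / ?a \<le> 1 / (c1 * \<delta> powr \<kappa>)" using a(1) ca by (intro divide_left_mono) (auto intro: mult_pos_pos[OF a0])
      then show ?thesis unfolding powr_minus_divide by (simp add: mult.commute)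
    qed
    have b1: "p1 * (C1 * m ^ CARD('d)) \<le> C1 / (2 * c1) * \<delta> powr \<rho>"
    proof -
      have md: "m ^ CARD('d) = \<delta> powr (- d / (t + d))"
        using m0 by (simp add: powr_realpow[symmetric] m_def powr_powr d)
      have "p1 * (C1 * m ^ CARD('d)) = (1 / ?a) * (C1 / 2 * (\<delta> powr 2 * \<delta> powr (- d / (t + d))))"
        using \<delta> by (simp add: p1_def md powr_numeral mult_ac)
      also have "\<dots> \<le> \<delta> powr (- \<kappa>) / c1 * (C1 / 2 * (\<delta> powr 2 * \<delta> powr (- d / (t + d))))"
        using C1 by (intro mult_right_mono inv_a) auto
      also have "\<dots> = C1 / (2 * c1) * \<delta> powr (- \<kappa> + (2 + (- d / (t + d))))"
        by (simp only: powr_add) (simp add: mult_ac)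
      also have "\<dots> \<le> C1 / (2 * c1) * \<delta> powr \<rho>"
      proof (intro mult_left_mono powr_le_of_exponent_ge \<delta>)
        have "(\<kappa> + \<rho>) * (t + d) \<le> 2 * t + d" using gap by (simp add: k\<rho>)
        then have "\<kappa> + \<rho> \<le> (2 * t + d) / (t + d)" using td by (simp add: pos_le_divide_eq)
        also have "(2 * t + d) / (t + d) = 2 + (- d / (t + d))" using td by (simp add: field_simps)
        finally show "\<rho> \<le> - \<kappa> + (2 + (- d / (t + d)))" by linarith
      qed (use C1 \<alpha>(1) in simp)
      finally show ?thesis .
    qed
    have \<tau>b: "\<delta> / (2 * ?a) * \<tau> \<le> 1 / (2 * c1) * \<delta> powr \<rho>"
    proof -
      have \<tau>\<delta>: "\<tau> = \<delta> powr ((b + t) / (t + d))"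
      proof -
        have "- 1 / (t + d) * - (b + t) = (b + t) / (t + d)"
          by (simp only: times_divide_eq_left mult_minus_left mult_minus_right mult_1 minus_minus)
        then show ?thesis by (simp only: \<tau>_def m_def powr_powr)
      qed
      have "\<delta> / (2 * ?a) * \<tau> = (1 / ?a) * (1 / 2 * (\<delta> powr 1 * \<delta> powr ((b + t) / (t + d))))"
        using \<delta> by (simp add: \<tau>\<delta>)
      also have "\<dots> \<le> \<delta> powr (- \<kappa>) / c1 * (1 / 2 * (\<delta> powr 1 * \<delta> powr ((b + t) / (t + d))))"
        by (intro mult_right_mono inv_a) auto
      also have "\<dots> = 1 / (2 * c1) * \<delta> powr (- \<kappa> + (1 + (b + t) / (t + d)))"
        by (simp only: powr_add) (simp add: mult_ac)
      also have "\<dots> \<le> 1 / (2 * c1) * \<delta> powr \<rho>"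
      proof (intro mult_left_mono powr_le_of_exponent_ge \<delta>)
        have "(\<kappa> + \<rho>) * (t + d) \<le> 2 * t + d + b" using b(3) by (simp add: k\<rho>)
        then have "\<kappa> + \<rho> \<le> (2 * t + d + b) / (t + d)" using td by (simp add: pos_le_divide_eq)
        also have "(2 * t + d + b) / (t + d) = 1 + (b + t) / (t + d)" using td by (simp add: field_simps)
        finally show "\<rho> \<le> - \<kappa> + (1 + (b + t) / (t + d))" by linarith
      qed (use \<alpha>(1) in simp)
      finally show ?thesis .
    qed
    have b2: "p2 * (A * \<tau>\<^sup>2) \<le> A / (2 * c1) * \<delta> powr \<rho>"
    proof -
      have "p2 * (A * \<tau>\<^sup>2) = A * (\<delta> / (2 * ?a) * \<tau>)" using \<tau> by (simp add: p2_def power2_eq_square)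
      also have "\<dots> \<le> A * (1 / (2 * c1) * \<delta> powr \<rho>)" by (intro mult_left_mono \<tau>b A)
      finally show ?thesis by simp
    qed
    have b3: "p3 * C2 \<le> C2 / (2 * c1) * \<delta> powr \<rho> + C2 * \<delta> powr \<rho>"
      using mult_right_mono[OF \<tau>b C2(1)] by (simp add: p3_def distrib_right distrib_left mult_ac)
    have b4: "p4 \<le> c2 * Cs / 2 * \<delta> powr \<rho> + \<delta> powr \<rho>"
    proof -
      have "?a * W\<^sup>2 \<le> (c2 * \<delta> powr \<kappa>) * (Cs * ?\<beta> powr (- r1))"
        using a a0 W(2) by (intro mult_mono) auto
      also have "\<dots> = c2 * Cs * \<delta> powr (\<kappa> + \<rho> * (- r1))"
        by (simp only: powr_add powr_powr mult_ac)
      also have "\<kappa> + \<rho> * (- r1) = \<rho>" by (simp add: \<kappa>(1) algebra_simps)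
      finally show ?thesis by (simp add: p4_def)
    qed
    have total: "p1 * (C1 * m ^ CARD('d)) + (p2 * (A * \<tau>\<^sup>2) + (p3 * C2 + p4)) \<le> C * \<delta> powr \<rho>"
      using b1 b2 b3 b4 by (simp add: C_def distrib_right add_divide_distrib)
    have nn2: "(\<integral>\<^sup>+\<omega>. ennreal (?D \<delta> \<omega>) \<partial>M) \<le> ennreal (C * \<delta> powr \<rho>)"
      using nn ennreal_leI[OF total] by (rule order_trans)
    have D0: "0 \<le> ?D \<delta> \<omega>" if "\<omega> \<in> space M" for \<omega> by (rule bregman_nonneg[OF sol[OF \<delta>(1) that]])
    have meas: "?D \<delta> \<in> borel_measurable M"
      by (rule bregman_measurable[OF sol[OF \<delta>(1)] \<delta>(1) a0 src_small])
    have int: "integrable M (?D \<delta>)"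
      by (rule integrableI_nonneg[OF meas AE_I2[OF D0]]) (use nn2 in \<open>auto simp: less_top[symmetric] top_unique\<close>)
    have pos: "0 \<le> (\<integral>\<omega>. ?D \<delta> \<omega> \<partial>M)" by (rule integral_nonneg_AE[OF AE_I2[OF D0]])
    have "0 \<le> C * \<delta> powr \<rho>" using total p A C1 C2(1) m0 by (intro order_trans[OF _ total] add_nonneg_nonneg mult_nonneg_nonneg) auto
    moreover have "ennreal (\<integral>\<omega>. ?D \<delta> \<omega> \<partial>M) \<le> ennreal (C * \<delta> powr \<rho>)"
      by (subst nn_integral_eq_integral[OF int AE_I2[OF D0], symmetric]) (assumption, rule nn2)
    ultimately have "(\<integral>\<omega>. ?D \<delta> \<omega> \<partial>M) \<le> C * \<delta> powr \<rho>" by (simp add: ennreal_le_iff)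
    with int pos show ?case by blast
  qed
  then show ?thesis by blast
qed

end

theorem theorem4p12:
  fixes K Kstar :: "(real ^ 'd \<Rightarrow> real) \<Rightarrow> (real ^ 'd \<Rightarrow> real)"
    and Kext :: "'d distribution \<Rightarrow> 'd distribution"
    and X :: "(real ^ 'd \<Rightarrow> real) set"
    and u_dag :: "real ^ 'd \<Rightarrow> real"
    and \<mu>_dag :: "(real ^ 'd \<Rightarrow> real) \<Rightarrow> real"
    and M :: "'w measure"
    and N :: "'w \<Rightarrow> 'd distribution"
    and \<alpha> :: "real \<Rightarrow> real"
    and U :: "real \<Rightarrow> 'w \<Rightarrow> (real ^ 'd \<Rightarrow> real)"
    and \<mu> :: "real \<Rightarrow> 'w \<Rightarrow> ((real ^ 'd \<Rightarrow> real) \<Rightarrow> real)"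
    and d \<epsilon> t r1 \<nu> \<kappa> :: real
  assumes d_def: "d = real CARD('d)"
    and d_le: "d \<le> 2"
    and eps: "\<epsilon> > 0"
    and t_gt: "t > d / 2 + \<epsilon>"
    and nu_def: "\<nu> = (t - d / 2 - \<epsilon>) / (2 * t)"
    and kappa_def: "\<kappa> = (if r1 \<le> (d + 2 * \<epsilon>) / t then (1 + r1) / ((2 + r1) * (1 - \<nu>)) else 1)"
    and K_pdo: "pseudodifferential (- t) K"
    and K_ext: "extends_L2_operator Kext K"
    and K_bij: "\<And>r. sobolev_bijection r (r + t) Kext"
    and K_adj: "L2_adjoint K Kstar"
    and L_pow: "\<exists>P. L2_power (\<lambda>u. Kstar (K u)) \<nu> P \<and> L2_sobolev_isomorphism (2 * t * \<nu>) P"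
    and X_space: "function_subspace X"
    and X_BV: "X \<subseteq> BV \<inter> L2"
    and X_embed: "\<exists>C>0. \<forall>u\<in>X. C * L2_norm u \<le> TV u"
    and u_dag: "u_dag \<in> X"
    and mu_dag: "\<mu>_dag \<in> TV_subdifferential X u_dag"
    and r1: "r1 \<ge> 0"
    and source: "approx_source_condition X K \<mu>_dag r1"
    and prob: "prob_space M"
    and noise: "white_noise M (- d / 2 - \<epsilon>) N"
    and alpha_pos: "\<And>\<delta>. \<delta> > 0 \<Longrightarrow> \<alpha> \<delta> > 0"
    and alpha_choice: "\<alpha> \<in> \<Theta>[at_right 0](\<lambda>\<delta>. \<delta> powr \<kappa>)"
    and U_min: "\<And>\<delta> \<omega>. \<delta> > 0 \<Longrightarrow> \<omega> \<in> space M \<Longrightarrow>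
                  tikhonov_minimizer X K (\<alpha> \<delta>) (noisy_data K u_dag \<delta> (N \<omega>)) (U \<delta> \<omega>)"
    and mu_subgrad: "\<And>\<delta> \<omega>. \<delta> > 0 \<Longrightarrow> \<omega> \<in> space M \<Longrightarrow>
                  \<mu> \<delta> \<omega> \<in> TV_subdifferential X (U \<delta> \<omega>)"
    and mu_opt: "\<And>\<delta> \<omega>. \<delta> > 0 \<Longrightarrow> \<omega> \<in> space M \<Longrightarrow>
                  optimality_condition X K (\<alpha> \<delta>) (noisy_data K u_dag \<delta> (N \<omega>)) (U \<delta> \<omega>) (\<mu> \<delta> \<omega>)"
  shows "(\<forall>\<^sub>F \<delta> in at_right 0. integrable M (\<lambda>\<omega>. sym_bregman (\<mu> \<delta> \<omega>) \<mu>_dag (U \<delta> \<omega>) u_dag)) \<and>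
         (if r1 \<le> (d + 2 * \<epsilon>) / t
          then (\<lambda>\<delta>. \<integral>\<omega>. sym_bregman (\<mu> \<delta> \<omega>) \<mu>_dag (U \<delta> \<omega>) u_dag \<partial>M)
                 \<in> O[at_right 0](\<lambda>\<delta>. \<delta> powr (1 / ((2 + r1) * (1 - \<nu>)))) \<and>
               (\<forall>\<delta>. 0 < \<delta> \<and> \<delta> < 1 \<longrightarrow>
                  \<delta> powr (1 / ((2 + r1) * (1 - \<nu>))) \<le> \<delta> powr (1 / (2 + r1)))
          else (\<lambda>\<delta>. \<integral>\<omega>. sym_bregman (\<mu> \<delta> \<omega>) \<mu>_dag (U \<delta> \<omega>) u_dag \<partial>M)
                 \<in> O[at_right 0](\<lambda>\<delta>. \<delta> powr (1 / (1 + r1))))"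
proof -
  define s where "s = d / 2 + \<epsilon>"
  have d0: "0 < d" using d_def by simp
  have s: "0 < s" "s < t" "d < 2 * s" using t_gt eps d0 by (auto simp: s_def)
  obtain c where c: "0 < c" "\<And>u. u \<in> X \<Longrightarrow> c * L2_norm u \<le> TV u" using X_embed by auto
  have cd: "CARD('d) \<le> 2" using d_le d_def by simp
  have N: "white_noise M (- s) N" using noise by (simp add: s_def)
  interpret prob_space M by (rule prob)
  interpret tv_problem M s N K Kext t Kstar X c u_dag \<mu>_dag
    by unfold_locales (use N K_ext K_bij s cd K_adj X_space X_BV c u_dag mu_dag d_def in auto)
  have sol: "solution \<delta> (\<alpha> \<delta>) \<omega> (U \<delta> \<omega>) (\<mu> \<delta> \<omega>)" if "0 < \<delta>" "\<omega> \<in> space M" for \<delta> \<omega>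
    using U_min[OF that] mu_subgrad[OF that] mu_opt[OF that] by (simp add: solution_def tikhonov_minimizer_def)
  obtain Cs \<beta>0 where src: "0 \<le> Cs" "0 < \<beta>0" "\<And>\<beta>. 0 < \<beta> \<Longrightarrow> \<beta> < \<beta>0 \<Longrightarrow> \<exists>W\<ge>0. W\<^sup>2 \<le> Cs * \<beta> powr (- r1) \<and> (\<forall>u\<in>X. \<bar>\<mu>_dag u\<bar> \<le> W * L2_norm (K u) + \<beta> * TV u)"
    by (rule approx_source_bound[OF X_space X_BV subdiff_dual[OF mu_dag] K_L2 K_adj source]) (assumption, rule that)
  define \<rho> where "\<rho> = (if r1 \<le> (d + 2 * \<epsilon>) / t then 1 / ((2 + r1) * (1 - \<nu>)) else 1 / (1 + r1))"
  have t0: "0 < t" using s by linarith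
  have nu: "1 - \<nu> = (t + s) / (2 * t)" using t0 by (simp add: nu_def s_def field_simps)
  have nu_pos: "0 < 1 - \<nu>" unfolding nu using t0 s by simp
  have nu_less: "1 - \<nu> < 1" unfolding nu using t0 s by simp
  have \<rho>0: "0 < \<rho>" using r1 nu_pos by (simp add: \<rho>_def)
  have \<kappa>: "\<kappa> = (1 + r1) * \<rho>" using r1 by (simp add: kappa_def \<rho>_def)
  have \<kappa>_le: "\<kappa> \<le> 2 * t / (t + s)"
  proof (cases "r1 \<le> (d + 2 * \<epsilon>) / t")
    case True
    have "\<kappa> = (1 + r1) / (2 + r1) * (1 / (1 - \<nu>))" using True by (simp add: kappa_def)
    also have "\<dots> \<le> 1 * (1 / (1 - \<nu>))" using r1 nu_pos by (intro mult_right_mono) auto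
    finally show ?thesis using t0 s by (simp add: nu)
  next
    case False
    then show ?thesis using t0 s by (simp add: kappa_def)
  qed
  \<comment> \<open>in the second case the threshold enters here: it implies \<open>d < r1 * t\<close>\<close>
  have gap: "(2 + r1) * \<rho> * (t + d) < 2 * t + d"
  proof (cases "r1 \<le> (d + 2 * \<epsilon>) / t")
    case True
    then have "(2 + r1) * \<rho> = 2 * t / (t + s)" using r1 by (simp add: \<rho>_def nu)
    moreover have "2 * t * (t + d) < (2 * t + d) * (t + s)"
    proof -
      have "0 < 2 * t * (s - d / 2) + d * s" using t0 d0 s by (intro add_pos_pos mult_pos_pos) auto
      then show ?thesis by (simp add: algebra_simps)
    qed
    ultimately show ?thesis using t0 s by (simp add: pos_divide_less_eq)
  next
    case False
    then have "(2 * s) / t < r1" by (simp add: s_def)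
    then have r: "2 * s < r1 * t" using t0 by (simp add: pos_divide_less_eq)
    have eq: "(2 + r1) * \<rho> = (2 + r1) / (1 + r1)" using False by (simp add: \<rho>_def)
    have "d < r1 * t" using r s by linarith
    then have "(2 + r1) * (t + d) < (2 * t + d) * (1 + r1)" by (simp add: algebra_simps)
    then show ?thesis unfolding eq using r1 by (simp add: pos_divide_less_eq)
  qed
  obtain c1 c2 where c12: "0 < c1" "\<forall>\<^sub>F \<delta> in at_right 0. c1 * \<delta> powr \<kappa> \<le> \<alpha> \<delta> \<and> \<alpha> \<delta> \<le> c2 * \<delta> powr \<kappa>"
  proof -
    have O: "\<alpha> \<in> O[at_right 0](\<lambda>\<delta>. \<delta> powr \<kappa>)" and Om: "\<alpha> \<in> \<Omega>[at_right 0](\<lambda>\<delta>. \<delta> powr \<kappa>)"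
      using alpha_choice by (auto simp: bigtheta_def)
    obtain c2 where c2: "\<forall>\<^sub>F \<delta> in at_right 0. norm (\<alpha> \<delta>) \<le> c2 * norm (\<delta> powr \<kappa>)"
      using landau_o.bigE[OF O] by blast
    obtain c1 where c1: "0 < c1" "\<forall>\<^sub>F \<delta> in at_right 0. norm (\<alpha> \<delta>) \<ge> c1 * norm (\<delta> powr \<kappa>)"
      using landau_omega.bigE[OF Om] by blast
    have "\<forall>\<^sub>F \<delta> in at_right (0::real). 0 < \<delta>" by (rule eventually_at_right_less)
    then have "\<forall>\<^sub>F \<delta> in at_right 0. c1 * \<delta> powr \<kappa> \<le> \<alpha> \<delta> \<and> \<alpha> \<delta> \<le> c2 * \<delta> powr \<kappa>"
      using c1(2) c2
    proof eventually_elim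
      case (elim \<delta>)
      then show ?case using alpha_pos[OF elim(1)] by simp
    qed
    then show ?thesis using c1(1) that by blast
  qed
  let ?D = "\<lambda>\<delta> \<omega>. sym_bregman (\<mu> \<delta> \<omega>) \<mu>_dag (U \<delta> \<omega>) u_dag"
  obtain C where C: "\<forall>\<^sub>F \<delta> in at_right 0. integrable M (?D \<delta>) \<and> 0 \<le> (\<integral>\<omega>. ?D \<delta> \<omega> \<partial>M) \<and> (\<integral>\<omega>. ?D \<delta> \<omega> \<partial>M) \<le> C * \<delta> powr \<rho>"
    using expected_rate[OF d_def r1 \<rho>0 \<kappa> \<kappa>_le gap c12 sol src] by blast
  have int: "\<forall>\<^sub>F \<delta> in at_right 0. integrable M (?D \<delta>)" using C by eventually_elim blast
  have bigo: "(\<lambda>\<delta>. \<integral>\<omega>. ?D \<delta> \<omega> \<partial>M) \<in> O[at_right 0](\<lambda>\<delta>. \<delta> powr \<rho>)"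
  proof (rule bigoI[of _ C])
    show "\<forall>\<^sub>F \<delta> in at_right 0. norm (\<integral>\<omega>. ?D \<delta> \<omega> \<partial>M) \<le> C * norm (\<delta> powr \<rho>)"
      using C by eventually_elim simp
  qed
  have rate: "\<delta> powr (1 / ((2 + r1) * (1 - \<nu>))) \<le> \<delta> powr (1 / (2 + r1))" if "0 < \<delta> \<and> \<delta> < 1" for \<delta>
  proof (rule powr_le_of_exponent_ge)
    have "(2 + r1) * (1 - \<nu>) \<le> (2 + r1) * 1" using r1 nu_less by (intro mult_left_mono) auto
    then show "1 / (2 + r1) \<le> 1 / ((2 + r1) * (1 - \<nu>))" using r1 nu_pos by (intro divide_left_mono) auto
  qed (use that in auto)
  show ?thesis using int bigo rate unfolding \<rho>_def by (cases "r1 \<le> (d + 2 * \<epsilon>) / t") simp_all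
qed

end
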